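(* Let $g\in H$, $g\ne0$, be an eigenvector of the Stokes operator, $Ag=\lambda g$ with $\lambda>0$. Then $0\notin\mathcal{A}_g$, where $\mathcal{A}_g$ is the global attractor of the 2D periodic Navier-Stokes equations $\frac{du}{dt}+\nu Au+B(u,u)=g$.
   Context: Fix $L>0$, $\nu>0$, $\Omega=[0,L]^2$. $H$ is the closure in $[L^2(\Omega)]^2$ of the $\Omega$-periodic $\mathbb{R}^2$-valued trigonometric polynomials $v$ with $\nabla\cdot v=0$ and $\int_\Omega v\,dx=0$; $|\cdot|$ denotes the $L^2$ norm. $\mathcal{P}$ is the orthogonal (Helmholtz-Leray) projection of $[L^2(\Omega)]^2$ onto $H$; $A=-\mathcal{P}\Delta$ $(=-\Delta)$ is the Stokes operator; $B(u,v)=\mathcal{P}((u\cdot\nabla)v)$. The global attractor $\mathcal{A}_g$ is the set of all $u_0\in H$ for which there exists a solution $u(t)$ of $\frac{du}{dt}+\nu Au+B(u,u)=g$ defined for all $t\in\mathbb{R}$ with $u(0)=u_0$ and $\sup_{t\in\mathbb{R}}|u(t)|<\infty$. *)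

theory Defs
  imports "HOL-Analysis.Analysis"
begin

type_synonym field2 = "real^2 \<Rightarrow> real^2"

(* Elements of [L^2(Omega)]^2 are represented by functions on the whole plane of which only the
   values on the cell Omega = [0,L]^2 matter; equality in L^2 is equality almost everywhere on
   the cell, and every notion below is invariant under it. *)

abbreviation cell :: "real \<Rightarrow> (real^2) measure" where
  "cell L \<equiv> lebesgue_on (cbox 0 (vec L))"

definition L2 :: "real \<Rightarrow> field2 set" where
  "L2 L = {u. u \<in> borel_measurable (cell L) \<and> integrable (cell L) (\<lambda>x. (norm (u x))\<^sup>2)}"

definition l2_inner :: "real \<Rightarrow> field2 \<Rightarrow> field2 \<Rightarrow> real" where
  "l2_inner L u v = (\<integral>x. u x \<bullet> v x \<partial>cell L)"

definition l2_norm :: "real \<Rightarrow> field2 \<Rightarrow> real" where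
  "l2_norm L u = sqrt (l2_inner L u u)"

definition partial :: "2 \<Rightarrow> field2 \<Rightarrow> field2" where
  "partial j f x = vector_derivative (\<lambda>s. f (x + s *\<^sub>R axis j 1)) (at 0)"

definition divergence :: "field2 \<Rightarrow> real^2 \<Rightarrow> real" where
  "divergence v x = (\<Sum>j\<in>UNIV. partial j v x $ j)"

definition laplacian :: "field2 \<Rightarrow> field2" where
  "laplacian v x = (\<Sum>j\<in>UNIV. partial j (partial j v) x)"

definition phase :: "real \<Rightarrow> int^2 \<Rightarrow> real^2 \<Rightarrow> real" where
  "phase L k x = 2 * pi / L * (\<Sum>j\<in>UNIV. of_int (k $ j) * x $ j)"

definition trig_polys :: "real \<Rightarrow> field2 set" where
  "trig_polys L = {v. \<exists>K a b. finite K \<and>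
     v = (\<lambda>x. \<Sum>k\<in>K. cos (phase L k x) *\<^sub>R a k + sin (phase L k x) *\<^sub>R b k)}"

definition solenoidal_polys :: "real \<Rightarrow> field2 set" where
  "solenoidal_polys L =
     {v \<in> trig_polys L. (\<forall>x. divergence v x = 0) \<and> (\<integral>x. v x \<partial>cell L) = 0}"

definition H_space :: "real \<Rightarrow> field2 set" where
  "H_space L = {u \<in> L2 L. \<forall>e>0. \<exists>v\<in>solenoidal_polys L. l2_norm L (\<lambda>x. u x - v x) < e}"

(* Graph of the orthogonal projection P of [L^2]^2 onto H: w = P f. *)
definition leray_proj :: "real \<Rightarrow> field2 \<Rightarrow> field2 \<Rightarrow> bool" where
  "leray_proj L f w \<longleftrightarrow> f \<in> L2 L \<and> w \<in> H_space L \<and>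
     (\<forall>v\<in>H_space L. l2_inner L (\<lambda>x. f x - w x) v = 0)"

(* Derivatives of periodic distributions.  Trigonometric polynomials are dense in the smooth
   periodic functions, so testing against them is enough. *)
definition weak_partial :: "real \<Rightarrow> 2 \<Rightarrow> field2 \<Rightarrow> field2 \<Rightarrow> bool" where
  "weak_partial L j u w \<longleftrightarrow> u \<in> L2 L \<and> w \<in> L2 L \<and>
     (\<forall>\<phi>\<in>trig_polys L. l2_inner L u (partial j \<phi>) = - l2_inner L w \<phi>)"

definition weak_laplacian :: "real \<Rightarrow> field2 \<Rightarrow> field2 \<Rightarrow> bool" where
  "weak_laplacian L u w \<longleftrightarrow> u \<in> L2 L \<and> w \<in> L2 L \<and>
     (\<forall>\<phi>\<in>trig_polys L. l2_inner L u (laplacian \<phi>) = l2_inner L w \<phi>)"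

(* Graph of the Stokes operator A = -P Laplacian, with domain D(A) = {u in H. Laplacian u in L^2}:
   f = A u. *)
definition stokes :: "real \<Rightarrow> field2 \<Rightarrow> field2 \<Rightarrow> bool" where
  "stokes L u f \<longleftrightarrow> u \<in> H_space L \<and>
     (\<exists>w. weak_laplacian L u w \<and> leray_proj L (\<lambda>x. - w x) f)"

definition V_space :: "real \<Rightarrow> field2 set" where
  "V_space L = {u \<in> H_space L. \<forall>j. \<exists>w. weak_partial L j u w}"

(* The weak derivative is unique up to null sets; wpartial is only used on V_space. *)
definition wpartial :: "real \<Rightarrow> 2 \<Rightarrow> field2 \<Rightarrow> field2" where
  "wpartial L j u = (SOME w. weak_partial L j u w)"

definition convection :: "real \<Rightarrow> field2 \<Rightarrow> field2 \<Rightarrow> field2" where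
  "convection L u v x = (\<Sum>j\<in>UNIV. (u x $ j) *\<^sub>R wpartial L j v x)"

(* For u, v in V the elements A u and B(u,v) = P((u . nabla) v) of the dual V' act on a test field
   phi in V as follows: integrate by parts in A u, and use that P is symmetric with P phi = phi.
   For smooth u, v these are the L^2 inner products of A u and B(u,v) with phi. *)
definition stokes_dual :: "real \<Rightarrow> field2 \<Rightarrow> field2 \<Rightarrow> real" where
  "stokes_dual L u \<phi> = (\<Sum>j\<in>UNIV. l2_inner L (wpartial L j u) (wpartial L j \<phi>))"

definition B_dual :: "real \<Rightarrow> field2 \<Rightarrow> field2 \<Rightarrow> field2 \<Rightarrow> real" where
  "B_dual L u v \<phi> = l2_inner L (convection L u v) \<phi>"

(* Weak solutions of du/dt + nu A u + B(u,u) = g on the whole time line: u in C(R;H) and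
   L^2_loc(R;V), with the equation holding in V' in its time-integrated form.  By density of
   solenoidal_polys in V, it is enough to test with them. *)
definition nse_solution :: "real \<Rightarrow> real \<Rightarrow> field2 \<Rightarrow> (real \<Rightarrow> field2) \<Rightarrow> bool" where
  "nse_solution L \<nu> g u \<longleftrightarrow>
     (\<forall>t. u t \<in> H_space L) \<and>
     (\<forall>t. ((\<lambda>s. l2_norm L (\<lambda>x. u s x - u t x)) \<longlongrightarrow> 0) (at t)) \<and>
     (AE t in lebesgue. u t \<in> V_space L) \<and>
     (\<forall>a b. integrable (lebesgue_on {a..b}) (\<lambda>t. stokes_dual L (u t) (u t))) \<and>
     (\<forall>\<phi>\<in>solenoidal_polys L. \<forall>a b. a \<le> b \<longrightarrow>
        l2_inner L (u b) \<phi> - l2_inner L (u a) \<phi>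
        + (\<integral>t. \<nu> * stokes_dual L (u t) \<phi> + B_dual L (u t) (u t) \<phi> \<partial>lebesgue_on {a..b})
        = (b - a) * l2_inner L g \<phi>)"

definition global_attractor :: "real \<Rightarrow> real \<Rightarrow> field2 \<Rightarrow> field2 set" where
  "global_attractor L \<nu> g = {u0 \<in> H_space L. \<exists>u. nse_solution L \<nu> g u \<and> u 0 = u0 \<and>
     bdd_above (range (\<lambda>t. l2_norm L (u t)))}"

end

(* Let w_k be the Fourier coefficients of the vorticity and w' + nu |k|^2 w + N(w) = g the equation, with g
   supported on the shell |k|^2 = mu.  Formally Z = sum (|k|^2 - mu) |w_k|^2 / |k|^2 (enstrophy minus mu times
   energy) does not see the forcing, because both quantities receive multiples of the same work term, and
   Z' + 2 nu mu Z = - 2 nu sum (|k|^2 - mu)^2 |w_k|^2 / |k|^2.  So exp(2 nu mu t) Z is nonincreasing; it tends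
   to 0 as t -> - infinity along times of bounded enstrophy and vanishes at t = 0 if w(0) = 0.  Hence w(t) lives
   on the shell for t <= 0, where N(w) = 0, and the remaining linear equation has no bounded backward solution.

   For weak solutions the weight |k|^2 - mu is replaced by (|k|^2 - mu) / (1 + eps |k|^2).  After
   antisymmetrisation over the three wave numbers j + l + m = 0 the nonlinear term carries eps times a
   Vandermonde determinant in |j|^2, |l|^2, |m|^2.  A discrete Ladyzhenskaya inequality then bounds it by
   sqrt eps |z| D with z = w / sqrt (1 + eps |k|^2) and D the dissipation; sqrt eps |z| tends to 0 uniformly on
   compact time intervals because the orbit is compact in H.  So no regularity theory is needed. *)
theory Submission
  imports Defs
begin

section \<open>Ladyzhenskaya's inequality on the lattice\<close>


type_synonym idx = "int \<times> int"

definition n2 :: "idx \<Rightarrow> real" where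
  "n2 k = (of_int (fst k))\<^sup>2 + (of_int (snd k))\<^sup>2"

definition crs :: "idx \<Rightarrow> idx \<Rightarrow> real" where
  "crs j k = of_int (fst j) * of_int (snd k) - of_int (snd j) * of_int (fst k)"

lemma n2_nonneg [simp]: "0 \<le> n2 k"
  by (simp add: n2_def)

lemma n2_0 [simp]: "n2 0 = 0"
  by (simp add: n2_def)

lemma n2_eq_0_iff [simp]: "n2 k = 0 \<longleftrightarrow> k = 0"
  by (cases k) (auto simp: n2_def sum_power2_eq_zero_iff zero_prod_def)

lemma n2_ge_1: "k \<noteq> 0 \<Longrightarrow> 1 \<le> n2 k"
proof -
  assume "k \<noteq> 0"
  have "n2 k = of_int ((fst k)\<^sup>2 + (snd k)\<^sup>2)" by (simp add: n2_def)
  moreover have "0 < (fst k)\<^sup>2 + (snd k)\<^sup>2"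
    using \<open>k \<noteq> 0\<close> by (cases k) (auto simp: zero_prod_def sum_power2_gt_zero_iff)
  ultimately show ?thesis by linarith
qed

lemma n2_uminus [simp]: "n2 (- k) = n2 k"
  by (simp add: n2_def)

lemma crs_sq_le: "(crs j k)\<^sup>2 \<le> n2 j * n2 k"
proof -
  have "n2 j * n2 k - (crs j k)\<^sup>2 = (of_int (fst j) * of_int (fst k) + of_int (snd j) * of_int (snd k))\<^sup>2"
    by (simp add: n2_def crs_def power2_eq_square algebra_simps)
  then show ?thesis by (metis diff_ge_0_iff_ge zero_le_power2)
qed

lemma abs_crs_le: "\<bar>crs j k\<bar> \<le> sqrt (n2 j) * sqrt (n2 k)"
  using crs_sq_le[of j k] by (metis real_sqrt_abs real_sqrt_le_iff real_sqrt_mult)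

lemma sqrt_n2_triangle: "sqrt (n2 (- j - k)) \<le> sqrt (n2 j) + sqrt (n2 k)"
proof -
  have *: "sqrt (n2 p) = norm (of_int (fst p) :: real, of_int (snd p) :: real)" for p
    by (simp add: norm_Pair n2_def)
  have "norm (of_int (fst (- j - k)) :: real, of_int (snd (- j - k)) :: real)
     = norm ((of_int (fst j) :: real, of_int (snd j) :: real) + (of_int (fst k), of_int (snd k)))"
    by (subst norm_minus_cancel[symmetric]) (simp add: algebra_simps)
  also have "\<dots> \<le> norm (of_int (fst j) :: real, of_int (snd j) :: real) + norm (of_int (fst k) :: real, of_int (snd k) :: real)"
    by (rule norm_triangle_ineq)
  finally show ?thesis by (simp only: *)
qed

lemma sum_lorentz_nat:
  fixes R :: real
  assumes "R > 0"
  shows "(\<Sum>i<n. R / (R\<^sup>2 + (real (Suc i))\<^sup>2)) \<le> arctan (real n / R)"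
proof (induction n)
  case (Suc n)
  have "\<exists>x>real n. x < real (Suc n) \<and> arctan (real (Suc n) / R) - arctan (real n / R)
      = (real (Suc n) - real n) * (R / (R\<^sup>2 + x\<^sup>2))"
  proof (rule MVT2)
    fix x :: real
    have "((\<lambda>x. arctan (x / R)) has_real_derivative (inverse (1 + (x/R)\<^sup>2) * (1 / R))) (at x)"
      using assms by (auto intro!: derivative_eq_intros)
    moreover have "inverse (1 + (x/R)\<^sup>2) * (1 / R) = R / (R\<^sup>2 + x\<^sup>2)"
    proof -
      have "R \<noteq> 0" using assms by simp
      then have "1 + (x/R)\<^sup>2 = (R\<^sup>2 + x\<^sup>2) / R\<^sup>2" by (simp add: power_divide add_divide_distrib)
      then show ?thesis using \<open>R \<noteq> 0\<close> by (simp add: power2_eq_square)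
    qed
    ultimately show "((\<lambda>x. arctan (x / R)) has_real_derivative R / (R\<^sup>2 + x\<^sup>2)) (at x)" by simp
  qed simp
  then obtain x where x: "real n < x" "x < real (Suc n)"
    "arctan (real (Suc n) / R) - arctan (real n / R) = R / (R\<^sup>2 + x\<^sup>2)" by auto
  have "R / (R\<^sup>2 + (real (Suc n))\<^sup>2) \<le> R / (R\<^sup>2 + x\<^sup>2)"
    using x assms by (intro divide_left_mono add_left_mono power_mono mult_pos_pos add_pos_nonneg) auto
  with Suc x show ?case by simp
qed simp

lemma sum_lorentz_int:
  fixes R :: real and F :: "int set"
  assumes "R \<ge> 1" "finite F"
  shows "(\<Sum>q\<in>F. R / (R\<^sup>2 + (of_int q)\<^sup>2)) \<le> 5"
proof -
  define N where "N = nat (Max (insert 0 (abs ` F)))"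
  let ?f = "\<lambda>q::int. R / (R\<^sup>2 + (of_int q)\<^sup>2)"
  have N: "\<bar>q\<bar> \<le> int N" if "q \<in> F" for q
  proof -
    have "\<bar>q\<bar> \<le> Max (insert 0 (abs ` F))" using assms that by (intro Max_ge) auto
    moreover have "0 \<le> Max (insert 0 (abs ` F))" using assms by (intro Max_ge) auto
    ultimately show ?thesis unfolding N_def by simp
  qed
  let ?p = "\<lambda>i. 1 + int i"
  have F: "F \<subseteq> {0} \<union> (?p ` {..<N} \<union> (\<lambda>i. - ?p i) ` {..<N})"
  proof
    fix q assume "q \<in> F"
    then have "\<bar>q\<bar> \<le> int N" by (rule N)
    then consider "q = 0" | "q = ?p (nat (q - 1))" "nat (q-1) < N" | "q = - ?p (nat (- q - 1))" "nat (-q-1) < N"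
      by linarith
    then show "q \<in> {0} \<union> (?p ` {..<N} \<union> (\<lambda>i. - ?p i) ` {..<N})"
      by cases blast+
  qed
  have nn: "0 \<le> ?f q" for q using assms by (auto intro!: divide_nonneg_nonneg)
  have half: "(\<Sum>i<N. ?f (?p i)) \<le> 2"
  proof -
    have "(\<Sum>i<N. ?f (?p i)) \<le> arctan (real N / R)"
      using sum_lorentz_nat[of R N] assms by simp
    also have "\<dots> \<le> 2" using arctan_ubound[of "real N / R"] pi_less_4 by linarith
    finally show ?thesis .
  qed
  have "sum ?f F \<le> sum ?f ({0} \<union> (?p ` {..<N} \<union> (\<lambda>i. - ?p i) ` {..<N}))"
    by (intro sum_mono2 F) (auto simp: nn)
  also have "\<dots> \<le> sum ?f {0} + (sum ?f (?p ` {..<N}) + sum ?f ((\<lambda>i. - ?p i) ` {..<N}))"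
  proof -
    have un: "sum ?f (A \<union> B) \<le> sum ?f A + sum ?f B" if "finite A" "finite B" for A B
      using sum.union_inter[OF that, of ?f] sum_nonneg[of "A \<inter> B" ?f] nn by simp
    show ?thesis by (intro order_trans[OF un] add_left_mono un) auto
  qed
  also have "sum ?f (?p ` {..<N}) = (\<Sum>i<N. ?f (?p i))"
    by (subst sum.reindex) (auto simp: inj_on_def)
  also have "sum ?f ((\<lambda>i. - ?p i) ` {..<N}) = (\<Sum>i<N. ?f (?p i))"
    by (subst sum.reindex) (auto simp: inj_on_def power2_eq_square algebra_simps)
  also have "sum ?f {0} \<le> 1" using assms by (simp add: power2_eq_square)
  finally show ?thesis using half by linarith
qed

lemma sum_mult_le_sqrt:
  fixes a b :: "'a \<Rightarrow> real"
  assumes "(\<Sum>i\<in>I. (a i)\<^sup>2) \<le> A" "(\<Sum>i\<in>I. (b i)\<^sup>2) \<le> B"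
  shows "(\<Sum>i\<in>I. a i * b i) \<le> sqrt A * sqrt B"
proof -
  have "(\<Sum>i\<in>I. a i * b i)\<^sup>2 \<le> (\<Sum>i\<in>I. (a i)\<^sup>2) * (\<Sum>i\<in>I. (b i)\<^sup>2)"
    by (rule Cauchy_Schwarz_ineq_sum)
  also have "\<dots> \<le> A * B"
  proof (rule mult_mono[OF assms])
    show "0 \<le> A" using assms(1) by (rule order_trans[rotated]) (simp add: sum_nonneg)
  qed (simp add: sum_nonneg)
  finally show ?thesis
    unfolding real_sqrt_mult[symmetric] by (rule real_le_rsqrt)
qed

lemma anisotropic_sum_bound:
  fixes A :: "int \<Rightarrow> real"
  assumes "finite I" "0 < X" "X \<le> Y" "\<And>q. 0 \<le> A q"
    and X: "(\<Sum>q\<in>I. (A q)\<^sup>2) \<le> X" and Y: "(\<Sum>q\<in>I. (of_int q)\<^sup>2 * (A q)\<^sup>2) \<le> Y"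
  shows "(\<Sum>q\<in>I. A q) \<le> sqrt 10 * sqrt (sqrt X * sqrt Y)"
proof -
  define R where "R = sqrt Y / sqrt X"
  have R: "R \<ge> 1" using assms by (simp add: R_def)
  have Rpos: "R > 0" using R by simp
  let ?h = "\<lambda>q::int. R / (R\<^sup>2 + (of_int q)\<^sup>2)"
  have hp: "0 < ?h q" for q using Rpos by (intro divide_pos_pos add_pos_nonneg) auto
  have "(\<Sum>q\<in>I. A q) = (\<Sum>q\<in>I. sqrt (?h q) * (A q / sqrt (?h q)))"
  proof (intro sum.cong refl)
    fix q show "A q = sqrt (?h q) * (A q / sqrt (?h q))"
      using hp[of q] by (metis less_irrefl nonzero_mult_div_cancel_left real_sqrt_eq_zero_cancel_iff times_divide_eq_right)
  qed
  also have "\<dots> \<le> sqrt 5 * sqrt (sqrt X * sqrt Y + sqrt X * sqrt Y)"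
  proof (rule sum_mult_le_sqrt)
    show "(\<Sum>q\<in>I. (sqrt (?h q))\<^sup>2) \<le> 5"
      using sum_lorentz_int[OF R \<open>finite I\<close>] hp by (simp add: less_imp_le)
    have "(\<Sum>q\<in>I. (A q / sqrt (?h q))\<^sup>2) = (\<Sum>q\<in>I. R * (A q)\<^sup>2 + (1/R) * ((of_int q)\<^sup>2 * (A q)\<^sup>2))"
    proof (intro sum.cong refl)
      fix q
      have "(A q / sqrt (?h q))\<^sup>2 = (A q)\<^sup>2 / ?h q"
        using hp[of q] by (simp add: power_divide)
      also have "\<dots> = R * (A q)\<^sup>2 + (1/R) * ((of_int q)\<^sup>2 * (A q)\<^sup>2)"
        using Rpos by (simp add: field_simps power2_eq_square)
      finally show "(A q / sqrt (?h q))\<^sup>2 = R * (A q)\<^sup>2 + (1/R) * ((of_int q)\<^sup>2 * (A q)\<^sup>2)" .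
    qed
    also have "\<dots> = R * (\<Sum>q\<in>I. (A q)\<^sup>2) + (1/R) * (\<Sum>q\<in>I. (of_int q)\<^sup>2 * (A q)\<^sup>2)"
      by (simp only: sum.distrib sum_distrib_left)
    also have "\<dots> \<le> R * X + (1/R) * Y"
      using X Y Rpos by (intro add_mono mult_left_mono) auto
    also have "R * X = sqrt X * sqrt Y"
      using assms by (simp add: R_def field_simps)
    also have "(1/R) * Y = sqrt X * sqrt Y"
      using assms by (simp add: R_def field_simps)
    finally show "(\<Sum>q\<in>I. (A q / sqrt (?h q))\<^sup>2) \<le> sqrt X * sqrt Y + sqrt X * sqrt Y" .
  qed
  also have "\<dots> = sqrt 10 * sqrt (sqrt X * sqrt Y)"
  proof -
    have "sqrt 5 * sqrt (2 * (sqrt X * sqrt Y)) = sqrt (5 * (2 * (sqrt X * sqrt Y)))"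
      by (rule real_sqrt_mult[symmetric])
    also have "\<dots> = sqrt (10 * (sqrt X * sqrt Y))" by simp
    also have "\<dots> = sqrt 10 * sqrt (sqrt X * sqrt Y)" by (rule real_sqrt_mult)
    finally show ?thesis by simp
  qed
  finally show ?thesis .
qed

text \<open>Discrete form of Ladyzhenskaya's inequality: for fixed \<open>j\<^sub>2\<close> and \<open>m\<^sub>1\<close> the map
  \<open>(j\<^sub>1, m\<^sub>2) \<mapsto> -j-m\<close> is injective, so the Cauchy--Schwarz inequality leaves a product of two
  one-dimensional sums.\<close>
lemma trilinear_sum_bound:
  fixes z b :: "idx \<Rightarrow> real"
  assumes z0: "\<And>k. 0 \<le> z k" and b0: "\<And>k. 0 \<le> b k" and zz: "z 0 = 0"
    and X: "\<And>F. finite F \<Longrightarrow> (\<Sum>k\<in>F. (z k)\<^sup>2) \<le> X"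
    and Y: "\<And>F. finite F \<Longrightarrow> (\<Sum>k\<in>F. n2 k * (z k)\<^sup>2) \<le> Y"
    and B: "\<And>F. finite F \<Longrightarrow> (\<Sum>k\<in>F. (b k)\<^sup>2) \<le> \<beta>"
    and F: "finite F"
  shows "(\<Sum>(j,m)\<in>F. b (- j - m) * z j * z m) \<le> 10 * sqrt \<beta> * sqrt X * sqrt Y"
proof -
  have X0: "0 \<le> X" using X[of "{}"] by simp
  have Y0: "0 \<le> Y" using Y[of "{}"] by simp
  have B0: "0 \<le> \<beta>" using B[of "{}"] by simp
  define X' where "X' = min X Y"
  have X': "(\<Sum>k\<in>F. (z k)\<^sup>2) \<le> X'" if "finite F" for F
  proof -
    have "(\<Sum>k\<in>F. (z k)\<^sup>2) \<le> (\<Sum>k\<in>F. n2 k * (z k)\<^sup>2)"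
    proof (rule sum_mono)
      fix k show "(z k)\<^sup>2 \<le> n2 k * (z k)\<^sup>2"
      proof (cases "k = 0")
        case False
        then show ?thesis using mult_right_mono[OF n2_ge_1, of k "(z k)\<^sup>2"] by simp
      qed (simp add: zz)
    qed
    then show ?thesis using X[OF that] Y[OF that] by (simp add: X'_def)
  qed
  show ?thesis
  proof (cases "X' = 0")
    case True
    have "z k = 0" for k using X'[of "{k}"] True by simp
    then show ?thesis using X0 Y0 B0 by (simp add: case_prod_unfold)
  next
    case False
    then have X'p: "0 < X'" using X0 Y0 by (simp add: X'_def min_def split: if_splits)
    have X'Y: "X' \<le> Y" by (simp add: X'_def)
    define I where "I = fst ` fst ` F \<union> snd ` fst ` F \<union> fst ` snd ` F \<union> snd ` snd ` F"
    have I: "finite I" using F by (simp add: I_def)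
    have FI: "F \<subseteq> (I \<times> I) \<times> (I \<times> I)" 
    proof
      fix x assume "x \<in> F"
      then have "fst (fst x) \<in> I" "snd (fst x) \<in> I" "fst (snd x) \<in> I" "snd (snd x) \<in> I"
        unfolding I_def by (blast intro: imageI)+
      then show "x \<in> (I \<times> I) \<times> (I \<times> I)" by (simp add: mem_Times_iff)
    qed
    define G where "G = (\<lambda>j m. b (- j - m) * z j * z m)"
    have G0: "0 \<le> G j m" for j m using z0 b0 by (simp add: G_def)
    define A where "A = (\<lambda>q. sqrt (\<Sum>p\<in>I. (z (p, q))\<^sup>2))"
    define C where "C = (\<lambda>p. sqrt (\<Sum>q\<in>I. (z (p, q))\<^sup>2))"
    have A2: "(A q)\<^sup>2 = (\<Sum>p\<in>I. (z (p, q))\<^sup>2)" for q by (simp add: A_def sum_nonneg)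
    have C2: "(C p)\<^sup>2 = (\<Sum>q\<in>I. (z (p, q))\<^sup>2)" for p by (simp add: C_def sum_nonneg)
    have AC0: "0 \<le> A q" "0 \<le> C q" for q by (simp_all add: A_def C_def sum_nonneg)
    have SA: "(\<Sum>q\<in>I. A q) \<le> sqrt 10 * sqrt (sqrt X' * sqrt Y)"
    proof (rule anisotropic_sum_bound[OF I X'p X'Y AC0(1)])
      have "(\<Sum>q\<in>I. (A q)\<^sup>2) = (\<Sum>k\<in>I\<times>I. (z k)\<^sup>2)"
        unfolding A2 by (subst sum.swap) (simp add: sum.cartesian_product case_prod_unfold)
      then show "(\<Sum>q\<in>I. (A q)\<^sup>2) \<le> X'" using X'[of "I\<times>I"] I by simp
      have "(\<Sum>q\<in>I. (of_int q)\<^sup>2 * (A q)\<^sup>2) = (\<Sum>k\<in>I\<times>I. (of_int (snd k))\<^sup>2 * (z k)\<^sup>2)"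
        unfolding A2 sum_distrib_left by (subst sum.swap) (simp add: sum.cartesian_product case_prod_unfold)
      also have "\<dots> \<le> (\<Sum>k\<in>I\<times>I. n2 k * (z k)\<^sup>2)"
        by (intro sum_mono mult_right_mono) (auto simp: n2_def)
      finally show "(\<Sum>q\<in>I. (of_int q)\<^sup>2 * (A q)\<^sup>2) \<le> Y" using Y[of "I\<times>I"] I by simp
    qed
    have SC: "(\<Sum>q\<in>I. C q) \<le> sqrt 10 * sqrt (sqrt X' * sqrt Y)"
    proof (rule anisotropic_sum_bound[OF I X'p X'Y AC0(2)])
      have "(\<Sum>q\<in>I. (C q)\<^sup>2) = (\<Sum>k\<in>I\<times>I. (z k)\<^sup>2)"
        unfolding C2 by (simp add: sum.cartesian_product case_prod_unfold)
      then show "(\<Sum>q\<in>I. (C q)\<^sup>2) \<le> X'" using X'[of "I\<times>I"] I by simp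
      have "(\<Sum>q\<in>I. (of_int q)\<^sup>2 * (C q)\<^sup>2) = (\<Sum>k\<in>I\<times>I. (of_int (fst k))\<^sup>2 * (z k)\<^sup>2)"
        unfolding C2 sum_distrib_left by (simp add: sum.cartesian_product case_prod_unfold)
      also have "\<dots> \<le> (\<Sum>k\<in>I\<times>I. n2 k * (z k)\<^sup>2)"
        by (intro sum_mono mult_right_mono) (auto simp: n2_def)
      finally show "(\<Sum>q\<in>I. (of_int q)\<^sup>2 * (C q)\<^sup>2) \<le> Y" using Y[of "I\<times>I"] I by simp
    qed
    have inner: "(\<Sum>(p,q)\<in>I\<times>I. G (p, j2) (m1, q)) \<le> sqrt \<beta> * (A j2 * C m1)" for j2 m1
    proof -
      have "(\<Sum>(p,q)\<in>I\<times>I. G (p, j2) (m1, q))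
          = (\<Sum>x\<in>I\<times>I. b (- (fst x, j2) - (m1, snd x)) * (z (fst x, j2) * z (m1, snd x)))"
        by (simp add: G_def case_prod_unfold mult.assoc)
      also have "\<dots> \<le> sqrt \<beta> * sqrt ((A j2)\<^sup>2 * (C m1)\<^sup>2)"
      proof (rule sum_mult_le_sqrt)
        let ?s = "\<lambda>x. - (fst x, j2) - (m1, snd x)"
        have "inj_on ?s (I\<times>I)" by (auto simp: inj_on_def)
        then have "(\<Sum>x\<in>I\<times>I. (b (?s x))\<^sup>2) = (\<Sum>k\<in>?s ` (I\<times>I). (b k)\<^sup>2)"
          by (simp add: sum.reindex)
        also have "\<dots> \<le> \<beta>" using I by (intro B) simp
        finally show "(\<Sum>x\<in>I\<times>I. (b (?s x))\<^sup>2) \<le> \<beta>" .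
        have "(A j2)\<^sup>2 * (C m1)\<^sup>2 = (\<Sum>x\<in>I\<times>I. (z (fst x, j2))\<^sup>2 * (z (m1, snd x))\<^sup>2)"
          unfolding A2 C2 sum_product by (simp add: sum.cartesian_product case_prod_unfold)
        then show "(\<Sum>x\<in>I\<times>I. (z (fst x, j2) * z (m1, snd x))\<^sup>2) \<le> (A j2)\<^sup>2 * (C m1)\<^sup>2"
          by (simp add: power_mult_distrib)
      qed
      also have "sqrt ((A j2)\<^sup>2 * (C m1)\<^sup>2) = A j2 * C m1"
        using AC0 by (simp add: real_sqrt_mult)
      finally show ?thesis .
    qed
    have "(\<Sum>(j,m)\<in>F. G j m) \<le> (\<Sum>(j,m)\<in>(I\<times>I)\<times>(I\<times>I). G j m)"
      using FI I by (intro sum_mono2) (auto simp: G0)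
    also have "\<dots> = (\<Sum>(j2,m1)\<in>I\<times>I. \<Sum>(p,q)\<in>I\<times>I. G (p, j2) (m1, q))"
    proof -
      have "(\<Sum>(j2,m1)\<in>I\<times>I. \<Sum>(p,q)\<in>I\<times>I. G (p, j2) (m1, q))
          = (\<Sum>((j2,m1),(p,q))\<in>(I\<times>I)\<times>(I\<times>I). G (p, j2) (m1, q))"
        by (simp add: sum.cartesian_product' case_prod_unfold)
      also have "\<dots> = (\<Sum>(j,m)\<in>(I\<times>I)\<times>(I\<times>I). G j m)"
        by (rule sum.reindex_bij_witness[where i = "\<lambda>((p,j2),(m1,q)). ((j2,m1),(p,q))"
             and j = "\<lambda>((j2,m1),(p,q)). ((p,j2),(m1,q))"]) auto
      finally show ?thesis by simp
    qed
    also have "\<dots> \<le> (\<Sum>(j2,m1)\<in>I\<times>I. sqrt \<beta> * (A j2 * C m1))"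
      using inner by (intro sum_mono) auto
    also have "\<dots> = sqrt \<beta> * ((\<Sum>q\<in>I. A q) * (\<Sum>q\<in>I. C q))"
      unfolding sum_product sum.cartesian_product by (simp add: sum_distrib_left case_prod_unfold)
    also have "\<dots> \<le> sqrt \<beta> * ((sqrt 10 * sqrt (sqrt X' * sqrt Y)) * (sqrt 10 * sqrt (sqrt X' * sqrt Y)))"
      using SA SC B0 AC0 X'p Y0 by (intro mult_left_mono mult_mono) (auto simp: sum_nonneg)
    also have "\<dots> = 10 * sqrt \<beta> * (sqrt X' * sqrt Y)"
    proof -
      have "sqrt (sqrt X' * sqrt Y) * sqrt (sqrt X' * sqrt Y) = sqrt X' * sqrt Y"
        using X'p Y0 by simp
      moreover have "sqrt 10 * sqrt 10 = (10::real)" by simp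
      moreover have "sqrt \<beta> * ((u * v) * (u * v)) = (u * u) * sqrt \<beta> * (v * v)" for u v :: real
        by (simp only: mult_ac)
      ultimately show ?thesis by (simp only:)
    qed
    also have "\<dots> \<le> 10 * sqrt \<beta> * (sqrt X * sqrt Y)"
      using B0 Y0 by (intro mult_left_mono mult_right_mono) (auto simp: X'_def)
    finally show ?thesis by (simp add: G_def mult.assoc)
  qed
qed

section \<open>Triad sums\<close>


lemma trilinear_summable:
  fixes z b :: "idx \<Rightarrow> real"
  assumes z0: "\<And>k. 0 \<le> z k" and b0: "\<And>k. 0 \<le> b k" and zz: "z 0 = 0"
    and X: "(\<lambda>k. (z k)\<^sup>2) summable_on UNIV"
    and Y: "(\<lambda>k. n2 k * (z k)\<^sup>2) summable_on UNIV"
    and B: "(\<lambda>k. (b k)\<^sup>2) summable_on UNIV"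
  shows "(\<lambda>(j,m). b (- j - m) * z j * z m) summable_on UNIV" (is ?S)
    and "(\<Sum>\<^sub>\<infinity>(j,m). b (- j - m) * z j * z m)
       \<le> 10 * sqrt (\<Sum>\<^sub>\<infinity>k. (b k)\<^sup>2) * sqrt (\<Sum>\<^sub>\<infinity>k. (z k)\<^sup>2) * sqrt (\<Sum>\<^sub>\<infinity>k. n2 k * (z k)\<^sup>2)"
proof -
  let ?C = "10 * sqrt (\<Sum>\<^sub>\<infinity>k. (b k)\<^sup>2) * sqrt (\<Sum>\<^sub>\<infinity>k. (z k)\<^sup>2) * sqrt (\<Sum>\<^sub>\<infinity>k. n2 k * (z k)\<^sup>2)"
  have le: "sum (\<lambda>(j,m). b (- j - m) * z j * z m) F \<le> ?C" if "finite F" for F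
    by (rule trilinear_sum_bound) (use z0 b0 zz that in \<open>auto intro!: finite_sum_le_infsum X Y B\<close>)
  show *: ?S
    by (rule nonneg_bdd_above_summable_on)
      (use z0 b0 le in \<open>auto intro!: bdd_aboveI simp: case_prod_unfold\<close>)
  show "(\<Sum>\<^sub>\<infinity>(j,m). b (- j - m) * z j * z m) \<le> ?C"
    by (rule infsum_le_finite_sums[OF *]) (use le in auto)
qed

lemma bij_idx_perms:
  "bij (\<lambda>(j::idx,m::idx). (m, j))" "bij (\<lambda>(j::idx,m::idx). (m, - j - m))"
  "bij (\<lambda>(j::idx,m::idx). (- j - m, m))" "bij (\<lambda>(j::idx,m::idx). (- j - m, j))"
  "bij (\<lambda>(j::idx,m::idx). (j, - j - m))"
proof -
  show "bij (\<lambda>(j::idx,m::idx). (m, j))"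
    by (rule bij_betw_byWitness[where f' = "\<lambda>(j,m). (m, j)"]) auto
  show "bij (\<lambda>(j::idx,m::idx). (m, - j - m))"
    by (rule bij_betw_byWitness[where f' = "\<lambda>(j,m). (- j - m, j)"]) auto
  show "bij (\<lambda>(j::idx,m::idx). (- j - m, m))"
    by (rule bij_betw_byWitness[where f' = "\<lambda>(j,m). (- j - m, m)"]) auto
  show "bij (\<lambda>(j::idx,m::idx). (- j - m, j))"
    by (rule bij_betw_byWitness[where f' = "\<lambda>(j,m). (m, - j - m)"]) auto
  show "bij (\<lambda>(j::idx,m::idx). (j, - j - m))"
    by (rule bij_betw_byWitness[where f' = "\<lambda>(j,m). (j, - j - m)"]) auto
qed

lemma infsum_idx_perm:
  fixes f :: "idx \<Rightarrow> idx \<Rightarrow> 'b::{comm_monoid_add,t2_space}"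
  assumes "bij (\<lambda>(j,m). (p j m, q j m))"
  shows "(\<Sum>\<^sub>\<infinity>(j,m). f (p j m) (q j m)) = (\<Sum>\<^sub>\<infinity>(j,m). f j m)"
    and "(\<lambda>(j,m). f (p j m) (q j m)) summable_on UNIV \<longleftrightarrow> (\<lambda>(j,m). f j m) summable_on UNIV"
  using infsum_reindex_bij_betw[OF assms, of "\<lambda>(j,m). f j m"]
    summable_on_reindex_bij_betw[OF assms, of "\<lambda>(j,m). f j m"]
  by (simp_all add: case_prod_unfold)

text \<open>Nonlinear contribution to the balance of \<open>\<Sum>k. \<theta> k * \<bar>\<omega> k\<bar>\<^sup>2 / n2 k\<close>, as a sum over triads \<open>j + m + l = 0\<close>.\<close>
definition transfer :: "(idx \<Rightarrow> real) \<Rightarrow> (idx \<Rightarrow> complex) \<Rightarrow> complex" where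
  "transfer \<theta> x = (\<Sum>\<^sub>\<infinity>(j,m). of_real (crs j m * \<theta> m / (n2 j * n2 m)) * (x j * x m * x (- j - m)))"

lemma velocity_sq:
  assumes "x 0 = 0"
  shows "n2 k * (cmod (x k) / sqrt (n2 k))\<^sup>2 = (cmod (x k))\<^sup>2"
  using assms by (cases "k = 0") (auto simp: power_divide)

lemma velocity_sq_le: "(cmod (x k) / sqrt (n2 k))\<^sup>2 \<le> (cmod (x k))\<^sup>2"
proof (cases "k = 0")
  case False
  then have "(cmod (x k))\<^sup>2 / n2 k \<le> (cmod (x k))\<^sup>2 / 1"
    by (intro divide_left_mono n2_ge_1) (auto intro: order_less_le_trans[OF _ n2_ge_1])
  then show ?thesis by (simp add: power_divide)
qed simp

lemma crs_div_le: "\<bar>crs j m\<bar> / (n2 j * n2 m) \<le> 1 / (sqrt (n2 j) * sqrt (n2 m))"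
proof (cases "j = 0 \<or> m = 0")
  case False
  then have p: "0 < n2 j" "0 < n2 m" by (auto simp: less_le)
  have "\<bar>crs j m\<bar> / (n2 j * n2 m) \<le> (sqrt (n2 j) * sqrt (n2 m)) / (n2 j * n2 m)"
    using p by (intro divide_right_mono abs_crs_le) auto
  also have "\<dots> = (sqrt (n2 j) / n2 j) * (sqrt (n2 m) / n2 m)" by simp
  also have "\<dots> = 1 / (sqrt (n2 j) * sqrt (n2 m))"
    using p by (simp add: sqrt_divide_self_eq inverse_eq_divide)
  finally show ?thesis .
qed auto

lemma transfer_summable:
  assumes x0: "x 0 = 0" and P: "(\<lambda>k. (cmod (x k))\<^sup>2) summable_on UNIV"
    and th: "\<And>k. \<bar>\<theta> k\<bar> \<le> \<Theta>"
  shows "(\<lambda>p. norm (case p of (j,m) \<Rightarrow> of_real (crs j m * \<theta> m / (n2 j * n2 m)) * (x j * x m * x (- j - m))))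
            summable_on UNIV" (is ?A)
    and "(\<Sum>\<^sub>\<infinity>(j,m). norm (of_real (crs j m * \<theta> m / (n2 j * n2 m)) * (x j * x m * x (- j - m))))
       \<le> 10 * \<Theta> * sqrt (\<Sum>\<^sub>\<infinity>k. (cmod (x k))\<^sup>2 / n2 k) * (\<Sum>\<^sub>\<infinity>k. (cmod (x k))\<^sup>2)" (is ?B)
proof -
  define a where "a k = cmod (x k) / sqrt (n2 k)" for k
  have a0: "0 \<le> a k" for k by (simp add: a_def)
  have a00: "a 0 = 0" by (simp add: a_def)
  have a2: "(a k)\<^sup>2 = (cmod (x k))\<^sup>2 / n2 k" for k by (simp add: a_def power_divide)
  have na: "n2 k * (a k)\<^sup>2 = (cmod (x k))\<^sup>2" for k unfolding a_def by (rule velocity_sq[where x = x, OF x0])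
  have sa: "(\<lambda>k. (a k)\<^sup>2) summable_on UNIV"
    by (rule summable_on_comparison_test[OF P]) (use velocity_sq_le in \<open>auto simp: a_def\<close>)
  have sna: "(\<lambda>k. n2 k * (a k)\<^sup>2) summable_on UNIV" unfolding na by (rule P)
  note tri = trilinear_summable[OF a0 _ a00 sa sna P, simplified]
  have T0: "0 \<le> \<Theta>" using th[of 0] by linarith
  let ?f = "\<lambda>j m. complex_of_real (crs j m * \<theta> m / (n2 j * n2 m)) * (x j * x m * x (- j - m))"
  let ?g = "\<lambda>j m. \<Theta> * (cmod (x (- j - m)) * a j * a m)"
  have le: "norm (?f j m) \<le> ?g j m" for j m
  proof -
    have "norm (?f j m) = (\<bar>crs j m\<bar> / (n2 j * n2 m)) * \<bar>\<theta> m\<bar> * (cmod (x j) * cmod (x m) * cmod (x (- j - m)))"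
      by (simp add: norm_mult norm_divide abs_mult)
    also have "\<dots> \<le> (1 / (sqrt (n2 j) * sqrt (n2 m))) * \<Theta> * (cmod (x j) * cmod (x m) * cmod (x (- j - m)))"
      by (intro mult_right_mono mult_mono crs_div_le th) auto
    also have "\<dots> = ?g j m" by (simp add: a_def)
    finally show ?thesis .
  qed
  have sg: "(\<lambda>(j,m). ?g j m) summable_on UNIV"
    using summable_on_cmult_right[OF tri(1), of \<Theta>] by (simp add: case_prod_unfold)
  have sf: "(\<lambda>p. norm (case p of (j,m) \<Rightarrow> ?f j m)) summable_on UNIV"
    by (rule summable_on_comparison_test[OF sg]) (use le in auto)
  then show ?A .
  have "(\<Sum>\<^sub>\<infinity>(j,m). norm (?f j m)) \<le> (\<Sum>\<^sub>\<infinity>(j,m). ?g j m)"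
    using sf sg le by (intro infsum_mono) (auto simp: case_prod_unfold)
  also have "\<dots> = \<Theta> * (\<Sum>\<^sub>\<infinity>(j,m). cmod (x (- j - m)) * a j * a m)"
    using infsum_cmult_right[OF tri(1), of \<Theta>] by (simp add: case_prod_unfold)
  also have "\<dots> \<le> \<Theta> * (10 * sqrt (\<Sum>\<^sub>\<infinity>k. (cmod (x k))\<^sup>2) * sqrt (\<Sum>\<^sub>\<infinity>k. (a k)\<^sup>2) * sqrt (\<Sum>\<^sub>\<infinity>k. n2 k * (a k)\<^sup>2))"
    by (intro mult_left_mono tri(2) T0)
  also have "\<dots> = 10 * \<Theta> * sqrt (\<Sum>\<^sub>\<infinity>k. (a k)\<^sup>2) * (sqrt (\<Sum>\<^sub>\<infinity>k. (cmod (x k))\<^sup>2) * sqrt (\<Sum>\<^sub>\<infinity>k. (cmod (x k))\<^sup>2))"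
    unfolding na by (simp only: mult_ac)
  also have "sqrt (\<Sum>\<^sub>\<infinity>k. (cmod (x k))\<^sup>2) * sqrt (\<Sum>\<^sub>\<infinity>k. (cmod (x k))\<^sup>2) = (\<Sum>\<^sub>\<infinity>k. (cmod (x k))\<^sup>2)"
    by (simp add: infsum_nonneg)
  finally show ?B by (simp only: a2)
qed

text \<open>\<open>crs j m\<close> is the same for the three cyclic rotations of \<open>(j, m, -j-m)\<close> and changes sign under
  transpositions, so only the antisymmetric part of the weight contributes.\<close>
lemma transfer_symmetrized:
  assumes x0: "x 0 = 0" and P: "(\<lambda>k. (cmod (x k))\<^sup>2) summable_on UNIV"
    and th: "\<And>k. \<bar>\<theta> k\<bar> \<le> \<Theta>"
  shows "6 * transfer \<theta> x = (\<Sum>\<^sub>\<infinity>(j,m). of_real (crs j m *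
      ((\<theta> m - \<theta> j) * n2 (- j - m) + (\<theta> (- j - m) - \<theta> m) * n2 j + (\<theta> j - \<theta> (- j - m)) * n2 m)
        / (n2 j * n2 m * n2 (- j - m))) * (x j * x m * x (- j - m)))"
proof -
  define f where "f j m = complex_of_real (crs j m * \<theta> m / (n2 j * n2 m)) * (x j * x m * x (- j - m))" for j m
  have T: "transfer \<theta> x = (\<Sum>\<^sub>\<infinity>(j,m). f j m)" by (simp add: transfer_def f_def)
  have s: "(\<lambda>(j,m). f j m) summable_on UNIV"
    using transfer_summable(1)[OF assms] unfolding f_def by (rule abs_summable_summable)
  have S: "(\<lambda>(j,m). f m j) summable_on UNIV" "(\<lambda>(j,m). f m (- j - m)) summable_on UNIV"
    "(\<lambda>(j,m). f (- j - m) m) summable_on UNIV" "(\<lambda>(j,m). f (- j - m) j) summable_on UNIV"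
    "(\<lambda>(j,m). f j (- j - m)) summable_on UNIV"
    using bij_idx_perms[THEN infsum_idx_perm(2), of f] s by (simp_all only:)
  have E: "(\<Sum>\<^sub>\<infinity>(j,m). f m j) = transfer \<theta> x" "(\<Sum>\<^sub>\<infinity>(j,m). f m (- j - m)) = transfer \<theta> x"
    "(\<Sum>\<^sub>\<infinity>(j,m). f (- j - m) m) = transfer \<theta> x" "(\<Sum>\<^sub>\<infinity>(j,m). f (- j - m) j) = transfer \<theta> x"
    "(\<Sum>\<^sub>\<infinity>(j,m). f j (- j - m)) = transfer \<theta> x"
    unfolding T using bij_idx_perms[THEN infsum_idx_perm(1), of f] by (simp_all only:)
  have add: "(\<lambda>(j,m). u j m + v j m) summable_on UNIV \<and>
      (\<Sum>\<^sub>\<infinity>(j,m). u j m + v j m) = (\<Sum>\<^sub>\<infinity>(j,m). u j m) + (\<Sum>\<^sub>\<infinity>(j,m). v j m)"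
    if "(\<lambda>(j,m). u j m) summable_on UNIV" "(\<lambda>(j,m). v j m) summable_on UNIV"
    for u v :: "idx \<Rightarrow> idx \<Rightarrow> complex"
    using infsum_add[OF that] summable_on_add[OF that] by (simp add: case_prod_unfold)
  note a1 = add[OF s S(1)]
  note a2 = add[OF conjunct1[OF a1] S(2)]
  note a3 = add[OF conjunct1[OF a2] S(3)]
  note a4 = add[OF conjunct1[OF a3] S(4)]
  note a5 = add[OF conjunct1[OF a4] S(5)]
  have "6 * transfer \<theta> x = (\<Sum>\<^sub>\<infinity>(j,m). f j m + f m j + f m (- j - m) + f (- j - m) m + f (- j - m) j + f j (- j - m))"
    using a1 a2 a3 a4 a5 E by (simp add: T)
  also have "\<dots> = (\<Sum>\<^sub>\<infinity>(j,m). of_real (crs j m *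
      ((\<theta> m - \<theta> j) * n2 (- j - m) + (\<theta> (- j - m) - \<theta> m) * n2 j + (\<theta> j - \<theta> (- j - m)) * n2 m)
        / (n2 j * n2 m * n2 (- j - m))) * (x j * x m * x (- j - m)))"
  proof (intro infsum_cong, clarify)
    fix a b c d :: int
    define j m l where "j = (a,b)" and "m = (c,d)" and "l = - j - m"
    have l: "- l - m = j" "- l - j = m" "- m - l = j" "- j - l = m" "- m - j = l" by (simp_all add: l_def)
    have c: "crs m j = - crs j m" "crs m l = crs j m" "crs l m = - crs j m" "crs l j = crs j m" "crs j l = - crs j m"
      by (auto simp: l_def crs_def algebra_simps)
    define W where "W = x j * x m * x l"
    have W: "x m * x j * x l = W" "x m * x l * x j = W" "x l * x m * x j = W" "x l * x j * x m = W" "x j * x l * x m = W"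
      by (simp_all add: W_def mult_ac)
    show "f j m + f m j + f m (- j - m) + f (- j - m) m + f (- j - m) j + f j (- j - m) =
       of_real (crs j m *
      ((\<theta> m - \<theta> j) * n2 (- j - m) + (\<theta> (- j - m) - \<theta> m) * n2 j + (\<theta> j - \<theta> (- j - m)) * n2 m)
        / (n2 j * n2 m * n2 (- j - m))) * (x j * x m * x (- j - m))"
    proof (cases "j = 0 \<or> m = 0 \<or> l = 0")
      case True
      then have "W = 0" using x0 by (auto simp: W_def)
      then show ?thesis unfolding f_def l_def[symmetric] l c W W_def[symmetric] by simp
    next
      case False
      then have "n2 j \<noteq> 0" "n2 m \<noteq> 0" "n2 l \<noteq> 0" by auto
      then show ?thesis
        unfolding f_def l_def[symmetric] l c W W_def[symmetric] distrib_right[symmetric] of_real_add[symmetric]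
        by (intro arg_cong[where f="\<lambda>r. of_real r * W"]) (simp add: field_simps)
    qed
  qed
  finally show ?thesis .
qed

lemma transfer_one:
  assumes "x 0 = 0" "(\<lambda>k. (cmod (x k))\<^sup>2) summable_on UNIV"
  shows "transfer (\<lambda>_. c) x = 0"
  using transfer_symmetrized[OF assms, of "\<lambda>_. c" "\<bar>c\<bar>"] by (simp add: case_prod_unfold)

lemma vandermonde_weight:
  fixes s p q \<epsilon> \<mu> :: real
  assumes "0 \<le> s" "0 \<le> p" "0 \<le> q" "0 \<le> \<epsilon>"
  defines "\<theta> \<equiv> \<lambda>x. (x - \<mu>) / (1 + \<epsilon> * x)"
  shows "(\<theta> q - \<theta> s) * p + (\<theta> p - \<theta> q) * s + (\<theta> s - \<theta> p) * q
    = (1 + \<epsilon> * \<mu>) * \<epsilon> * ((q - s) * (p - q) * (p - s)) / ((1 + \<epsilon> * s) * (1 + \<epsilon> * p) * (1 + \<epsilon> * q))"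
proof -
  have d: "\<theta> x - \<theta> y = (1 + \<epsilon> * \<mu>) * (x - y) / ((1 + \<epsilon> * x) * (1 + \<epsilon> * y))" if "0 \<le> x" "0 \<le> y" for x y
  proof -
    have "1 + \<epsilon> * x \<noteq> 0" "1 + \<epsilon> * y \<noteq> 0"
      using assms(4) that by (smt (verit) mult_nonneg_nonneg)+
    then show ?thesis unfolding \<theta>_def by (simp add: divide_simps) (simp add: algebra_simps)
  qed
  have nz: "1 + \<epsilon> * s \<noteq> 0" "1 + \<epsilon> * p \<noteq> 0" "1 + \<epsilon> * q \<noteq> 0"
    using assms by (smt (verit) mult_nonneg_nonneg)+
  define S Q U where "S = 1 + \<epsilon> * s" and "Q = 1 + \<epsilon> * q" and "U = 1 + \<epsilon> * p"
  have "(1 + \<epsilon> * \<mu>) * (q - s) / (Q * S) * p + (1 + \<epsilon> * \<mu>) * (p - q) / (U * Q) * s + (1 + \<epsilon> * \<mu>) * (s - p) / (S * U) * q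
     = (1 + \<epsilon> * \<mu>) * ((q - s) * p * U + (p - q) * s * S + (s - p) * q * Q) / (S * U * Q)"
    using nz unfolding S_def[symmetric] Q_def[symmetric] U_def[symmetric] by (simp add: divide_simps) (simp add: algebra_simps)
  also have "(q - s) * p * U + (p - q) * s * S + (s - p) * q * Q = \<epsilon> * ((q - s) * (p - q) * (p - s))"
    unfolding S_def Q_def U_def by (simp add: algebra_simps)
  finally show ?thesis using assms unfolding d[OF assms(3,1)] d[OF assms(2,3)] d[OF assms(1,2)] S_def Q_def U_def
    by (simp add: mult_ac)
qed

lemma kernel_bound:
  fixes a b c D \<epsilon> :: real
  assumes pos: "0 < a" "0 < b" "0 < c" "0 < \<epsilon>"
    and D: "\<bar>D\<bar> \<le> a * c" "\<bar>D\<bar> \<le> a * b" "\<bar>D\<bar> \<le> b * c"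
    and tri: "\<bar>c - a\<bar> \<le> b" "\<bar>b - c\<bar> \<le> a" "\<bar>b - a\<bar> \<le> c"
  defines "\<rho> \<equiv> (1 + \<epsilon> * a\<^sup>2) * (1 + \<epsilon> * b\<^sup>2) * (1 + \<epsilon> * c\<^sup>2)"
  shows "\<bar>D * (\<epsilon> * ((c\<^sup>2 - a\<^sup>2) * (b\<^sup>2 - c\<^sup>2) * (b\<^sup>2 - a\<^sup>2)) / \<rho>) / (a\<^sup>2 * c\<^sup>2 * b\<^sup>2)\<bar>
     \<le> 3 * sqrt \<epsilon> * (a + b + c) / sqrt \<rho>"
proof -
  have one: "1 \<le> 1 + \<epsilon> * r\<^sup>2" for r :: real using pos by simp
  have P1: "1 + \<epsilon> * a\<^sup>2 \<le> \<rho>" "1 + \<epsilon> * b\<^sup>2 \<le> \<rho>" "1 + \<epsilon> * c\<^sup>2 \<le> \<rho>"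
  proof -
    have "(1 + \<epsilon> * a\<^sup>2) * 1 * 1 \<le> \<rho>" "1 * (1 + \<epsilon> * b\<^sup>2) * 1 \<le> \<rho>" "1 * 1 * (1 + \<epsilon> * c\<^sup>2) \<le> \<rho>"
      unfolding \<rho>_def using pos by (intro mult_mono one order_refl; simp)+
    then show "1 + \<epsilon> * a\<^sup>2 \<le> \<rho>" "1 + \<epsilon> * b\<^sup>2 \<le> \<rho>" "1 + \<epsilon> * c\<^sup>2 \<le> \<rho>" by simp_all
  qed
  have Pp: "0 < \<rho>" using P1(1) one[of a] by linarith
  have root: "sqrt \<epsilon> * r \<le> sqrt \<rho>" if "0 < r" "1 + \<epsilon> * r\<^sup>2 \<le> \<rho>" for r
  proof -
    have "sqrt \<epsilon> * r = sqrt (\<epsilon> * r\<^sup>2)" using that by (simp add: real_sqrt_mult)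
    also have "\<dots> \<le> sqrt \<rho>" using that by simp
    finally show ?thesis .
  qed
  have r3: "sqrt \<epsilon> * (a + b + c) \<le> 3 * sqrt \<rho>"
    using root[OF pos(1) P1(1)] root[OF pos(2) P1(2)] root[OF pos(3) P1(3)] by (simp add: algebra_simps)
  have sq: "\<bar>u\<^sup>2 - v\<^sup>2\<bar> = \<bar>u - v\<bar> * \<bar>u + v\<bar>" for u v :: real
    by (simp add: power2_eq_square square_diff_square_factored abs_mult)
  have "\<bar>(c\<^sup>2 - a\<^sup>2) * (b\<^sup>2 - c\<^sup>2) * (b\<^sup>2 - a\<^sup>2)\<bar> \<le> (b * (c + a)) * (a * (b + c)) * (c * (b + a))"
    unfolding abs_mult sq using tri pos by (intro mult_mono) auto
  also have "\<dots> = a * b * c * ((a + b) * (b + c) * (c + a))" by (simp add: algebra_simps)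
  also have "\<dots> \<le> a * b * c * ((a + b + c) * (a * b + b * c + c * a))"
    using pos by (intro mult_left_mono) (auto simp: algebra_simps)
  finally have V: "\<bar>(c\<^sup>2 - a\<^sup>2) * (b\<^sup>2 - c\<^sup>2) * (b\<^sup>2 - a\<^sup>2)\<bar> \<le> a * b * c * ((a + b + c) * (a * b + b * c + c * a))" .
  have DD: "\<bar>D\<bar> * (a * b + b * c + c * a) \<le> (a + b + c) * (a * b * c)"
  proof -
    have "\<bar>D\<bar> * (a * b) \<le> (b * c) * (a * b)" "\<bar>D\<bar> * (b * c) \<le> (a * c) * (b * c)" "\<bar>D\<bar> * (c * a) \<le> (a * b) * (c * a)"
      using D pos by (intro mult_right_mono; simp)+
    then show ?thesis by (simp add: algebra_simps)
  qed
  have "\<bar>D\<bar> * \<bar>(c\<^sup>2 - a\<^sup>2) * (b\<^sup>2 - c\<^sup>2) * (b\<^sup>2 - a\<^sup>2)\<bar> \<le> \<bar>D\<bar> * (a * b * c * ((a + b + c) * (a * b + b * c + c * a)))"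
    by (intro mult_left_mono V) simp
  also have "\<dots> = (\<bar>D\<bar> * (a * b + b * c + c * a)) * (a * b * c * (a + b + c))" by (simp only: mult_ac)
  also have "\<dots> \<le> ((a + b + c) * (a * b * c)) * (a * b * c * (a + b + c))"
    using pos by (intro mult_right_mono DD) auto
  also have "\<dots> = (a + b + c)\<^sup>2 * (a\<^sup>2 * c\<^sup>2 * b\<^sup>2)" by (simp add: power2_eq_square)
  finally have N: "\<bar>D\<bar> * \<bar>(c\<^sup>2 - a\<^sup>2) * (b\<^sup>2 - c\<^sup>2) * (b\<^sup>2 - a\<^sup>2)\<bar> \<le> (a + b + c)\<^sup>2 * (a\<^sup>2 * c\<^sup>2 * b\<^sup>2)" .
  have "\<bar>D * (\<epsilon> * ((c\<^sup>2 - a\<^sup>2) * (b\<^sup>2 - c\<^sup>2) * (b\<^sup>2 - a\<^sup>2)) / \<rho>) / (a\<^sup>2 * c\<^sup>2 * b\<^sup>2)\<bar>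
    = (\<bar>D\<bar> * \<bar>(c\<^sup>2 - a\<^sup>2) * (b\<^sup>2 - c\<^sup>2) * (b\<^sup>2 - a\<^sup>2)\<bar>) / (a\<^sup>2 * c\<^sup>2 * b\<^sup>2) * (\<epsilon> / \<rho>)"
    using pos Pp by (simp add: abs_mult mult_ac)
  also have "\<dots> \<le> (a + b + c)\<^sup>2 * (\<epsilon> / \<rho>)"
    using N pos Pp by (intro mult_right_mono) (simp_all add: divide_le_eq)
  also have "\<dots> = sqrt \<epsilon> * (a + b + c) / sqrt \<rho> * ((sqrt \<epsilon> * (a + b + c)) / sqrt \<rho>)"
    using pos Pp by (simp add: power2_eq_square)
  also have "\<dots> \<le> sqrt \<epsilon> * (a + b + c) / sqrt \<rho> * 3"
    using r3 pos Pp by (intro mult_left_mono) (simp_all add: divide_le_eq)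
  finally show ?thesis by (simp add: mult_ac)
qed

lemma transfer_bound:
  fixes \<epsilon> \<mu> :: real
  assumes x0: "x 0 = 0" and P: "(\<lambda>k. (cmod (x k))\<^sup>2) summable_on UNIV"
    and e: "0 < \<epsilon>" and mu: "0 \<le> \<mu>"
  shows "norm (transfer (\<lambda>k. (n2 k - \<mu>) / (1 + \<epsilon> * n2 k)) x) \<le> 15 * (1 + \<epsilon> * \<mu>) * sqrt \<epsilon> *
    sqrt (\<Sum>\<^sub>\<infinity>k. (cmod (x k))\<^sup>2 / (1 + \<epsilon> * n2 k)) * (\<Sum>\<^sub>\<infinity>k. n2 k * (cmod (x k))\<^sup>2 / (1 + \<epsilon> * n2 k))"
proof -
  define z where "z k = cmod (x k) / sqrt (1 + \<epsilon> * n2 k)" for k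
  define w where "w k = sqrt (n2 k) * z k" for k
  define \<theta> where "\<theta> k = (n2 k - \<mu>) / (1 + \<epsilon> * n2 k)" for k
  have pos: "1 \<le> 1 + \<epsilon> * n2 k" for k using e by simp
  have pos': "0 < 1 + \<epsilon> * n2 k" for k using pos[of k] by linarith
  have z0: "0 \<le> z k" "z 0 = 0" "0 \<le> w k" for k using pos[of k] x0 by (simp_all add: z_def w_def)
  have z2: "(z k)\<^sup>2 = (cmod (x k))\<^sup>2 / (1 + \<epsilon> * n2 k)" for k
    using pos[of k] by (simp add: z_def power_divide)
  have w2: "(w k)\<^sup>2 = n2 k * (z k)\<^sup>2" for k
    by (simp add: w_def power_mult_distrib)
  have sz: "(\<lambda>k. (z k)\<^sup>2) summable_on UNIV"
  proof (rule summable_on_comparison_test[OF P])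
    fix k show "(z k)\<^sup>2 \<le> (cmod (x k))\<^sup>2"
      unfolding z2 using divide_left_mono[OF pos[of k], of "(cmod (x k))\<^sup>2"] pos[of k] by simp
  qed auto
  have sw: "(\<lambda>k. n2 k * (z k)\<^sup>2) summable_on UNIV"
  proof (rule summable_on_comparison_test[OF summable_on_cmult_right[OF P, of "1/\<epsilon>"]])
    fix k
    have "\<epsilon> * n2 k * (cmod (x k))\<^sup>2 \<le> (1 + \<epsilon> * n2 k) * (cmod (x k))\<^sup>2" by (intro mult_right_mono) auto
    then show "n2 k * (z k)\<^sup>2 \<le> 1/\<epsilon> * (cmod (x k))\<^sup>2"
      unfolding z2 using pos'[of k] e by (simp add: divide_simps mult_ac)
  qed auto
  define Z D where "Z = (\<Sum>\<^sub>\<infinity>k. (z k)\<^sup>2)" and "D = (\<Sum>\<^sub>\<infinity>k. n2 k * (z k)\<^sup>2)"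
  note tri = trilinear_summable[OF z0(1,3,2) sz sw sw[folded w2], unfolded w2, folded Z_def D_def]
  define h where "h j m = w (- j - m) * z j * z m" for j m
  have h1: "(\<lambda>(j,m). h j m) summable_on UNIV" "(\<Sum>\<^sub>\<infinity>(j,m). h j m) \<le> 10 * sqrt D * sqrt Z * sqrt D"
    using tri by (simp_all add: h_def)
  have h2: "(\<lambda>(j,m). h m (- j - m)) summable_on UNIV" "(\<Sum>\<^sub>\<infinity>(j,m). h m (- j - m)) = (\<Sum>\<^sub>\<infinity>(j,m). h j m)"
    "(\<lambda>(j,m). h (- j - m) j) summable_on UNIV" "(\<Sum>\<^sub>\<infinity>(j,m). h (- j - m) j) = (\<Sum>\<^sub>\<infinity>(j,m). h j m)"
    using bij_idx_perms[THEN infsum_idx_perm(2), of h] bij_idx_perms[THEN infsum_idx_perm(1), of h] h1(1) by simp_all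
  define C where "C = 3 * (1 + \<epsilon> * \<mu>) * sqrt \<epsilon>"
  have C0: "0 \<le> C" using e mu by (simp add: C_def)
  define g where "g j m = complex_of_real (crs j m *
      ((\<theta> m - \<theta> j) * n2 (- j - m) + (\<theta> (- j - m) - \<theta> m) * n2 j + (\<theta> j - \<theta> (- j - m)) * n2 m)
        / (n2 j * n2 m * n2 (- j - m))) * (x j * x m * x (- j - m))" for j m
  have le: "norm (g j m) \<le> C * (h j m + h m (- j - m) + h (- j - m) j)" for j m
  proof -
    define l where "l = - j - m"
    have l: "- m - l = j" "- l - j = m" by (simp_all add: l_def)
    show ?thesis
    proof (cases "j = 0 \<or> m = 0 \<or> l = 0")
      case True
      then have "g j m = 0" using x0 by (auto simp: g_def l_def)
      moreover have "0 \<le> h j m" for j m using z0 by (simp add: h_def)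
      ultimately show ?thesis using C0 by simp
    next
      case False
      define a b c where "a = sqrt (n2 j)" and "b = sqrt (n2 l)" and "c = sqrt (n2 m)"
      have abc: "n2 j = a\<^sup>2" "n2 l = b\<^sup>2" "n2 m = c\<^sup>2" by (simp_all add: a_def b_def c_def)
      have p: "0 < a" "0 < b" "0 < c" using False by (auto simp: a_def b_def c_def less_le)
      have cr: "crs m l = crs j m" "crs l j = crs j m" by (auto simp: l_def crs_def algebra_simps)
      have Db: "\<bar>crs j m\<bar> \<le> a * c" "\<bar>crs j m\<bar> \<le> a * b" "\<bar>crs j m\<bar> \<le> b * c"
        using abs_crs_le[of j m] abs_crs_le[of l j] abs_crs_le[of m l] unfolding cr a_def b_def c_def
        by (simp_all add: mult.commute)
      have tr: "b \<le> a + c" "c \<le> b + a" "a \<le> c + b"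
        using sqrt_n2_triangle[of j m] sqrt_n2_triangle[of l j] sqrt_n2_triangle[of m l]
        unfolding l l_def[symmetric] a_def b_def c_def by simp_all
      define \<rho> where "\<rho> = (1 + \<epsilon> * a\<^sup>2) * (1 + \<epsilon> * b\<^sup>2) * (1 + \<epsilon> * c\<^sup>2)"
      have kb: "\<bar>crs j m * (\<epsilon> * ((c\<^sup>2 - a\<^sup>2) * (b\<^sup>2 - c\<^sup>2) * (b\<^sup>2 - a\<^sup>2)) / \<rho>) / (a\<^sup>2 * c\<^sup>2 * b\<^sup>2)\<bar>
         \<le> 3 * sqrt \<epsilon> * (a + b + c) / sqrt \<rho>"
        unfolding \<rho>_def by (rule kernel_bound[OF p e Db]) (use tr in linarith)+
      have br: "(\<theta> m - \<theta> j) * n2 l + (\<theta> l - \<theta> m) * n2 j + (\<theta> j - \<theta> l) * n2 m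
          = (1 + \<epsilon> * \<mu>) * (\<epsilon> * ((c\<^sup>2 - a\<^sup>2) * (b\<^sup>2 - c\<^sup>2) * (b\<^sup>2 - a\<^sup>2)) / \<rho>)"
        using vandermonde_weight[of "n2 j" "n2 l" "n2 m" \<epsilon> \<mu>] e
        unfolding \<theta>_def \<rho>_def abc by (simp add: mult.assoc)
      have "norm (g j m) = (1 + \<epsilon> * \<mu>) *
          \<bar>crs j m * (\<epsilon> * ((c\<^sup>2 - a\<^sup>2) * (b\<^sup>2 - c\<^sup>2) * (b\<^sup>2 - a\<^sup>2)) / \<rho>) / (a\<^sup>2 * c\<^sup>2 * b\<^sup>2)\<bar>
          * (cmod (x j) * cmod (x m) * cmod (x l))"
        unfolding g_def l_def[symmetric] br norm_mult norm_of_real unfolding abc using e mu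
        by (simp add: abs_mult mult_ac)
      also have "\<dots> \<le> (1 + \<epsilon> * \<mu>) * (3 * sqrt \<epsilon> * (a + b + c) / sqrt \<rho>) * (cmod (x j) * cmod (x m) * cmod (x l))"
        using e mu by (intro mult_right_mono mult_left_mono kb) auto
      also have "\<dots> = C * ((a + b + c) * ((cmod (x j) * cmod (x m) * cmod (x l)) / sqrt \<rho>))"
        by (simp add: C_def)
      also have "(cmod (x j) * cmod (x m) * cmod (x l)) / sqrt \<rho> = z j * z m * z l"
        unfolding z_def abc \<rho>_def by (simp add: real_sqrt_mult)
      also have "(a + b + c) * (z j * z m * z l) = h j m + h m l + h l j"
        unfolding h_def l l_def[symmetric] w_def a_def b_def c_def by (simp add: algebra_simps)
      finally show ?thesis by (simp add: l_def)
    qed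
  qed
  have s3: "(\<lambda>(j,m). h j m + h m (- j - m) + h (- j - m) j) summable_on UNIV"
    and e3: "(\<Sum>\<^sub>\<infinity>(j,m). h j m + h m (- j - m) + h (- j - m) j) = 3 * (\<Sum>\<^sub>\<infinity>(j,m). h j m)"
    using summable_on_add[OF summable_on_add[OF h1(1) h2(1)] h2(3)]
      infsum_add[OF summable_on_add[OF h1(1) h2(1)] h2(3)] infsum_add[OF h1(1) h2(1)] h2(2,4)
    by (simp_all add: case_prod_unfold)
  have sC: "(\<lambda>(j,m). C * (h j m + h m (- j - m) + h (- j - m) j)) summable_on UNIV"
    using summable_on_cmult_right[OF s3, of C] by (simp add: case_prod_unfold)
  have th: "\<bar>\<theta> k\<bar> \<le> \<mu> + 1/\<epsilon>" for k
  proof -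
    have "\<bar>n2 k - \<mu>\<bar> \<le> (\<mu> + 1/\<epsilon>) * (1 + \<epsilon> * n2 k)"
    proof -
      have "\<bar>n2 k - \<mu>\<bar> \<le> n2 k + \<mu>" using mu n2_nonneg[of k] by linarith
      also have "\<dots> \<le> (\<mu> + 1/\<epsilon>) * (1 + \<epsilon> * n2 k)"
        using e mu by (simp add: algebra_simps)
      finally show ?thesis .
    qed
    then show ?thesis using pos'[of k] by (simp add: \<theta>_def divide_le_eq)
  qed
  have "6 * norm (transfer \<theta> x) = norm (6 * transfer \<theta> x)" by (simp add: norm_mult)
  also have "6 * transfer \<theta> x = (\<Sum>\<^sub>\<infinity>(j,m). g j m)"
    unfolding g_def by (rule transfer_symmetrized[OF x0 P th])
  also have "norm (\<Sum>\<^sub>\<infinity>(j,m). g j m) \<le> (\<Sum>\<^sub>\<infinity>(j,m). C * (h j m + h m (- j - m) + h (- j - m) j))"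
  proof -
    have sg: "(\<lambda>p. norm (case p of (j,m) \<Rightarrow> g j m)) summable_on UNIV"
      by (rule summable_on_comparison_test[OF sC]) (use le in auto)
    have "norm (\<Sum>\<^sub>\<infinity>(j,m). g j m) \<le> (\<Sum>\<^sub>\<infinity>p. norm (case p of (j,m) \<Rightarrow> g j m))"
      by (rule norm_infsum_bound[OF sg])
    also have "\<dots> \<le> (\<Sum>\<^sub>\<infinity>(j,m). C * (h j m + h m (- j - m) + h (- j - m) j))"
      using le by (intro infsum_mono sg sC) auto
    finally show ?thesis .
  qed
  also have "\<dots> = C * (3 * (\<Sum>\<^sub>\<infinity>(j,m). h j m))"
    using infsum_cmult_right[OF s3, of C] e3 by (simp add: case_prod_unfold)
  also have "\<dots> \<le> C * (3 * (10 * (sqrt D * sqrt Z * sqrt D)))"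
    using h1(2) C0 by (intro mult_left_mono) (auto simp: mult.assoc)
  also have "sqrt D * sqrt Z * sqrt D = sqrt Z * D"
  proof -
    have "0 \<le> D" unfolding D_def by (intro infsum_nonneg) auto
    then have "sqrt D * sqrt D = D" by simp
    then show ?thesis by (metis mult.assoc mult.commute)
  qed
  finally have "6 * norm (transfer \<theta> x) \<le> C * (30 * (sqrt Z * D))" by (simp add: mult.assoc)
  moreover have "C * (30 * (sqrt Z * D)) = 6 * (15 * (1 + \<epsilon> * \<mu>) * sqrt \<epsilon> * sqrt Z * D)"
    by (simp add: C_def)
  ultimately have "norm (transfer \<theta> x) \<le> 15 * (1 + \<epsilon> * \<mu>) * sqrt \<epsilon> * sqrt Z * D" by linarith
  then show ?thesis unfolding Z_def D_def z2 \<theta>_def by simp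
qed

section \<open>Indefinite integrals\<close>


lemma borel_measurable_lebesgue_on_AE:
  fixes f g :: "'a::euclidean_space \<Rightarrow> 'b::euclidean_space"
  assumes S: "S \<in> sets lebesgue" and f: "f \<in> borel_measurable (lebesgue_on S)"
    and ae: "AE x in lebesgue_on S. f x = g x"
  shows "g \<in> borel_measurable (lebesgue_on S)"
proof -
  have "(\<lambda>x. if x \<in> S then f x else 0) \<in> borel_measurable lebesgue"
    using f S by (simp add: borel_measurable_if)
  moreover have "AE x in lebesgue. (if x \<in> S then f x else 0) = (if x \<in> S then g x else 0)"
    using ae S by (simp add: AE_restrict_space_iff)
  ultimately have "(\<lambda>x. if x \<in> S then g x else 0) \<in> borel_measurable lebesgue"
    by (rule borel_measurable_AE)
  then show ?thesis using S by (simp add: borel_measurable_if)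
qed

lemma borel_measurable_lebesgue_on_lim:
  fixes s :: "nat \<Rightarrow> 'a::euclidean_space \<Rightarrow> 'b::euclidean_space"
  assumes S: "S \<in> sets lebesgue" and s: "\<And>n. s n \<in> borel_measurable (lebesgue_on S)"
    and lim: "AE x in lebesgue_on S. (\<lambda>n. s n x) \<longlonglongrightarrow> f x"
  shows "f \<in> borel_measurable (lebesgue_on S)"
proof (rule borel_measurable_lebesgue_on_AE[OF S])
  show "(\<lambda>x. lim (\<lambda>n. s n x)) \<in> borel_measurable (lebesgue_on S)"
    by (rule borel_measurable_lim_metric) (rule s)
  show "AE x in lebesgue_on S. lim (\<lambda>n. s n x) = f x"
    using lim by eventually_elim (rule limI)
qed

lemma dominated_convergence_lebesgue_on:
  fixes s :: "nat \<Rightarrow> 'a::euclidean_space \<Rightarrow> real"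
  assumes S: "S \<in> sets lebesgue" and s: "\<And>n. s n \<in> borel_measurable (lebesgue_on S)"
    and lim: "AE x in lebesgue_on S. (\<lambda>n. s n x) \<longlonglongrightarrow> f x"
    and w: "integrable (lebesgue_on S) w" and b: "\<And>n. AE x in lebesgue_on S. norm (s n x) \<le> w x"
  shows "integrable (lebesgue_on S) f" "(\<lambda>n. integral\<^sup>L (lebesgue_on S) (s n)) \<longlonglongrightarrow> integral\<^sup>L (lebesgue_on S) f"
  using integrable_dominated_convergence[OF borel_measurable_lebesgue_on_lim[OF S s lim] s w lim b]
    integral_dominated_convergence[OF borel_measurable_lebesgue_on_lim[OF S s lim] s w lim b] by simp_all

lemma additive_small_bound:
  fixes G :: "real \<Rightarrow> real \<Rightarrow> real" and W :: "real \<Rightarrow> real"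
  assumes add: "\<And>u v w. a \<le> u \<Longrightarrow> u \<le> v \<Longrightarrow> v \<le> w \<Longrightarrow> w \<le> b \<Longrightarrow> G u w = G u v + G v w"
    and small: "\<And>u v. a \<le> u \<Longrightarrow> u \<le> v \<Longrightarrow> v \<le> b \<Longrightarrow> v - u \<le> d \<Longrightarrow> \<bar>G u v\<bar> \<le> W v - W u"
    and d: "0 < d" and ab: "a \<le> b"
  shows "\<bar>G a b\<bar> \<le> W b - W a"
proof -
  have "\<bar>G u v\<bar> \<le> W v - W u" if "a \<le> u" "u \<le> v" "v \<le> b" "v - u \<le> real (Suc n) * d" for n u v
    using that
  proof (induction n arbitrary: u)
    case 0
    then show ?case by (intro small) auto
  next
    case (Suc n)
    define w where "w = min v (u + d)"
    have w: "u \<le> w" "w \<le> v" "w - u \<le> d" using Suc.prems d by (auto simp: w_def)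
    have "v - w \<le> real (Suc n) * d" using Suc.prems d by (auto simp: w_def min_def algebra_simps)
    then have "\<bar>G w v\<bar> \<le> W v - W w" using Suc.IH[of w] Suc.prems w by auto
    moreover have "\<bar>G u w\<bar> \<le> W w - W u" using Suc.prems w by (intro small) auto
    moreover have "G u v = G u w + G w v" using Suc.prems w by (intro add) auto
    ultimately show ?case by linarith
  qed
  moreover obtain n where "b - a \<le> real n * d"
    using reals_Archimedean3[OF d] by (meson less_imp_le)
  ultimately show ?thesis using ab d by (smt (verit) mult_right_mono of_nat_Suc order_refl)
qed

text \<open>On a short interval \<open>F\<close> and \<open>H\<close> are nearly constant.\<close>
lemma integral_product_rule:
  fixes F H f h :: "real \<Rightarrow> real"
  assumes ab: "a \<le> b"
    and f: "f absolutely_integrable_on {a..b}" and h: "h absolutely_integrable_on {a..b}"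
    and F: "continuous_on {a..b} F" and H: "continuous_on {a..b} H"
    and Ff: "\<And>u v. a \<le> u \<Longrightarrow> u \<le> v \<Longrightarrow> v \<le> b \<Longrightarrow> F v - F u = integral {u..v} f"
    and Hh: "\<And>u v. a \<le> u \<Longrightarrow> u \<le> v \<Longrightarrow> v \<le> b \<Longrightarrow> H v - H u = integral {u..v} h"
  shows "(\<lambda>s. f s * H s + F s * h s) absolutely_integrable_on {a..b}"
    and "F b * H b - F a * H a = integral {a..b} (\<lambda>s. f s * H s + F s * h s)"
proof -
  have cm: "(\<lambda>s. G s * k s) absolutely_integrable_on {a..b}"
    if "continuous_on {a..b} G" "k absolutely_integrable_on {a..b}" for G k :: "real \<Rightarrow> real"
    using that by (intro absolutely_integrable_bounded_measurable_product_real)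
      (auto intro!: continuous_imp_measurable_on_sets_lebesgue compact_imp_bounded compact_continuous_image)
  show ai: "(\<lambda>s. f s * H s + F s * h s) absolutely_integrable_on {a..b}"
    using set_integral_add(1)[OF cm[OF H f] cm[OF F h]] by (simp add: mult.commute)
  let ?p = "\<lambda>s. f s * H s + F s * h s"
  define w where "w s = \<bar>f s\<bar> + \<bar>h s\<bar>" for s
  have w: "w absolutely_integrable_on {a..b}" unfolding w_def
    using set_integral_add(1)[OF set_integrable_abs[OF f] set_integrable_abs[OF h]] .
  have sub: "k integrable_on {u..v}" if "k absolutely_integrable_on {a..b}" "a \<le> u" "v \<le> b" for k :: "real \<Rightarrow> real" and u v
    by (rule integrable_on_subinterval[of k "{a..b}"]) (use that in \<open>auto simp: absolutely_integrable_on_def\<close>)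
  define W where "W v = integral {a..v} w" for v
  have Wd: "W v - W u = integral {u..v} w" if "a \<le> u" "u \<le> v" "v \<le> b" for u v
    using Henstock_Kurzweil_Integration.integral_combine[OF that(1,2) sub[OF w order_refl that(3)]] unfolding W_def by linarith
  have wi0: "0 \<le> integral {a..b} w"
    by (rule integral_nonneg[OF sub[OF w order_refl order_refl]]) (simp add: w_def)
  define G where "G u v = (F v * H v - F u * H u) - integral {u..v} ?p" for u v
  have lim: "\<bar>G a b\<bar> \<le> \<eta> * integral {a..b} w" if eta: "0 < \<eta>" for \<eta>
  proof -
    have uc: "uniformly_continuous_on {a..b} F" "uniformly_continuous_on {a..b} H"
      by (rule compact_uniformly_continuous[OF F compact_Icc], rule compact_uniformly_continuous[OF H compact_Icc])
    from uc(1)[unfolded uniformly_continuous_on_def, rule_format, OF eta]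
    obtain d1 where d1: "0 < d1" "\<forall>x\<in>{a..b}. \<forall>y\<in>{a..b}. dist y x < d1 \<longrightarrow> dist (F y) (F x) < \<eta>"
      by (elim exE conjE) (rule that)
    from uc(2)[unfolded uniformly_continuous_on_def, rule_format, OF eta]
    obtain d2 where d2: "0 < d2" "\<forall>x\<in>{a..b}. \<forall>y\<in>{a..b}. dist y x < d2 \<longrightarrow> dist (H y) (H x) < \<eta>"
      by (elim exE conjE) (rule that)
    note d = d1(1) d2(1) d1(2)[rule_format] d2(2)[rule_format]
    define d where "d = min d1 d2 / 2"
    have dp: "0 < d" "d < d1" "d < d2" using d(1,2) by (auto simp: d_def)
    have "\<bar>G a b\<bar> \<le> \<eta> * W b - \<eta> * W a"
    proof (rule additive_small_bound[where d = d and G = G and W = "\<lambda>v. \<eta> * W v"])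
      fix u v w' assume uvw: "a \<le> u" "u \<le> v" "v \<le> w'" "w' \<le> b"
      have "integral {u..v} ?p + integral {v..w'} ?p = integral {u..w'} ?p"
        by (rule Henstock_Kurzweil_Integration.integral_combine[OF uvw(2,3) sub[OF ai uvw(1,4)]])
      then show "G u w' = G u v + G v w'" unfolding G_def by linarith
    next
      fix u v assume uv: "a \<le> u" "u \<le> v" "v \<le> b" "v - u \<le> d"
      have i1: "f integrable_on {u..v}" "h integrable_on {u..v}" "?p integrable_on {u..v}"
        using sub f h ai uv by auto
      have i2: "(\<lambda>s. f s * H v + F u * h s) integrable_on {u..v}"
        using i1 by (intro integrable_add integrable_on_mult_left integrable_on_mult_right) auto
      have "F v * H v - F u * H u = (F v - F u) * H v + F u * (H v - H u)" by (simp add: algebra_simps)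
      also have "\<dots> = integral {u..v} (\<lambda>s. f s * H v + F u * h s)"
        using i1 uv by (simp add: Ff Hh integral_add integrable_on_mult_left integrable_on_mult_right)
      finally have "G u v = integral {u..v} (\<lambda>s. f s * H v + F u * h s) - integral {u..v} ?p" by (simp add: G_def)
      also have "\<dots> = integral {u..v} (\<lambda>s. (f s * H v + F u * h s) - ?p s)"
        by (rule integral_diff[OF i2 i1(3), symmetric])
      finally have Guv: "G u v = integral {u..v} (\<lambda>s. (f s * H v + F u * h s) - ?p s)" .
      have "norm (integral {u..v} (\<lambda>s. (f s * H v + F u * h s) - ?p s)) \<le> integral {u..v} (\<lambda>s. \<eta> * w s)"
      proof (rule integral_norm_bound_integral)
        show "(\<lambda>s. (f s * H v + F u * h s) - ?p s) integrable_on {u..v}"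
          by (rule integrable_diff[OF i2 i1(3)])
        show "(\<lambda>s. \<eta> * w s) integrable_on {u..v}" using sub[OF w] uv by (intro integrable_on_mult_right) auto
        fix s assume s: "s \<in> {u..v}"
        have "\<bar>H v - H s\<bar> \<le> \<eta>" "\<bar>F u - F s\<bar> \<le> \<eta>"
          using d(4)[of s v] d(3)[of s u] uv s dp by (auto simp: dist_real_def intro!: less_imp_le)
        then have "\<bar>f s\<bar> * \<bar>H v - H s\<bar> + \<bar>F u - F s\<bar> * \<bar>h s\<bar> \<le> \<bar>f s\<bar> * \<eta> + \<eta> * \<bar>h s\<bar>"
          by (intro add_mono mult_left_mono mult_right_mono) auto
        moreover have eq: "(f s * H v + F u * h s) - ?p s = f s * (H v - H s) + (F u - F s) * h s" by (simp add: algebra_simps)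
        ultimately show "norm ((f s * H v + F u * h s) - ?p s) \<le> \<eta> * w s"
          unfolding eq real_norm_def w_def distrib_left
          using abs_triangle_ineq[of "f s * (H v - H s)" "(F u - F s) * h s"] unfolding abs_mult
          by (simp only: mult.commute)
      qed
      also have "\<dots> = \<eta> * W v - \<eta> * W u" using Wd[of u v] uv by (simp add: right_diff_distrib[symmetric])
      finally show "\<bar>G u v\<bar> \<le> \<eta> * W v - \<eta> * W u" by (simp add: Guv)
    qed (use dp ab in auto)
    then show ?thesis by (simp add: W_def)
  qed
  have "\<bar>G a b\<bar> \<le> 0"
  proof (rule field_le_epsilon)
    fix e :: real assume *: "0 < e"
    have "\<bar>G a b\<bar> \<le> (e / (integral {a..b} w + 1)) * integral {a..b} w" using * wi0 by (intro lim) auto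
    also have "\<dots> \<le> e" using * wi0 by (simp add: field_simps)
    finally show "\<bar>G a b\<bar> \<le> 0 + e" by simp
  qed
  then show "F b * H b - F a * H a = integral {a..b} ?p" by (simp add: G_def)
qed

lemma integral_mode_balance:
  fixes y f :: "real \<Rightarrow> complex" and c :: real
  assumes ab: "a \<le> b" and f: "f absolutely_integrable_on {a..b}" and y: "continuous_on {a..b} y"
    and yf: "\<And>u v. a \<le> u \<Longrightarrow> u \<le> v \<Longrightarrow> v \<le> b \<Longrightarrow> y v - y u = integral {u..v} f"
  shows "(\<lambda>t. exp (c * t) * (c * (cmod (y t))\<^sup>2 + 2 * Re (f t * cnj (y t)))) absolutely_integrable_on {a..b}" (is ?A)
    and "exp (c * b) * (cmod (y b))\<^sup>2 - exp (c * a) * (cmod (y a))\<^sup>2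
      = integral {a..b} (\<lambda>t. exp (c * t) * (c * (cmod (y t))\<^sup>2 + 2 * Re (f t * cnj (y t))))" (is ?B)
proof -
  have sub: "f integrable_on {u..v}" if "a \<le> u" "v \<le> b" for u v
    by (rule integrable_on_subinterval[of f "{a..b}"]) (use that f in \<open>auto simp: absolutely_integrable_on_def\<close>)
  have ai: "(\<lambda>t. Re (f t)) absolutely_integrable_on {a..b}" "(\<lambda>t. Im (f t)) absolutely_integrable_on {a..b}"
    using absolutely_integrable_linear[OF f bounded_linear_Re] absolutely_integrable_linear[OF f bounded_linear_Im]
    by (simp_all add: o_def)
  have ri: "Re (y v) - Re (y u) = integral {u..v} (\<lambda>t. Re (f t))" "Im (y v) - Im (y u) = integral {u..v} (\<lambda>t. Im (f t))"
    if "a \<le> u" "u \<le> v" "v \<le> b" for u v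
    using yf[OF that] integral_linear[OF sub bounded_linear_Re, of u v] integral_linear[OF sub bounded_linear_Im, of u v] that
    by (simp_all add: o_def flip: minus_complex.simps)
  have cy: "continuous_on {a..b} (\<lambda>t. Re (y t))" "continuous_on {a..b} (\<lambda>t. Im (y t))"
    using y by (auto intro: continuous_intros)
  let ?q = "\<lambda>t. Re (f t) * Re (y t) + Re (y t) * Re (f t) + (Im (f t) * Im (y t) + Im (y t) * Im (f t))"
  have rr: "(\<lambda>t. Re (f t) * Re (y t) + Re (y t) * Re (f t)) absolutely_integrable_on {a..b}"
    by (rule integral_product_rule(1)[OF ab ai(1) ai(1) cy(1) cy(1) ri(1) ri(1)])
  have ii: "(\<lambda>t. Im (f t) * Im (y t) + Im (y t) * Im (f t)) absolutely_integrable_on {a..b}"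
    by (rule integral_product_rule(1)[OF ab ai(2) ai(2) cy(2) cy(2) ri(2) ri(2)])
  have qi: "?q absolutely_integrable_on {a..b}" by (rule set_integral_add(1)[OF rr ii])
  have qe: "(cmod (y v))\<^sup>2 - (cmod (y u))\<^sup>2 = integral {u..v} ?q" if uv: "a \<le> u" "u \<le> v" "v \<le> b" for u v
  proof -
    have ss: "{u..v} \<subseteq> {a..b}" using uv by auto
    have s: "k absolutely_integrable_on {u..v}" if "k absolutely_integrable_on {a..b}" for k :: "real \<Rightarrow> real"
      using absolutely_integrable_on_subinterval[OF that ss] .
    note cs = continuous_on_subset[OF _ ss]
    have "Re (y v) * Re (y v) - Re (y u) * Re (y u) = integral {u..v} (\<lambda>t. Re (f t) * Re (y t) + Re (y t) * Re (f t))"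
      by (rule integral_product_rule(2)[OF uv(2) s[OF ai(1)] s[OF ai(1)] cs[OF cy(1)] cs[OF cy(1)]]) (use uv in \<open>auto intro!: ri\<close>)
    moreover have "Im (y v) * Im (y v) - Im (y u) * Im (y u) = integral {u..v} (\<lambda>t. Im (f t) * Im (y t) + Im (y t) * Im (f t))"
      by (rule integral_product_rule(2)[OF uv(2) s[OF ai(2)] s[OF ai(2)] cs[OF cy(2)] cs[OF cy(2)]]) (use uv in \<open>auto intro!: ri\<close>)
    moreover have "integral {u..v} ?q = integral {u..v} (\<lambda>t. Re (f t) * Re (y t) + Re (y t) * Re (f t))
        + integral {u..v} (\<lambda>t. Im (f t) * Im (y t) + Im (y t) * Im (f t))"
      using s[OF rr] s[OF ii] by (intro integral_add) (auto simp: absolutely_integrable_on_def)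
    ultimately show ?thesis unfolding cmod_power2 unfolding power2_eq_square by linarith
  qed
  have ec: "continuous_on {a..b} (\<lambda>t. exp (c * t))" "continuous_on {a..b} (\<lambda>t. c * exp (c * t))"
    by (auto intro!: continuous_intros)
  have ee: "exp (c * v) - exp (c * u) = integral {u..v} (\<lambda>t. c * exp (c * t))" if "a \<le> u" "u \<le> v" "v \<le> b" for u v
  proof (rule integral_unique[symmetric], rule fundamental_theorem_of_calculus)
    fix t show "((\<lambda>t. exp (c * t)) has_vector_derivative c * exp (c * t)) (at t within {u..v})"
      by (auto intro!: derivative_eq_intros simp: has_real_derivative_iff_has_vector_derivative[symmetric])
  qed (use that in auto)
  have cc: "continuous_on {a..b} (\<lambda>t. (cmod (y t))\<^sup>2)" using y by (auto intro!: continuous_intros)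
  have eq: "?q t * exp (c * t) + (cmod (y t))\<^sup>2 * (c * exp (c * t)) =
      exp (c * t) * (c * (cmod (y t))\<^sup>2 + 2 * Re (f t * cnj (y t)))" for t
    by (simp add: algebra_simps)
  have cai: "(\<lambda>t. c * exp (c * t)) absolutely_integrable_on {a..b}"
    using ec(2) by (rule absolutely_integrable_continuous_real)
  show ?A using integral_product_rule(1)[OF ab qi cai cc ec(1) qe ee] unfolding eq .
  show ?B using integral_product_rule(2)[OF ab qi cai cc ec(1) qe ee] unfolding eq by (simp add: mult.commute)
qed

section \<open>Balance laws in Fourier space\<close>


definition ibox :: "nat \<Rightarrow> idx set" where
  "ibox n = {- int n..int n} \<times> {- int n..int n}"

lemma finite_ibox [simp]: "finite (ibox n)"
  by (simp add: ibox_def)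

lemma ibox_exhausts: "filterlim ibox (finite_subsets_at_top UNIV) sequentially"
  unfolding filterlim_finite_subsets_at_top
proof (intro allI impI)
  fix X :: "idx set" assume X: "finite X \<and> X \<subseteq> UNIV"
  define N where "N = Max (insert 0 ((\<lambda>k. nat (\<bar>fst k\<bar> + \<bar>snd k\<bar>)) ` X))"
  have "X \<subseteq> ibox n" if "N \<le> n" for n
  proof
    fix k assume "k \<in> X"
    then have "nat (\<bar>fst k\<bar> + \<bar>snd k\<bar>) \<le> N" unfolding N_def using X by (intro Max_ge) auto
    then show "k \<in> ibox n" using that by (cases k) (auto simp: ibox_def)
  qed
  then show "eventually (\<lambda>n. finite (ibox n) \<and> X \<subseteq> ibox n \<and> ibox n \<subseteq> UNIV) sequentially"
    unfolding eventually_sequentially by auto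
qed

lemma has_sum_ibox: "(f has_sum a) UNIV \<Longrightarrow> (\<lambda>n. sum f (ibox n)) \<longlonglongrightarrow> a"
  unfolding has_sum_def by (rule filterlim_compose[OF _ ibox_exhausts])

lemma finite_n2_level: "finite {k. n2 k \<le> r}"
proof (rule finite_subset)
  define N where "N = nat \<lceil>r\<rceil>"
  show "{k. n2 k \<le> r} \<subseteq> ibox N"
  proof
    fix k assume k: "k \<in> {k. n2 k \<le> r}"
    have "\<bar>i\<bar> \<le> int N" if "(of_int i)\<^sup>2 \<le> r" for i
    proof -
      have "of_int \<bar>i\<bar> \<le> (of_int \<bar>i\<bar> :: real)\<^sup>2"
      proof (cases "i = 0")
        case False
        then have "1 \<le> (of_int \<bar>i\<bar> :: real)" by linarith
        then show ?thesis by (simp only: self_le_power pos2)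
      qed simp
      then have "of_int \<bar>i\<bar> \<le> r" using that by simp
      then show ?thesis unfolding N_def by linarith
    qed
    moreover have "(of_int (fst k))\<^sup>2 \<le> r" "(of_int (snd k))\<^sup>2 \<le> r"
      using k zero_le_power2[of "of_int (fst k) :: real"] zero_le_power2[of "of_int (snd k) :: real"]
      unfolding mem_Collect_eq n2_def by linarith+
    ultimately have "\<bar>fst k\<bar> \<le> int N" "\<bar>snd k\<bar> \<le> int N" by blast+
    then show "k \<in> ibox N" by (cases k) (auto simp: ibox_def abs_le_iff)
  qed
qed simp

definition conv :: "(idx \<Rightarrow> complex) \<Rightarrow> idx \<Rightarrow> complex" where
  "conv x k = (\<Sum>\<^sub>\<infinity>j. of_real (crs j (k - j) / n2 j) * (x j * x (k - j)))"

lemma weighted_conv: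
  assumes x0: "x 0 = 0" and P: "(\<lambda>k. (cmod (x k))\<^sup>2) summable_on UNIV"
    and th: "\<And>k. \<bar>\<theta> k\<bar> \<le> \<Theta>" and even: "\<And>k. \<theta> (- k) = \<theta> k" and re: "\<And>k. x (- k) = cnj (x k)"
  shows "((\<lambda>k. of_real (\<theta> k / n2 k) * (cnj (x k) * conv x k)) has_sum - transfer \<theta> x) UNIV"
    and "finite S \<Longrightarrow> norm (\<Sum>k\<in>S. of_real (\<theta> k / n2 k) * (cnj (x k) * conv x k))
       \<le> 10 * \<Theta> * sqrt (\<Sum>\<^sub>\<infinity>k. (cmod (x k))\<^sup>2 / n2 k) * (\<Sum>\<^sub>\<infinity>k. (cmod (x k))\<^sup>2)"
proof -
  let ?f = "\<lambda>j m. complex_of_real (crs j m * \<theta> m / (n2 j * n2 m)) * (x j * x m * x (- j - m))"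
  note ts = transfer_summable[OF x0 P th]
  have swap: "bij (\<lambda>(m::idx, j::idx). (j, m))" by (rule bij_idx_perms(1))
  have s: "(\<lambda>(m,j). ?f j m) summable_on UNIV \<times> UNIV"
    using infsum_idx_perm(2)[OF swap, of ?f] abs_summable_summable[OF ts(1)] by simp
  have sn: "(\<lambda>(m,j). norm (?f j m)) summable_on UNIV \<times> UNIV"
    using infsum_idx_perm(2)[OF swap, of "\<lambda>j m. norm (?f j m)"] ts(1) by (simp add: case_prod_unfold)
  have row: "(\<lambda>j. norm (?f j m)) summable_on UNIV" for m
    using summable_on_SigmaD1[OF sn, of m] by simp
  define F where "F m = (\<Sum>\<^sub>\<infinity>j. ?f j m)" for m
  have eq: "of_real (\<theta> k / n2 k) * (cnj (x k) * conv x k) = - F (- k)" for k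
  proof -
    have "- F (- k) = - (\<Sum>\<^sub>\<infinity>j. (of_real (\<theta> k / n2 k) * cnj (x k)) * - (of_real (crs j (k - j) / n2 j) * (x j * x (k - j))))"
      unfolding F_def
    proof (intro arg_cong[where f = uminus] infsum_cong)
      fix j
      have c: "crs j (- k) = - crs j (k - j)" by (simp add: crs_def algebra_simps)
      show "?f j (- k) = (of_real (\<theta> k / n2 k) * cnj (x k)) * - (of_real (crs j (k - j) / n2 j) * (x j * x (k - j)))"
        unfolding c even re n2_uminus by (simp add: algebra_simps)
    qed
    also have "\<dots> = of_real (\<theta> k / n2 k) * (cnj (x k) * conv x k)"
      unfolding infsum_cmult_right' infsum_uminus conv_def by simp
    finally show ?thesis by simp
  qed
  have sF: "F summable_on UNIV"
    unfolding F_def using summable_on_Sigma_banach[OF s] by simp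
  have FT: "infsum F UNIV = transfer \<theta> x"
    using infsum_Sigma'_banach[OF s] infsum_idx_perm(1)[OF swap, of ?f] unfolding F_def transfer_def by simp
  have bu: "bij (uminus :: idx \<Rightarrow> idx)" by (rule bij_uminus)
  have "((\<lambda>k. - F (- k)) has_sum - transfer \<theta> x) UNIV"
  proof -
    have "(F has_sum transfer \<theta> x) UNIV" using sF FT by (metis has_sum_infsum)
    then have "((\<lambda>k. F (- k)) has_sum transfer \<theta> x) UNIV"
      using has_sum_reindex_bij_betw[OF bu, of F] by simp
    then show ?thesis by (simp add: has_sum_uminus)
  qed
  then show "((\<lambda>k. of_real (\<theta> k / n2 k) * (cnj (x k) * conv x k)) has_sum - transfer \<theta> x) UNIV"
    unfolding eq .
  show "norm (\<Sum>k\<in>S. of_real (\<theta> k / n2 k) * (cnj (x k) * conv x k))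
       \<le> 10 * \<Theta> * sqrt (\<Sum>\<^sub>\<infinity>k. (cmod (x k))\<^sup>2 / n2 k) * (\<Sum>\<^sub>\<infinity>k. (cmod (x k))\<^sup>2)" if "finite S"
  proof -
    have "norm (\<Sum>k\<in>S. - F (- k)) \<le> (\<Sum>k\<in>S. norm (F (- k)))"
      by (rule order_trans[OF norm_sum]) simp
    also have "\<dots> \<le> (\<Sum>k\<in>S. \<Sum>\<^sub>\<infinity>j. norm (?f j (- k)))"
      unfolding F_def by (intro sum_mono norm_infsum_bound row)
    also have "\<dots> = (\<Sum>m\<in>uminus ` S. \<Sum>\<^sub>\<infinity>j. norm (?f j m))"
      by (subst sum.reindex) auto
    also have "\<dots> \<le> (\<Sum>\<^sub>\<infinity>m. \<Sum>\<^sub>\<infinity>j. norm (?f j m))"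
      using summable_on_Sigma_banach[OF sn] that by (intro finite_sum_le_infsum) (auto intro: infsum_nonneg)
    also have "\<dots> = (\<Sum>\<^sub>\<infinity>(j,m). norm (?f j m))"
      using infsum_Sigma'_banach[OF sn] infsum_idx_perm(1)[OF swap, of "\<lambda>j m. norm (?f j m)"] by simp
    also have "\<dots> \<le> 10 * \<Theta> * sqrt (\<Sum>\<^sub>\<infinity>k. (cmod (x k))\<^sup>2 / n2 k) * (\<Sum>\<^sub>\<infinity>k. (cmod (x k))\<^sup>2)"
      by (rule ts(2))
    finally show ?thesis unfolding eq .
  qed
qed

definition energy :: "(idx \<Rightarrow> complex) \<Rightarrow> real" where
  "energy x = (\<Sum>\<^sub>\<infinity>k. (cmod (x k))\<^sup>2 / n2 k)"

definition enstrophy :: "(idx \<Rightarrow> complex) \<Rightarrow> real" where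
  "enstrophy x = (\<Sum>\<^sub>\<infinity>k. (cmod (x k))\<^sup>2)"

definition vort_rhs :: "real \<Rightarrow> real \<Rightarrow> (idx \<Rightarrow> complex) \<Rightarrow> (idx \<Rightarrow> complex) \<Rightarrow> idx \<Rightarrow> complex" where
  "vort_rhs \<nu> \<kappa> g x k = g k - of_real (\<nu> * n2 k) * x k + of_real \<kappa> * conv x k"

locale vorticity_flow =
  fixes \<omega> :: "real \<Rightarrow> idx \<Rightarrow> complex" and g :: "idx \<Rightarrow> complex" and \<nu> \<kappa> \<mu> M :: real and e :: "real \<Rightarrow> real"
  assumes nu: "0 < \<nu>" and mu: "0 < \<mu>"
    and zero: "\<And>t. \<omega> t 0 = 0" and real: "\<And>t k. \<omega> t (- k) = cnj (\<omega> t k)"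
    and energy_summable: "\<And>t. (\<lambda>k. (cmod (\<omega> t k))\<^sup>2 / n2 k) summable_on UNIV"
    and energy_le: "\<And>t. energy (\<omega> t) \<le> M"
    and strong_cont: "\<And>t. ((\<lambda>s. energy (\<lambda>k. \<omega> s k - \<omega> t k)) \<longlongrightarrow> 0) (at t)"
    and enstrophy_ae: "AE t in lebesgue. (\<lambda>k. (cmod (\<omega> t k))\<^sup>2) summable_on UNIV \<and> enstrophy (\<omega> t) \<le> e t"
    and e_int: "\<And>a b. integrable (lebesgue_on {a..b}) e"
    and rhs_int: "\<And>k a b. (\<lambda>t. vort_rhs \<nu> \<kappa> g (\<omega> t) k) absolutely_integrable_on {a..b}"
    and ode: "\<And>k a b. a \<le> b \<Longrightarrow> \<omega> b k - \<omega> a k = integral {a..b} (\<lambda>t. vort_rhs \<nu> \<kappa> g (\<omega> t) k)"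
    and forcing: "\<And>k. g k \<noteq> 0 \<Longrightarrow> n2 k = \<mu>"
begin

lemma mode_cont: "continuous_on S (\<lambda>t. \<omega> t k)"
proof -
  have "continuous_on {a..b} (\<lambda>t. \<omega> t k)" for a b
  proof (cases "a \<le> b")
    case True
    have "continuous_on {a..b} (\<lambda>t. \<omega> a k + integral {a..t} (\<lambda>t. vort_rhs \<nu> \<kappa> g (\<omega> t) k))"
      using rhs_int[where k = k and a = a and b = b] by (intro continuous_intros indefinite_integral_continuous_1) (auto simp: absolutely_integrable_on_def)
    then show ?thesis
    proof (rule continuous_on_eq)
      fix t assume "t \<in> {a..b}"
      then show "\<omega> a k + integral {a..t} (\<lambda>t. vort_rhs \<nu> \<kappa> g (\<omega> t) k) = \<omega> t k"
        using ode[of a t k] by (metis add.commute atLeastAtMost_iff diff_add_cancel)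
    qed
  qed simp
  then have "isCont (\<lambda>t. \<omega> t k) t" for t
    by (rule continuous_on_interior[of "{t - 1..t + 1}"]) simp_all
  then show ?thesis by (simp add: continuous_at_imp_continuous_on)
qed

lemma M_nonneg: "0 \<le> M"
  using energy_le[of 0] infsum_nonneg[of UNIV "\<lambda>k. (cmod (\<omega> 0 k))\<^sup>2 / n2 k"] by (simp add: energy_def)

lemma mode_le: "(cmod (\<omega> t k))\<^sup>2 \<le> n2 k * M"
proof (cases "k = 0")
  case False
  then have "0 < n2 k" by (simp add: less_le)
  have "(\<Sum>k\<in>{k}. (cmod (\<omega> t k))\<^sup>2 / n2 k) \<le> energy (\<omega> t)"
    unfolding energy_def by (rule finite_sum_le_infsum[OF energy_summable]) auto
  then have "(cmod (\<omega> t k))\<^sup>2 / n2 k \<le> M" using energy_le[of t] by simp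
  then show ?thesis using \<open>0 < n2 k\<close> by (simp add: divide_le_eq mult.commute)
qed (simp add: zero)

lemma enstrophy_ae_on: "AE t in lebesgue_on {a..b}. (\<lambda>k. (cmod (\<omega> t k))\<^sup>2) summable_on UNIV \<and> enstrophy (\<omega> t) \<le> e t"
proof -
  have S: "{a..b} \<inter> space lebesgue \<in> sets lebesgue" by simp
  show ?thesis
    unfolding AE_restrict_space_iff[OF S] by (rule eventually_mono[OF enstrophy_ae]) blast
qed

lemma balance:
  fixes \<theta> :: "idx \<Rightarrow> real" and c :: real
  assumes ab: "a \<le> b" and th: "\<And>k. \<bar>\<theta> k\<bar> \<le> \<Theta>" and even: "\<And>k. \<theta> (- k) = \<theta> k"
  defines "h \<equiv> \<lambda>t. exp (c * t) * ((\<Sum>\<^sub>\<infinity>k. \<theta> k / n2 k * ((c - 2 * \<nu> * n2 k) * (cmod (\<omega> t k))\<^sup>2))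
      + 2 * (\<Sum>\<^sub>\<infinity>k. \<theta> k / n2 k * Re (g k * cnj (\<omega> t k))) - 2 * \<kappa> * Re (transfer \<theta> (\<omega> t)))"
  shows "integrable (lebesgue_on {a..b}) h"
    and "exp (c * b) * (\<Sum>\<^sub>\<infinity>k. \<theta> k / n2 k * (cmod (\<omega> b k))\<^sup>2) - exp (c * a) * (\<Sum>\<^sub>\<infinity>k. \<theta> k / n2 k * (cmod (\<omega> a k))\<^sup>2)
      = integral\<^sup>L (lebesgue_on {a..b}) h"
proof -
  define s where "s n t = (\<Sum>k\<in>ibox n. \<theta> k / n2 k * (exp (c * t) * (c * (cmod (\<omega> t k))\<^sup>2
      + 2 * Re (vort_rhs \<nu> \<kappa> g (\<omega> t) k * cnj (\<omega> t k)))))" for n t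
  have T0: "0 \<le> \<Theta>" using th[of 0] by linarith
  note mode = integral_mode_balance[OF ab rhs_int mode_cont ode, where c = c]
  have mi: "integrable (lebesgue_on {a..b}) (\<lambda>t. exp (c * t) * (c * (cmod (\<omega> t k))\<^sup>2
      + 2 * Re (vort_rhs \<nu> \<kappa> g (\<omega> t) k * cnj (\<omega> t k))))" for k
    by (rule absolutely_integrable_imp_integrable[OF mode(1)]) auto
  have me: "integral\<^sup>L (lebesgue_on {a..b}) (\<lambda>t. exp (c * t) * (c * (cmod (\<omega> t k))\<^sup>2
      + 2 * Re (vort_rhs \<nu> \<kappa> g (\<omega> t) k * cnj (\<omega> t k)))) = exp (c * b) * (cmod (\<omega> b k))\<^sup>2 - exp (c * a) * (cmod (\<omega> a k))\<^sup>2" for k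
    using lebesgue_integral_eq_integral[OF mi[of k]] mode(2)[of k] by simp
  have si: "integrable (lebesgue_on {a..b}) (s n)" for n
    unfolding s_def using mi by (intro Bochner_Integration.integrable_sum integrable_mult_right) auto
  have se: "integral\<^sup>L (lebesgue_on {a..b}) (s n) =
      exp (c * b) * (\<Sum>k\<in>ibox n. \<theta> k / n2 k * (cmod (\<omega> b k))\<^sup>2) - exp (c * a) * (\<Sum>k\<in>ibox n. \<theta> k / n2 k * (cmod (\<omega> a k))\<^sup>2)" for n
  proof -
    have "integral\<^sup>L (lebesgue_on {a..b}) (s n) = (\<Sum>k\<in>ibox n. \<theta> k / n2 k * (exp (c * b) * (cmod (\<omega> b k))\<^sup>2 - exp (c * a) * (cmod (\<omega> a k))\<^sup>2))"
      unfolding s_def by (subst Bochner_Integration.integral_sum) (use mi me in auto)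
    also have "\<dots> = exp (c * b) * (\<Sum>k\<in>ibox n. \<theta> k / n2 k * (cmod (\<omega> b k))\<^sup>2) - exp (c * a) * (\<Sum>k\<in>ibox n. \<theta> k / n2 k * (cmod (\<omega> a k))\<^sup>2)"
      unfolding sum_distrib_left sum_subtractf[symmetric] by (intro sum.cong refl) (simp add: algebra_simps)
    finally show ?thesis .
  qed
  have Qs: "(\<lambda>k. \<theta> k / n2 k * (cmod (\<omega> t k))\<^sup>2) summable_on UNIV" for t
  proof (rule abs_summable_summable, rule summable_on_comparison_test[OF summable_on_cmult_right[OF energy_summable[of t], of \<Theta>]])
    fix k show "norm (\<theta> k / n2 k * (cmod (\<omega> t k))\<^sup>2) \<le> \<Theta> * ((cmod (\<omega> t k))\<^sup>2 / n2 k)"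
      using mult_right_mono[OF th[of k], of "(cmod (\<omega> t k))\<^sup>2 / n2 k"] by (simp add: abs_mult)
  qed auto
  have sl: "(\<lambda>n. integral\<^sup>L (lebesgue_on {a..b}) (s n)) \<longlonglongrightarrow>
     exp (c * b) * (\<Sum>\<^sub>\<infinity>k. \<theta> k / n2 k * (cmod (\<omega> b k))\<^sup>2) - exp (c * a) * (\<Sum>\<^sub>\<infinity>k. \<theta> k / n2 k * (cmod (\<omega> a k))\<^sup>2)"
    unfolding se by (intro tendsto_intros has_sum_ibox has_sum_infsum Qs)
  define G where "G = {k. n2 k \<le> \<mu>}"
  have Gf: "finite G" unfolding G_def by (rule finite_n2_level)
  define X where "X = exp (\<bar>c\<bar> * (\<bar>a\<bar> + \<bar>b\<bar>))"
  have X: "exp (c * t) \<le> X" if "t \<in> {a..b}" for t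
  proof -
    have "\<bar>t\<bar> \<le> \<bar>a\<bar> + \<bar>b\<bar>" using that by auto
    then have "\<bar>c\<bar> * \<bar>t\<bar> \<le> \<bar>c\<bar> * (\<bar>a\<bar> + \<bar>b\<bar>)" by (rule mult_left_mono) simp
    then show ?thesis unfolding X_def exp_le_cancel_iff using abs_ge_self[of "c * t"] by (simp add: abs_mult)
  qed
  define w where "w t = X * (\<Theta> * (\<bar>c\<bar> + 2 * \<nu>) * e t + 2 * (\<Theta> * (\<Sum>k\<in>G. cmod (g k) * (\<mu> * M + 1)))
     + 2 * \<bar>\<kappa>\<bar> * (10 * \<Theta> * sqrt M * e t))" for t
  have wi: "integrable (lebesgue_on {a..b}) w"
    unfolding w_def using e_int[of a b] by (intro integrable_mult_right Bochner_Integration.integrable_add) auto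
  have point: "(\<lambda>n. s n t) \<longlonglongrightarrow> h t \<and> (\<forall>n. norm (s n t) \<le> w t)"
    if t: "t \<in> {a..b}" and P: "(\<lambda>k. (cmod (\<omega> t k))\<^sup>2) summable_on UNIV" and Pe: "enstrophy (\<omega> t) \<le> e t" for t
  proof -
    let ?x = "\<omega> t"
    define u1 where "u1 k = \<theta> k / n2 k * ((c - 2 * \<nu> * n2 k) * (cmod (?x k))\<^sup>2)" for k
    define u2 where "u2 k = \<theta> k / n2 k * Re (g k * cnj (?x k))" for k
    define u3 where "u3 k = of_real (\<theta> k / n2 k) * (cnj (?x k) * conv ?x k)" for k
    have rm: "Re (complex_of_real r * z) = r * Re z" for r z by simp
    have gen: "q * (E * (c * W + 2 * (A - \<nu> * n * W + \<kappa> * B))) = E * (q * ((c - 2 * \<nu> * n) * W) + 2 * (q * A) + 2 * \<kappa> * (q * B))"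
      for q E W A n B by (simp add: algebra_simps)
    have s_eq: "s n t = exp (c * t) * ((\<Sum>k\<in>ibox n. u1 k) + 2 * (\<Sum>k\<in>ibox n. u2 k) + 2 * \<kappa> * Re (\<Sum>k\<in>ibox n. u3 k))" for n
      unfolding s_def sum_distrib_left Re_sum sum.distrib[symmetric]
    proof (intro sum.cong refl)
      fix k
      have "Re (vort_rhs \<nu> \<kappa> g ?x k * cnj (?x k)) = Re (g k * cnj (?x k)) - \<nu> * n2 k * (cmod (?x k))\<^sup>2 + \<kappa> * Re (cnj (?x k) * conv ?x k)"
        unfolding vort_rhs_def cmod_power2 by (simp add: algebra_simps power2_eq_square)
      then show "\<theta> k / n2 k * (exp (c * t) * (c * (cmod (?x k))\<^sup>2 + 2 * Re (vort_rhs \<nu> \<kappa> g ?x k * cnj (?x k))))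
         = exp (c * t) * (u1 k + 2 * u2 k + 2 * \<kappa> * Re (u3 k))"
        unfolding u1_def u2_def u3_def rm by (simp only: gen)
    qed
    have b1: "norm (u1 k) \<le> \<Theta> * (\<bar>c\<bar> + 2 * \<nu>) * (cmod (?x k))\<^sup>2" for k
    proof (cases "k = 0")
      case False
      then have n1: "1 \<le> n2 k" by (rule n2_ge_1)
      have "\<bar>c - 2 * \<nu> * n2 k\<bar> \<le> \<bar>c\<bar> * n2 k + 2 * \<nu> * n2 k"
      proof -
        have "\<bar>c\<bar> * 1 \<le> \<bar>c\<bar> * n2 k" using n1 by (intro mult_left_mono) auto
        moreover have "0 \<le> 2 * \<nu> * n2 k" using nu by simp
        ultimately show ?thesis by linarith
      qed
      then have "\<bar>c - 2 * \<nu> * n2 k\<bar> / n2 k \<le> \<bar>c\<bar> + 2 * \<nu>"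
        using n1 by (simp add: divide_le_eq algebra_simps)
      then have "\<bar>\<theta> k\<bar> * (\<bar>c - 2 * \<nu> * n2 k\<bar> / n2 k) * (cmod (?x k))\<^sup>2 \<le> \<Theta> * (\<bar>c\<bar> + 2 * \<nu>) * (cmod (?x k))\<^sup>2"
        using th[of k] T0 by (intro mult_right_mono mult_mono) auto
      then show ?thesis by (simp add: u1_def abs_mult)
    qed (simp add: u1_def zero)
    have s1: "(\<lambda>k. norm (u1 k)) summable_on UNIV"
      by (rule summable_on_comparison_test[OF summable_on_cmult_right[OF P]]) (use b1 in auto)
    have l1: "(\<lambda>n. \<Sum>k\<in>ibox n. u1 k) \<longlonglongrightarrow> (\<Sum>\<^sub>\<infinity>k. u1 k)"
      by (rule has_sum_ibox[OF has_sum_infsum[OF abs_summable_summable[OF s1]]])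
    have B1: "\<bar>\<Sum>k\<in>ibox n. u1 k\<bar> \<le> \<Theta> * (\<bar>c\<bar> + 2 * \<nu>) * e t" for n
    proof -
      have "\<bar>\<Sum>k\<in>ibox n. u1 k\<bar> \<le> (\<Sum>k\<in>ibox n. \<Theta> * (\<bar>c\<bar> + 2 * \<nu>) * (cmod (?x k))\<^sup>2)"
        by (rule order_trans[OF sum_abs], rule sum_mono) (use b1 in auto)
      also have "\<dots> = \<Theta> * (\<bar>c\<bar> + 2 * \<nu>) * (\<Sum>k\<in>ibox n. (cmod (?x k))\<^sup>2)" by (simp add: sum_distrib_left)
      also have "\<dots> \<le> \<Theta> * (\<bar>c\<bar> + 2 * \<nu>) * e t"
      proof (rule mult_left_mono)
        show "(\<Sum>k\<in>ibox n. (cmod (?x k))\<^sup>2) \<le> e t"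
          by (rule order_trans[OF finite_sum_le_infsum[OF P] Pe[unfolded enstrophy_def]]) auto
      qed (use T0 nu in auto)
      finally show ?thesis .
    qed
    have z2: "u2 k = 0" if "k \<notin> G" for k
    proof -
      have "g k = 0" using forcing[of k] that by (auto simp: G_def)
      then show ?thesis by (simp add: u2_def)
    qed
    have s2: "u2 summable_on UNIV"
      by (subst summable_on_cong_neutral[where T = G and g = u2]) (use z2 Gf in auto)
    have l2: "(\<lambda>n. \<Sum>k\<in>ibox n. u2 k) \<longlonglongrightarrow> (\<Sum>\<^sub>\<infinity>k. u2 k)"
      by (intro has_sum_ibox has_sum_infsum s2)
    have b2: "\<bar>u2 k\<bar> \<le> \<Theta> * (cmod (g k) * (\<mu> * M + 1))" if "k \<in> G" for k
    proof (cases "k = 0")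
      case False
      have "(cmod (?x k))\<^sup>2 \<le> \<mu> * M"
        using mode_le[of t k] that M_nonneg mult_right_mono[of "n2 k" \<mu> M] by (auto simp: G_def)
      moreover have "cmod (?x k) \<le> (cmod (?x k))\<^sup>2 + 1"
        using sum_squares_bound[of "cmod (?x k)" 1] norm_ge_zero[of "?x k"] unfolding power_one mult_1_right by linarith
      ultimately have m: "cmod (?x k) \<le> \<mu> * M + 1" by linarith
      have "\<bar>u2 k\<bar> = \<bar>\<theta> k\<bar> * (\<bar>Re (g k * cnj (?x k))\<bar> / n2 k)" by (simp add: u2_def abs_mult)
      also have "\<dots> \<le> \<Theta> * (\<bar>Re (g k * cnj (?x k))\<bar> / 1)"
        using th[of k] T0 n2_ge_1[OF False] by (intro mult_mono divide_left_mono) auto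
      also have "\<dots> \<le> \<Theta> * (cmod (g k) * (\<mu> * M + 1))"
        using abs_Re_le_cmod[of "g k * cnj (?x k)"] mult_left_mono[OF m, of "cmod (g k)"] T0
        by (intro mult_left_mono) (auto simp: norm_mult)
      finally show ?thesis .
    qed (use T0 mu M_nonneg in \<open>simp add: u2_def\<close>)
    have B2: "\<bar>\<Sum>k\<in>ibox n. u2 k\<bar> \<le> \<Theta> * (\<Sum>k\<in>G. cmod (g k) * (\<mu> * M + 1))" for n
    proof -
      have "\<bar>\<Sum>k\<in>ibox n. u2 k\<bar> = \<bar>\<Sum>k\<in>ibox n \<inter> G. u2 k\<bar>"
        by (rule arg_cong[where f = abs], rule sum.mono_neutral_right) (use z2 in auto)
      also have "\<dots> \<le> (\<Sum>k\<in>ibox n \<inter> G. \<bar>u2 k\<bar>)" by (rule sum_abs)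
      also have "\<dots> \<le> (\<Sum>k\<in>G. \<bar>u2 k\<bar>)" by (rule sum_mono2) (use Gf in auto)
      also have "\<dots> \<le> (\<Sum>k\<in>G. \<Theta> * (cmod (g k) * (\<mu> * M + 1)))" by (rule sum_mono) (rule b2)
      finally show ?thesis by (simp add: sum_distrib_left)
    qed
    note wc = weighted_conv[where x = ?x and \<theta> = \<theta> and \<Theta> = \<Theta>, OF zero P th even real, folded u3_def]
    have l3: "(\<lambda>n. Re (\<Sum>k\<in>ibox n. u3 k)) \<longlonglongrightarrow> - Re (transfer \<theta> ?x)"
      using tendsto_Re[OF has_sum_ibox[OF wc(1)]] by simp
    have B3: "\<bar>Re (\<Sum>k\<in>ibox n. u3 k)\<bar> \<le> 10 * \<Theta> * sqrt M * e t" for n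
    proof -
      have "\<bar>Re (\<Sum>k\<in>ibox n. u3 k)\<bar> \<le> 10 * \<Theta> * sqrt (energy ?x) * enstrophy ?x"
        using order_trans[OF abs_Re_le_cmod wc(2)[of "ibox n"]] by (simp add: energy_def enstrophy_def)
      also have "\<dots> \<le> 10 * \<Theta> * sqrt M * e t"
        using energy_le[of t] Pe T0 M_nonneg
        by (intro mult_mono mult_left_mono) (auto simp: enstrophy_def infsum_nonneg)
      finally show ?thesis .
    qed
    have "(\<lambda>n. s n t) \<longlonglongrightarrow> exp (c * t) * ((\<Sum>\<^sub>\<infinity>k. u1 k) + 2 * (\<Sum>\<^sub>\<infinity>k. u2 k) + 2 * \<kappa> * (- Re (transfer \<theta> ?x)))"
      unfolding s_eq by (intro tendsto_intros l1 l2 l3)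
    then have "(\<lambda>n. s n t) \<longlonglongrightarrow> h t" by (simp add: h_def u1_def u2_def)
    moreover have "norm (s n t) \<le> w t" for n
    proof -
      let ?a = "\<Sum>k\<in>ibox n. u1 k" and ?b = "\<Sum>k\<in>ibox n. u2 k" and ?c = "Re (\<Sum>k\<in>ibox n. u3 k)"
      have "\<bar>?a + 2 * ?b + 2 * \<kappa> * ?c\<bar> \<le> \<bar>?a\<bar> + 2 * \<bar>?b\<bar> + 2 * \<bar>\<kappa>\<bar> * \<bar>?c\<bar>"
        using abs_triangle_ineq[of "?a + 2 * ?b" "2 * \<kappa> * ?c"] abs_triangle_ineq[of ?a "2 * ?b"] by (simp add: abs_mult)
      also have "\<dots> \<le> \<Theta> * (\<bar>c\<bar> + 2 * \<nu>) * e t + 2 * (\<Theta> * (\<Sum>k\<in>G. cmod (g k) * (\<mu> * M + 1))) + 2 * \<bar>\<kappa>\<bar> * (10 * \<Theta> * sqrt M * e t)"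
        by (intro add_mono mult_left_mono B1 B2 B3) auto
      finally have "exp (c * t) * \<bar>?a + 2 * ?b + 2 * \<kappa> * ?c\<bar> \<le> w t"
        unfolding w_def using X[OF t] by (intro mult_mono) (auto simp: X_def)
      then show ?thesis unfolding s_eq by (simp add: abs_mult)
    qed
    ultimately show ?thesis by blast
  qed
  have ae: "AE t in lebesgue_on {a..b}. (\<lambda>n. s n t) \<longlonglongrightarrow> h t \<and> (\<forall>n. norm (s n t) \<le> w t)"
    using enstrophy_ae_on[of a b] AE_space by eventually_elim (use point in auto)
  have lim: "AE t in lebesgue_on {a..b}. (\<lambda>n. s n t) \<longlonglongrightarrow> h t" "AE t in lebesgue_on {a..b}. norm (s n t) \<le> w t" for n
    using ae by (auto elim: eventually_mono)
  note D = dominated_convergence_lebesgue_on[OF _ borel_measurable_integrable[OF si] lim(1) wi lim(2)]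
  show "integrable (lebesgue_on {a..b}) h" by (rule D(1)) simp
  have "(\<lambda>n. integral\<^sup>L (lebesgue_on {a..b}) (s n)) \<longlonglongrightarrow> integral\<^sup>L (lebesgue_on {a..b}) h" by (rule D(2)) simp
  with sl show "exp (c * b) * (\<Sum>\<^sub>\<infinity>k. \<theta> k / n2 k * (cmod (\<omega> b k))\<^sup>2) - exp (c * a) * (\<Sum>\<^sub>\<infinity>k. \<theta> k / n2 k * (cmod (\<omega> a k))\<^sup>2)
      = integral\<^sup>L (lebesgue_on {a..b}) h" by (rule LIMSEQ_unique)
qed

end

section \<open>Backward bounded solutions\<close>


lemma rational_weight_bound:
  assumes "0 < \<epsilon>" "0 \<le> \<mu>"
  shows "\<bar>(n2 k - \<mu>) / (1 + \<epsilon> * n2 k)\<bar> \<le> \<mu> + 1 / \<epsilon>"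
proof -
  have p: "0 < 1 + \<epsilon> * n2 k" using assms(1) by (intro add_pos_nonneg mult_nonneg_nonneg) auto
  have "\<bar>n2 k - \<mu>\<bar> \<le> n2 k + \<mu>" using assms(2) n2_nonneg[of k] by linarith
  also have "\<dots> \<le> (\<mu> + 1 / \<epsilon>) * (1 + \<epsilon> * n2 k)"
    using assms by (simp add: algebra_simps)
  finally show ?thesis using p by (simp add: divide_le_eq)
qed

context vorticity_flow
begin

lemma energy_nonneg: "0 \<le> energy x"
  by (simp add: energy_def infsum_nonneg)

lemma energy_dissipation:
  obtains C where "\<And>a. \<exists>t\<in>{a..a + 1}. (\<lambda>k. (cmod (\<omega> t k))\<^sup>2) summable_on UNIV \<and> enstrophy (\<omega> t) \<le> C"
proof -
  define G where "G = {k. n2 k \<le> \<mu>}"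
  have Gf: "finite G" unfolding G_def by (rule finite_n2_level)
  define C1 where "C1 = (\<Sum>k\<in>G. cmod (g k) * (\<mu> * M + 1))"
  have C1: "\<bar>\<Sum>\<^sub>\<infinity>k. 1 / n2 k * Re (g k * cnj (\<omega> t k))\<bar> \<le> C1" for t
  proof -
    let ?u = "\<lambda>k. 1 / n2 k * Re (g k * cnj (\<omega> t k))"
    have "?u k = 0" if "k \<notin> G" for k
    proof -
      have "g k = 0" using forcing[of k] that by (auto simp: G_def)
      then show ?thesis by simp
    qed
    then have "(\<Sum>\<^sub>\<infinity>k. ?u k) = (\<Sum>\<^sub>\<infinity>k\<in>G. ?u k)" by (intro infsum_cong_neutral) auto
    also have "\<bar>\<dots>\<bar> \<le> (\<Sum>k\<in>G. \<bar>?u k\<bar>)" using Gf by (simp only: infsum_finite sum_abs)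
    also have "\<dots> \<le> C1" unfolding C1_def
    proof (rule sum_mono)
      fix k assume k: "k \<in> G"
      show "\<bar>?u k\<bar> \<le> cmod (g k) * (\<mu> * M + 1)"
      proof (cases "k = 0")
        case False
        have "n2 k * M \<le> \<mu> * M" using k M_nonneg by (intro mult_right_mono) (auto simp: G_def)
        then have "(cmod (\<omega> t k))\<^sup>2 \<le> \<mu> * M" using mode_le[of t k] by linarith
        moreover have "cmod (\<omega> t k) \<le> (cmod (\<omega> t k))\<^sup>2 + 1"
          using sum_squares_bound[of "cmod (\<omega> t k)" 1] norm_ge_zero[of "\<omega> t k"] unfolding power_one mult_1_right by linarith
        ultimately have m: "cmod (\<omega> t k) \<le> \<mu> * M + 1" by linarith
        have "\<bar>?u k\<bar> = \<bar>Re (g k * cnj (\<omega> t k))\<bar> / n2 k" by (simp add: abs_mult)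
        also have "\<dots> \<le> \<bar>Re (g k * cnj (\<omega> t k))\<bar> / 1"
          using n2_ge_1[OF False] by (intro divide_left_mono) auto
        also have "\<dots> \<le> cmod (g k) * cmod (\<omega> t k)"
          using abs_Re_le_cmod[of "g k * cnj (\<omega> t k)"] by (simp only: norm_mult complex_mod_cnj div_by_1)
        also have "\<dots> \<le> cmod (g k) * (\<mu> * M + 1)" using m by (rule mult_left_mono) simp
        finally show ?thesis .
      qed (use mu M_nonneg in simp)
    qed
    finally show ?thesis .
  qed
  define C where "C = (M + 2 * C1 + 1) / (2 * \<nu>)"
  have "\<exists>t\<in>{a..a + 1}. (\<lambda>k. (cmod (\<omega> t k))\<^sup>2) summable_on UNIV \<and> enstrophy (\<omega> t) \<le> C" for a
  proof (rule ccontr)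
    assume contra: "\<not> ?thesis"
    define h where "h t = exp (0 * t) * ((\<Sum>\<^sub>\<infinity>k. 1 / n2 k * ((0 - 2 * \<nu> * n2 k) * (cmod (\<omega> t k))\<^sup>2))
      + 2 * (\<Sum>\<^sub>\<infinity>k. 1 / n2 k * Re (g k * cnj (\<omega> t k))) - 2 * \<kappa> * Re (transfer (\<lambda>_. 1) (\<omega> t)))" for t
    note bal = balance[of a "a + 1" "\<lambda>_. 1" 1 0, folded h_def, simplified]
    have hle: "h t \<le> - (M + 1)" if t: "t \<in> {a..a + 1}" and P: "(\<lambda>k. (cmod (\<omega> t k))\<^sup>2) summable_on UNIV" for t
    proof -
      have tr: "transfer (\<lambda>_. 1) (\<omega> t) = 0" by (rule transfer_one[OF zero P])
      have "(\<Sum>\<^sub>\<infinity>k. 1 / n2 k * ((0 - 2 * \<nu> * n2 k) * (cmod (\<omega> t k))\<^sup>2)) = (\<Sum>\<^sub>\<infinity>k. (- 2 * \<nu>) * (cmod (\<omega> t k))\<^sup>2)"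
      proof (rule infsum_cong)
        fix k show "1 / n2 k * ((0 - 2 * \<nu> * n2 k) * (cmod (\<omega> t k))\<^sup>2) = (- 2 * \<nu>) * (cmod (\<omega> t k))\<^sup>2"
          by (cases "k = 0") (auto simp: zero)
      qed
      also have "\<dots> = (- 2 * \<nu>) * enstrophy (\<omega> t)" unfolding enstrophy_def by (rule infsum_cmult_right')
      finally have "h t \<le> (- 2 * \<nu>) * enstrophy (\<omega> t) + 2 * C1" using C1[of t] tr by (simp add: h_def)
      moreover have "\<not> enstrophy (\<omega> t) \<le> C" using contra t P by blast
      then have "2 * \<nu> * C < 2 * \<nu> * enstrophy (\<omega> t)" using nu by simp
      moreover have "2 * \<nu> * C = M + 2 * C1 + 1" using nu by (simp add: C_def)
      ultimately show ?thesis by linarith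
    qed
    have "integral\<^sup>L (lebesgue_on {a..a + 1}) h \<le> integral\<^sup>L (lebesgue_on {a..a + 1}) (\<lambda>_. - (M + 1))"
    proof (rule integral_mono_AE)
      show "AE t in lebesgue_on {a..a + 1}. h t \<le> - (M + 1)"
        using enstrophy_ae_on[of a "a + 1"] AE_space by eventually_elim (use hle in auto)
      show "integrable (lebesgue_on {a..a + 1}) (\<lambda>_. - (M + 1))"
        by (intro finite_measure.integrable_const finite_measure_lebesgue_on) simp
    qed (rule bal(1))
    also have "\<dots> = - (M + 1)" by (simp add: measure_restrict_space)
    also have "integral\<^sup>L (lebesgue_on {a..a + 1}) h = energy (\<omega> (a + 1)) - energy (\<omega> a)"
      unfolding bal(2)[symmetric] energy_def by simp
    finally show False using energy_le[of a] energy_nonneg[of "\<omega> (a + 1)"] by linarith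
  qed
  then show ?thesis by (rule that)
qed

lemma diff_energy_summable: "(\<lambda>k. (cmod (\<omega> s k - \<omega> t k))\<^sup>2 / n2 k) summable_on UNIV"
proof (rule summable_on_comparison_test)
  show "(\<lambda>k. 2 * ((cmod (\<omega> s k))\<^sup>2 / n2 k) + 2 * ((cmod (\<omega> t k))\<^sup>2 / n2 k)) summable_on UNIV"
    by (intro summable_on_add summable_on_cmult_right energy_summable)
  fix k
  have "(cmod (\<omega> s k - \<omega> t k))\<^sup>2 \<le> (cmod (\<omega> s k) + cmod (\<omega> t k))\<^sup>2"
    by (intro power_mono norm_triangle_ineq4) auto
  also have "\<dots> \<le> 2 * (cmod (\<omega> s k))\<^sup>2 + 2 * (cmod (\<omega> t k))\<^sup>2"
    using sum_squares_bound[of "cmod (\<omega> s k)" "cmod (\<omega> t k)"] by (simp add: power2_sum)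
  finally have "(cmod (\<omega> s k - \<omega> t k))\<^sup>2 \<le> 2 * (cmod (\<omega> s k))\<^sup>2 + 2 * (cmod (\<omega> t k))\<^sup>2" .
  from divide_right_mono[OF this n2_nonneg[of k]]
  show "(cmod (\<omega> s k - \<omega> t k))\<^sup>2 / n2 k \<le> 2 * ((cmod (\<omega> s k))\<^sup>2 / n2 k) + 2 * ((cmod (\<omega> t k))\<^sup>2 / n2 k)"
    by (simp add: add_divide_distrib)
qed auto

lemma damped_summable:
  assumes "0 < \<epsilon>"
  shows "(\<lambda>k. \<epsilon> * (cmod (\<omega> t k))\<^sup>2 / (1 + \<epsilon> * n2 k)) summable_on UNIV"
    and "\<epsilon> * (cmod (\<omega> t k))\<^sup>2 / (1 + \<epsilon> * n2 k) \<le> (cmod (\<omega> t k))\<^sup>2 / n2 k"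
    and "\<epsilon> * (cmod (\<omega> t k))\<^sup>2 / (1 + \<epsilon> * n2 k) \<le> \<epsilon> * (cmod (\<omega> t k))\<^sup>2"
proof -
  have p: "1 \<le> 1 + \<epsilon> * n2 k" for k using assms by simp
  show *: "\<epsilon> * (cmod (\<omega> t k))\<^sup>2 / (1 + \<epsilon> * n2 k) \<le> (cmod (\<omega> t k))\<^sup>2 / n2 k" for k
  proof (cases "k = 0")
    case False
    then have "0 < n2 k" by (simp add: less_le)
    then have "\<epsilon> * (cmod (\<omega> t k))\<^sup>2 / (1 + \<epsilon> * n2 k) \<le> \<epsilon> * (cmod (\<omega> t k))\<^sup>2 / (\<epsilon> * n2 k)"
      using assms less_le_trans[OF zero_less_one p[of k]] by (intro divide_left_mono mult_pos_pos) auto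
    then show ?thesis using assms by simp
  qed (simp add: zero)
  show "(\<lambda>k. \<epsilon> * (cmod (\<omega> t k))\<^sup>2 / (1 + \<epsilon> * n2 k)) summable_on UNIV"
    by (rule summable_on_comparison_test[OF energy_summable[of t]]) (use * assms p in \<open>auto intro!: divide_nonneg_nonneg\<close>)
  show "\<epsilon> * (cmod (\<omega> t k))\<^sup>2 / (1 + \<epsilon> * n2 k) \<le> \<epsilon> * (cmod (\<omega> t k))\<^sup>2"
    using divide_left_mono[OF p[of k], of "\<epsilon> * (cmod (\<omega> t k))\<^sup>2"] p[of k] assms by simp
qed

text \<open>The orbit segment \<open>\<omega> ` {a..0}\<close> is compact in the energy space, hence its tails are uniformly small.\<close>
lemma uniform_damping:
  assumes eta: "0 < \<eta>"
  obtains \<epsilon>0 where "0 < \<epsilon>0"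
    "\<And>\<epsilon> t. 0 < \<epsilon> \<Longrightarrow> \<epsilon> \<le> \<epsilon>0 \<Longrightarrow> t \<in> {a..0} \<Longrightarrow> (\<Sum>\<^sub>\<infinity>k. \<epsilon> * (cmod (\<omega> t k))\<^sup>2 / (1 + \<epsilon> * n2 k)) \<le> \<eta>"
proof -
  let ?f = "\<lambda>\<epsilon> t. \<Sum>\<^sub>\<infinity>k. \<epsilon> * (cmod (\<omega> t k))\<^sup>2 / (1 + \<epsilon> * n2 k)"
  define R where "R t0 d \<epsilon>0 \<longleftrightarrow> 0 < d \<and> 0 < \<epsilon>0 \<and> (\<forall>t \<epsilon>. 0 < \<epsilon> \<and> \<epsilon> \<le> \<epsilon>0 \<and> dist t t0 < d \<longrightarrow> ?f \<epsilon> t \<le> \<eta>)" for t0 d \<epsilon>0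
  have "\<exists>d \<epsilon>0. R t0 d \<epsilon>0" for t0
  proof -
    let ?e = "\<lambda>k. (cmod (\<omega> t0 k))\<^sup>2 / n2 k"
    obtain F where F: "finite F" "energy (\<omega> t0) - (\<Sum>k\<in>F. ?e k) < \<eta> / 8"
    proof -
      have "((\<lambda>F. sum ?e F) \<longlongrightarrow> energy (\<omega> t0)) (finite_subsets_at_top UNIV)"
        using has_sum_infsum[OF energy_summable[of t0]] unfolding has_sum_def energy_def .
      then have "eventually (\<lambda>F. dist (sum ?e F) (energy (\<omega> t0)) < \<eta> / 8) (finite_subsets_at_top UNIV)"
        using eta by (intro tendstoD) auto
      then obtain F where F: "finite F" "dist (sum ?e F) (energy (\<omega> t0)) < \<eta> / 8"
        unfolding eventually_finite_subsets_at_top by blast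
      from F(2) have "energy (\<omega> t0) - sum ?e F < \<eta> / 8" unfolding dist_real_def by linarith
      with F(1) show ?thesis by (rule that)
    qed
    define B where "B = (\<Sum>k\<in>F. (cmod (\<omega> t0 k))\<^sup>2)"
    have B0: "0 \<le> B" by (simp add: B_def sum_nonneg)
    define \<epsilon>0 where "\<epsilon>0 = \<eta> / (8 * (B + 1))"
    have e0: "0 < \<epsilon>0" using eta B0 by (simp add: \<epsilon>0_def)
    have "eventually (\<lambda>s. dist (energy (\<lambda>k. \<omega> s k - \<omega> t0 k)) 0 < \<eta> / 4) (at t0)"
      using eta by (intro tendstoD[OF strong_cont]) auto
    then obtain d where d: "0 < d" "\<And>s. s \<noteq> t0 \<Longrightarrow> dist s t0 < d \<Longrightarrow> energy (\<lambda>k. \<omega> s k - \<omega> t0 k) < \<eta> / 4"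
      unfolding eventually_at by (auto simp: energy_nonneg)
    have d': "energy (\<lambda>k. \<omega> s k - \<omega> t0 k) \<le> \<eta> / 4" if "dist s t0 < d" for s
      using d(2)[of s] that eta by (cases "s = t0") (auto simp: energy_def)
    have "?f \<epsilon> t \<le> \<eta>" if e: "0 < \<epsilon>" "\<epsilon> \<le> \<epsilon>0" and t: "dist t t0 < d" for t \<epsilon>
    proof -
      have f0: "?f \<epsilon> t0 \<le> \<eta> / 4"
      proof (rule infsum_le_finite_sums[OF damped_summable(1)[OF e(1)]])
        fix H :: "idx set" assume H: "finite H"
        let ?t = "\<lambda>k. \<epsilon> * (cmod (\<omega> t0 k))\<^sup>2 / (1 + \<epsilon> * n2 k)"
        have t0: "0 \<le> ?t k" for k using e by (intro divide_nonneg_nonneg add_nonneg_nonneg mult_nonneg_nonneg) auto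
        have "sum ?t H \<le> sum ?t (H \<union> F)" using H F(1) t0 by (intro sum_mono2) auto
        also have "\<dots> = sum ?t F + sum ?t (H - F)"
          using H F(1) by (subst sum.union_disjoint[symmetric]) (auto intro: sum.cong)
        also have "sum ?t F \<le> (\<Sum>k\<in>F. \<epsilon> * (cmod (\<omega> t0 k))\<^sup>2)"
          by (intro sum_mono damped_summable(3) e)
        also have "\<dots> = \<epsilon> * B" by (simp add: B_def sum_distrib_left)
        also have "\<dots> \<le> \<epsilon>0 * (B + 1)" using e B0 by (intro mult_mono) auto
        also have "\<dots> = \<eta> / 8" using B0 by (simp add: \<epsilon>0_def field_simps)
        also have "sum ?t (H - F) \<le> sum ?e (H - F)"
          by (intro sum_mono damped_summable(2) e)
        also have "sum ?e (H - F) \<le> \<eta> / 8"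
        proof -
          have "sum ?e F + sum ?e (H - F) = sum ?e (F \<union> (H - F))"
            using H F(1) by (intro sum.union_disjoint[symmetric]) auto
          also have "\<dots> \<le> energy (\<omega> t0)"
            unfolding energy_def using H F(1) by (intro finite_sum_le_infsum energy_summable) auto
          finally show ?thesis using F(2) by linarith
        qed
        finally show "sum ?t H \<le> \<eta> / 4" by linarith
      qed
      have p: "0 < 1 + \<epsilon> * n2 k" for k using e by (intro add_pos_nonneg mult_nonneg_nonneg) auto
      have tm: "\<epsilon> * (cmod (\<omega> t k))\<^sup>2 / (1 + \<epsilon> * n2 k) \<le>
          2 * (\<epsilon> * (cmod (\<omega> t0 k))\<^sup>2 / (1 + \<epsilon> * n2 k)) + 2 * ((cmod (\<omega> t k - \<omega> t0 k))\<^sup>2 / n2 k)" for k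
      proof (cases "k = 0")
        case False
        then have n: "0 < n2 k" by (simp add: less_le)
        define x y where "x = cmod (\<omega> t0 k)" and "y = cmod (\<omega> t k - \<omega> t0 k)"
        have "cmod (\<omega> t k) \<le> x + y" unfolding x_def y_def by (rule norm_triangle_sub)
        then have "(cmod (\<omega> t k))\<^sup>2 \<le> (x + y)\<^sup>2" by (intro power_mono) auto
        also have "\<dots> \<le> 2 * x\<^sup>2 + 2 * y\<^sup>2" using sum_squares_bound[of x y] by (simp add: power2_sum)
        finally have "\<epsilon> * (cmod (\<omega> t k))\<^sup>2 / (1 + \<epsilon> * n2 k) \<le> \<epsilon> * (2 * x\<^sup>2 + 2 * y\<^sup>2) / (1 + \<epsilon> * n2 k)"
          using e p[of k] by (intro divide_right_mono mult_left_mono) auto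
        also have "\<dots> = 2 * (\<epsilon> * x\<^sup>2 / (1 + \<epsilon> * n2 k)) + 2 * (\<epsilon> * y\<^sup>2 / (1 + \<epsilon> * n2 k))"
          by (simp add: add_divide_distrib algebra_simps)
        also have "\<epsilon> * y\<^sup>2 / (1 + \<epsilon> * n2 k) \<le> \<epsilon> * y\<^sup>2 / (\<epsilon> * n2 k)"
          using e p[of k] n by (intro divide_left_mono mult_pos_pos) auto
        also have "\<epsilon> * y\<^sup>2 / (\<epsilon> * n2 k) = y\<^sup>2 / n2 k" using e by simp
        finally show ?thesis unfolding x_def y_def by simp
      qed (simp add: zero)
      note S = summable_on_cmult_right[OF damped_summable(1)[OF e(1), of t0], of 2]
        summable_on_cmult_right[OF diff_energy_summable[of t t0], of 2]
      have "?f \<epsilon> t \<le> (\<Sum>\<^sub>\<infinity>k. 2 * (\<epsilon> * (cmod (\<omega> t0 k))\<^sup>2 / (1 + \<epsilon> * n2 k)) + 2 * ((cmod (\<omega> t k - \<omega> t0 k))\<^sup>2 / n2 k))"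
        by (intro infsum_mono damped_summable(1) e summable_on_add S tm)
      also have "\<dots> = 2 * ?f \<epsilon> t0 + 2 * energy (\<lambda>k. \<omega> t k - \<omega> t0 k)"
        unfolding infsum_add[OF S] infsum_cmult_right' energy_def ..
      also have "\<dots> \<le> \<eta>" using f0 d'[OF t] by linarith
      finally show ?thesis .
    qed
    then have "R t0 d \<epsilon>0" unfolding R_def using d(1) e0 by blast
    then show ?thesis by blast
  qed
  then obtain d E where R: "\<And>t0. R t0 (d t0) (E t0)" by metis
  have dE: "0 < d t0" "0 < E t0" for t0 using R[of t0] unfolding R_def by blast+
  have dE3: "?f \<epsilon> t \<le> \<eta>" if "0 < \<epsilon>" "\<epsilon> \<le> E t0" "dist t t0 < d t0" for t0 t \<epsilon>
    using R[of t0] that unfolding R_def by blast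
  have cover: "{a..0} \<subseteq> (\<Union>t0\<in>{a..0}. ball t0 (d t0))"
  proof
    fix t assume "t \<in> {a..0}"
    moreover have "t \<in> ball t (d t)" using dE(1) by simp
    ultimately show "t \<in> (\<Union>t0\<in>{a..0}. ball t0 (d t0))" by blast
  qed
  have op: "open (ball t0 (d t0))" if "t0 \<in> {a..0}" for t0 by simp
  obtain T where T: "T \<subseteq> {a..0}" "finite T" "{a..0} \<subseteq> (\<Union>t0\<in>T. ball t0 (d t0))"
    by (rule compactE_image[OF compact_Icc op cover], assumption, rule that)
  define \<epsilon>0 where "\<epsilon>0 = Min (insert 1 (E ` T))"
  show ?thesis
  proof (rule that[of \<epsilon>0])
    show "0 < \<epsilon>0" unfolding \<epsilon>0_def using T(2) dE(2) by (subst Min_gr_iff) auto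
    fix \<epsilon> t assume e: "0 < \<epsilon>" "\<epsilon> \<le> \<epsilon>0" and t: "t \<in> {a..0}"
    obtain t0 where t0: "t0 \<in> T" "dist t t0 < d t0" using T(3) t by (auto simp: dist_commute)
    have "\<epsilon>0 \<le> E t0" unfolding \<epsilon>0_def using T(2) t0(1) by (intro Min_le) auto
    then show "?f \<epsilon> t \<le> \<eta>" using dE3[OF e(1) _ t0(2)] e by linarith
  qed
qed

lemma off_shell_bound:
  assumes start: "\<And>k. \<omega> 0 k = 0" and a: "a \<le> 0"
    and P: "(\<lambda>k. (cmod (\<omega> a k))\<^sup>2) summable_on UNIV" and k: "k \<noteq> 0"
  shows "\<nu> * ((n2 k - \<mu>)\<^sup>2 / n2 k / 2) * integral\<^sup>L (lebesgue_on {a..0}) (\<lambda>t. exp (2 * \<nu> * \<mu> * t) * (cmod (\<omega> t k))\<^sup>2)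
    \<le> exp (2 * \<nu> * \<mu> * a) * enstrophy (\<omega> a)"
proof -
  define c where "c = 2 * \<nu> * \<mu>"
  have c0: "0 \<le> c" using nu mu by (simp add: c_def)
  define K where "K = 30 * \<bar>\<kappa>\<bar> * (1 + \<mu>)"
  have K0: "0 \<le> K" using mu by (simp add: K_def)
  define \<delta> where "\<delta> = (n2 k - \<mu>)\<^sup>2 / n2 k / 2"
  let ?A = "lebesgue_on {a..0}"
  define I where "I = integral\<^sup>L ?A (\<lambda>t. exp (c * t) * (cmod (\<omega> t k))\<^sup>2)"
  define J where "J = integral\<^sup>L ?A e"
  have main: "\<nu> * \<delta> * I \<le> exp (c * a) * enstrophy (\<omega> a) + \<eta> * (2 * K * \<mu> * J)"
    if eta: "0 < \<eta>" "K * \<eta> \<le> \<nu>" for \<eta>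
  proof -
    have eta2: "0 < \<eta>\<^sup>2" using eta by simp
    obtain \<epsilon>0 where e0: "0 < \<epsilon>0"
      "\<And>\<epsilon> t. 0 < \<epsilon> \<Longrightarrow> \<epsilon> \<le> \<epsilon>0 \<Longrightarrow> t \<in> {a..0} \<Longrightarrow> (\<Sum>\<^sub>\<infinity>k. \<epsilon> * (cmod (\<omega> t k))\<^sup>2 / (1 + \<epsilon> * n2 k)) \<le> \<eta>\<^sup>2"
      by (rule uniform_damping[OF eta2, of a]) (rule that)
    define \<epsilon> where "\<epsilon> = min \<epsilon>0 (min 1 (1 / n2 k))"
    have n1: "1 \<le> n2 k" using k by (rule n2_ge_1)
    have e: "0 < \<epsilon>" "\<epsilon> \<le> \<epsilon>0" "\<epsilon> \<le> 1" "\<epsilon> * n2 k \<le> 1"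
    proof -
      show "0 < \<epsilon>" "\<epsilon> \<le> \<epsilon>0" using e0(1) n1 by (auto simp: \<epsilon>_def)
      show "\<epsilon> \<le> 1" unfolding \<epsilon>_def by linarith
      have "\<epsilon> \<le> 1 / n2 k" by (simp add: \<epsilon>_def)
      then show "\<epsilon> * n2 k \<le> 1" using n1 by (simp add: le_divide_eq)
    qed
    have p: "1 \<le> 1 + \<epsilon> * n2 j" "0 < 1 + \<epsilon> * n2 j" for j
      using e(1) n2_nonneg[of j] by (auto intro: add_pos_nonneg)
    define \<theta> where "\<theta> j = (n2 j - \<mu>) / (1 + \<epsilon> * n2 j)" for j
    have th: "\<bar>\<theta> j\<bar> \<le> \<mu> + 1 / \<epsilon>" for j unfolding \<theta>_def using e mu by (intro rational_weight_bound) auto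
    have even: "\<theta> (- j) = \<theta> j" for j by (simp add: \<theta>_def)
    define h where "h t = exp (c * t) * ((\<Sum>\<^sub>\<infinity>k. \<theta> k / n2 k * ((c - 2 * \<nu> * n2 k) * (cmod (\<omega> t k))\<^sup>2))
      + 2 * (\<Sum>\<^sub>\<infinity>k. \<theta> k / n2 k * Re (g k * cnj (\<omega> t k))) - 2 * \<kappa> * Re (transfer \<theta> (\<omega> t)))" for t
    note bal = balance[where a = a and b = 0 and c = c and \<theta> = \<theta>, OF a th even, folded h_def]
    define w where "w t = - (\<nu> * \<delta>) * (exp (c * t) * (cmod (\<omega> t k))\<^sup>2) + \<eta> * (2 * K * \<mu>) * e t" for t
    have hle: "h t \<le> w t" if t: "t \<in> {a..0}" and Pt: "(\<lambda>k. (cmod (\<omega> t k))\<^sup>2) summable_on UNIV"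
      and Pe: "enstrophy (\<omega> t) \<le> e t" for t
    proof -
      let ?x = "\<omega> t"
      define zf where "zf j = (n2 j - \<mu>)\<^sup>2 / n2 j / (1 + \<epsilon> * n2 j) * (cmod (?x j))\<^sup>2" for j
      define Zf where "Zf = (\<Sum>\<^sub>\<infinity>j. zf j)"
      define D where "D = (\<Sum>\<^sub>\<infinity>j. n2 j * (cmod (?x j))\<^sup>2 / (1 + \<epsilon> * n2 j))"
      define Z where "Z = (\<Sum>\<^sub>\<infinity>j. (cmod (?x j))\<^sup>2 / (1 + \<epsilon> * n2 j))"
      have zf0: "0 \<le> zf j" for j unfolding zf_def using p(2)[of j] by (intro mult_nonneg_nonneg divide_nonneg_nonneg) auto
      have Ds: "(\<lambda>j. n2 j * (cmod (?x j))\<^sup>2 / (1 + \<epsilon> * n2 j)) summable_on UNIV"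
      proof (rule summable_on_comparison_test[OF summable_on_cmult_right[OF Pt, of "1 / \<epsilon>"]])
        fix j
        have "\<epsilon> * n2 j * (cmod (?x j))\<^sup>2 \<le> (1 + \<epsilon> * n2 j) * (cmod (?x j))\<^sup>2" by (intro mult_right_mono) auto
        then show "n2 j * (cmod (?x j))\<^sup>2 / (1 + \<epsilon> * n2 j) \<le> 1 / \<epsilon> * (cmod (?x j))\<^sup>2"
          using p(2)[of j] e(1) by (simp add: divide_simps mult_ac)
        show "0 \<le> n2 j * (cmod (?x j))\<^sup>2 / (1 + \<epsilon> * n2 j)"
          using p(2)[of j] by (intro divide_nonneg_pos mult_nonneg_nonneg) auto
      qed
      have zfs: "zf summable_on UNIV"
      proof (rule summable_on_comparison_test)
        show "(\<lambda>j. n2 j * (cmod (?x j))\<^sup>2 / (1 + \<epsilon> * n2 j) + \<mu>\<^sup>2 * (cmod (?x j))\<^sup>2) summable_on UNIV"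
          by (intro summable_on_add Ds summable_on_cmult_right Pt)
        fix j
        show "zf j \<le> n2 j * (cmod (?x j))\<^sup>2 / (1 + \<epsilon> * n2 j) + \<mu>\<^sup>2 * (cmod (?x j))\<^sup>2"
        proof (cases "j = 0")
          case False
          then have j: "1 \<le> n2 j" by (rule n2_ge_1)
          have "(n2 j - \<mu>)\<^sup>2 / n2 j \<le> n2 j + \<mu>\<^sup>2"
          proof -
            have "(n2 j - \<mu>)\<^sup>2 \<le> n2 j * n2 j + \<mu>\<^sup>2 * 1"
            proof -
              have "(n2 j - \<mu>)\<^sup>2 = n2 j * n2 j - 2 * (n2 j * \<mu>) + \<mu>\<^sup>2" by (simp add: power2_eq_square algebra_simps)
              moreover have "0 \<le> n2 j * \<mu>" using mu by simp
              ultimately show ?thesis by linarith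
            qed
            also have "\<dots> \<le> n2 j * n2 j + \<mu>\<^sup>2 * n2 j" using j by (intro add_mono mult_left_mono) auto
            finally show ?thesis using j by (simp add: divide_le_eq algebra_simps)
          qed
          then have "zf j \<le> (n2 j + \<mu>\<^sup>2) / (1 + \<epsilon> * n2 j) * (cmod (?x j))\<^sup>2"
            unfolding zf_def using p(2)[of j] by (intro mult_right_mono divide_right_mono) auto
          also have "\<dots> = n2 j * (cmod (?x j))\<^sup>2 / (1 + \<epsilon> * n2 j) + \<mu>\<^sup>2 / (1 + \<epsilon> * n2 j) * (cmod (?x j))\<^sup>2"
            by (simp add: add_divide_distrib distrib_right)
          also have "\<mu>\<^sup>2 / (1 + \<epsilon> * n2 j) * (cmod (?x j))\<^sup>2 \<le> \<mu>\<^sup>2 * (cmod (?x j))\<^sup>2"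
            using divide_left_mono[OF p(1)[of j], of "\<mu>\<^sup>2"] p(2)[of j] by (intro mult_right_mono) auto
          finally show ?thesis by simp
        qed (simp add: zf_def zero)
      qed (rule zf0)
      have Zf: "(\<Sum>\<^sub>\<infinity>j. \<theta> j / n2 j * ((c - 2 * \<nu> * n2 j) * (cmod (?x j))\<^sup>2)) = - 2 * \<nu> * Zf"
      proof -
        have "\<theta> j / n2 j * ((c - 2 * \<nu> * n2 j) * (cmod (?x j))\<^sup>2) = (- 2 * \<nu>) * zf j" for j
        proof -
          have "(n2 j - \<mu>) * (c - 2 * \<nu> * n2 j) = - 2 * \<nu> * (n2 j - \<mu>)\<^sup>2" by (simp add: c_def power2_eq_square algebra_simps)
          then have "(n2 j - \<mu>) * (c - 2 * \<nu> * n2 j) / n2 j / (1 + \<epsilon> * n2 j) * (cmod (?x j))\<^sup>2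
             = (- 2 * \<nu>) * (n2 j - \<mu>)\<^sup>2 / n2 j / (1 + \<epsilon> * n2 j) * (cmod (?x j))\<^sup>2" by simp
          then show ?thesis by (simp add: \<theta>_def zf_def mult_ac)
        qed
        then show ?thesis unfolding Zf_def by (simp only: infsum_cmult_right')
      qed
      have Gam: "(\<Sum>\<^sub>\<infinity>j. \<theta> j / n2 j * Re (g j * cnj (?x j))) = 0"
      proof (rule infsum_0)
        fix j show "\<theta> j / n2 j * Re (g j * cnj (?x j)) = 0"
          using forcing[of j] by (cases "g j = 0") (auto simp: \<theta>_def)
      qed
      have D_le: "D \<le> Zf + 2 * \<mu> * enstrophy ?x"
      proof -
        have "D \<le> (\<Sum>\<^sub>\<infinity>j. zf j + 2 * \<mu> * (cmod (?x j))\<^sup>2)" unfolding D_def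
        proof (rule infsum_mono[OF Ds])
          show "(\<lambda>j. zf j + 2 * \<mu> * (cmod (?x j))\<^sup>2) summable_on UNIV"
            by (intro summable_on_add zfs summable_on_cmult_right Pt)
          fix j
          show "n2 j * (cmod (?x j))\<^sup>2 / (1 + \<epsilon> * n2 j) \<le> zf j + 2 * \<mu> * (cmod (?x j))\<^sup>2"
          proof (cases "j = 0")
            case False
            then have j: "1 \<le> n2 j" by (rule n2_ge_1)
            have "n2 j \<le> (n2 j - \<mu>)\<^sup>2 / n2 j + 2 * \<mu>"
            proof -
              have "(n2 j - \<mu>)\<^sup>2 / n2 j = n2 j - 2 * \<mu> + \<mu>\<^sup>2 / n2 j"
              proof -
                have "(n2 j - \<mu>)\<^sup>2 = n2 j * (n2 j - 2 * \<mu>) + \<mu>\<^sup>2" by (simp add: power2_eq_square algebra_simps)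
                then show ?thesis using j False by (simp add: add_divide_distrib)
              qed
              then show ?thesis by simp
            qed
            then have "n2 j / (1 + \<epsilon> * n2 j) \<le> ((n2 j - \<mu>)\<^sup>2 / n2 j + 2 * \<mu>) / (1 + \<epsilon> * n2 j)"
              using p(2)[of j] by (intro divide_right_mono) auto
            also have "\<dots> \<le> (n2 j - \<mu>)\<^sup>2 / n2 j / (1 + \<epsilon> * n2 j) + 2 * \<mu>"
              using divide_left_mono[OF p(1)[of j], of "2 * \<mu>"] p(2)[of j] mu by (simp add: add_divide_distrib)
            finally have "n2 j / (1 + \<epsilon> * n2 j) * (cmod (?x j))\<^sup>2 \<le> ((n2 j - \<mu>)\<^sup>2 / n2 j / (1 + \<epsilon> * n2 j) + 2 * \<mu>) * (cmod (?x j))\<^sup>2"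
              by (intro mult_right_mono) auto
            then show ?thesis unfolding zf_def distrib_right by simp
          qed (simp add: zf_def zero)
        qed
        also have "\<dots> = Zf + 2 * \<mu> * enstrophy ?x"
          unfolding infsum_add[OF zfs summable_on_cmult_right[OF Pt]] infsum_cmult_right' Zf_def enstrophy_def ..
        finally show ?thesis .
      qed
      have Z0: "0 \<le> Z" unfolding Z_def using p(2) by (intro infsum_nonneg divide_nonneg_pos) auto
      have sZ: "sqrt \<epsilon> * sqrt Z \<le> \<eta>"
      proof -
        have "\<epsilon> * Z = (\<Sum>\<^sub>\<infinity>j. \<epsilon> * (cmod (?x j))\<^sup>2 / (1 + \<epsilon> * n2 j))"
          unfolding Z_def infsum_cmult_right'[symmetric] by simp
        also have "\<dots> \<le> \<eta>\<^sup>2" using e0(2)[OF e(1,2) t] .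
        finally have "sqrt (\<epsilon> * Z) \<le> \<eta>" using eta(1) by (intro real_le_lsqrt) (auto simp: Z0 less_imp_le[OF e(1)])
        then show ?thesis by (simp add: real_sqrt_mult)
      qed
      have D0: "0 \<le> D" unfolding D_def using p(2) by (intro infsum_nonneg divide_nonneg_pos mult_nonneg_nonneg) auto
      have "norm (transfer \<theta> ?x) \<le> 15 * (1 + \<epsilon> * \<mu>) * sqrt \<epsilon> * sqrt Z * D"
        unfolding \<theta>_def Z_def D_def by (rule transfer_bound[OF zero Pt e(1)]) (use mu in simp)
      also have "\<dots> = 15 * (1 + \<epsilon> * \<mu>) * (sqrt \<epsilon> * sqrt Z) * D" by simp
      also have "\<dots> \<le> 15 * (1 + \<mu>) * \<eta> * D"
      proof -
        have "\<epsilon> * \<mu> \<le> 1 * \<mu>" using e(3) mu by (intro mult_right_mono) auto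
        then show ?thesis using sZ e mu D0 Z0 by (intro mult_right_mono mult_mono mult_left_mono) auto
      qed
      finally have T: "norm (transfer \<theta> ?x) \<le> 15 * (1 + \<mu>) * \<eta> * D" .
      have "- 2 * \<kappa> * Re (transfer \<theta> ?x) \<le> 2 * \<bar>\<kappa>\<bar> * norm (transfer \<theta> ?x)"
      proof -
        have "- (\<kappa> * Re (transfer \<theta> ?x)) \<le> \<bar>\<kappa>\<bar> * \<bar>Re (transfer \<theta> ?x)\<bar>"
          using abs_ge_minus_self[of "\<kappa> * Re (transfer \<theta> ?x)"] by (simp add: abs_mult)
        also have "\<dots> \<le> \<bar>\<kappa>\<bar> * norm (transfer \<theta> ?x)" by (intro mult_left_mono abs_Re_le_cmod) auto
        finally show ?thesis by simp
      qed
      also have "\<dots> \<le> 2 * \<bar>\<kappa>\<bar> * (15 * (1 + \<mu>) * \<eta> * D)" by (intro mult_left_mono T) auto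
      also have "\<dots> = K * \<eta> * D" by (simp add: K_def)
      also have "\<dots> \<le> K * \<eta> * (Zf + 2 * \<mu> * enstrophy ?x)"
        using D_le K0 eta(1) by (intro mult_left_mono) auto
      also have "\<dots> \<le> \<nu> * Zf + K * \<eta> * (2 * \<mu> * e t)"
      proof -
        have "K * \<eta> * Zf \<le> \<nu> * Zf" using eta(2) unfolding Zf_def by (intro mult_right_mono infsum_nonneg zf0)
        moreover have "K * \<eta> * (2 * \<mu> * enstrophy ?x) \<le> K * \<eta> * (2 * \<mu> * e t)"
          using Pe K0 eta(1) mu by (intro mult_left_mono) auto
        ultimately show ?thesis by (simp add: distrib_left)
      qed
      finally have tt: "- 2 * \<kappa> * Re (transfer \<theta> ?x) \<le> \<nu> * Zf + K * \<eta> * (2 * \<mu> * e t)" .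
      have Zk: "\<delta> * (cmod (?x k))\<^sup>2 \<le> Zf"
      proof -
        have "\<delta> \<le> (n2 k - \<mu>)\<^sup>2 / n2 k / (1 + \<epsilon> * n2 k)"
          unfolding \<delta>_def using e(4) p(2)[of k] n1 by (intro divide_left_mono mult_pos_pos divide_nonneg_pos) auto
        then have "\<delta> * (cmod (?x k))\<^sup>2 \<le> zf k" unfolding zf_def by (intro mult_right_mono) auto
        also have "zf k = sum zf {k}" by simp
        also have "\<dots> \<le> Zf" unfolding Zf_def by (rule finite_sum_le_infsum[OF zfs]) (auto simp: zf0)
        finally show ?thesis .
      qed
      have et: "0 \<le> e t" using order_trans[OF _ Pe] by (simp add: enstrophy_def infsum_nonneg)
      have "h t = exp (c * t) * (- 2 * \<nu> * Zf - 2 * \<kappa> * Re (transfer \<theta> ?x))"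
        unfolding h_def Zf Gam by simp
      also have "\<dots> \<le> exp (c * t) * (- \<nu> * (\<delta> * (cmod (?x k))\<^sup>2) + K * \<eta> * (2 * \<mu> * e t))"
      proof (rule mult_left_mono)
        have "\<nu> * (\<delta> * (cmod (?x k))\<^sup>2) \<le> \<nu> * Zf" using Zk nu by (intro mult_left_mono) auto
        then show "- 2 * \<nu> * Zf - 2 * \<kappa> * Re (transfer \<theta> ?x) \<le> - \<nu> * (\<delta> * (cmod (?x k))\<^sup>2) + K * \<eta> * (2 * \<mu> * e t)"
          using tt by linarith
      qed simp
      also have "\<dots> = - (\<nu> * \<delta>) * (exp (c * t) * (cmod (?x k))\<^sup>2) + exp (c * t) * (K * \<eta> * (2 * \<mu> * e t))"
        by (simp add: algebra_simps)
      also have "exp (c * t) * (K * \<eta> * (2 * \<mu> * e t)) \<le> 1 * (K * \<eta> * (2 * \<mu> * e t))"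
      proof (rule mult_right_mono)
        show "exp (c * t) \<le> 1" using t c0 by (simp add: mult_nonneg_nonpos)
        show "0 \<le> K * \<eta> * (2 * \<mu> * e t)" using K0 eta(1) mu et by (intro mult_nonneg_nonneg) auto
      qed
      finally show ?thesis unfolding w_def by (simp add: mult_ac)
    qed
    have ci: "integrable ?A (\<lambda>t. exp (c * t) * (cmod (\<omega> t k))\<^sup>2)"
      by (intro absolutely_integrable_imp_integrable absolutely_integrable_continuous_real continuous_intros mode_cont) simp
    have wi: "integrable ?A w" unfolding w_def
      using ci e_int by (intro Bochner_Integration.integrable_add integrable_mult_right) auto
    have "integral\<^sup>L ?A h \<le> integral\<^sup>L ?A w"
    proof (rule integral_mono_AE[OF bal(1) wi])
      show "AE t in ?A. h t \<le> w t"
        using enstrophy_ae_on[of a 0] AE_space by eventually_elim (use hle in auto)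
    qed
    also have "integral\<^sup>L ?A w = - (\<nu> * \<delta>) * I + \<eta> * (2 * K * \<mu>) * J"
      unfolding w_def I_def J_def using ci e_int
      by (subst Bochner_Integration.integral_add) (auto intro!: integrable_mult_right)
    also have "integral\<^sup>L ?A h = - exp (c * a) * (\<Sum>\<^sub>\<infinity>k. \<theta> k / n2 k * (cmod (\<omega> a k))\<^sup>2)"
      unfolding bal(2)[symmetric] by (simp add: start)
    finally have "\<nu> * \<delta> * I \<le> exp (c * a) * (\<Sum>\<^sub>\<infinity>k. \<theta> k / n2 k * (cmod (\<omega> a k))\<^sup>2) + \<eta> * (2 * K * \<mu> * J)"
      by (simp add: mult_ac)
    also have "(\<Sum>\<^sub>\<infinity>k. \<theta> k / n2 k * (cmod (\<omega> a k))\<^sup>2) \<le> enstrophy (\<omega> a)"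
      unfolding enstrophy_def
    proof (rule infsum_mono_neutral[OF _ P])
      show "(\<lambda>k. \<theta> k / n2 k * (cmod (\<omega> a k))\<^sup>2) summable_on UNIV"
      proof (rule abs_summable_summable, rule summable_on_comparison_test[OF summable_on_cmult_right[OF energy_summable[of a], of "\<mu> + 1 / \<epsilon>"]])
        fix j show "norm (\<theta> j / n2 j * (cmod (\<omega> a j))\<^sup>2) \<le> (\<mu> + 1 / \<epsilon>) * ((cmod (\<omega> a j))\<^sup>2 / n2 j)"
          using mult_right_mono[OF th[of j], of "(cmod (\<omega> a j))\<^sup>2 / n2 j"] by (simp add: abs_mult)
      qed auto
      fix j
      show "\<theta> j / n2 j * (cmod (\<omega> a j))\<^sup>2 \<le> (cmod (\<omega> a j))\<^sup>2"
      proof (cases "j = 0")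
        case False
        then have j: "1 \<le> n2 j" by (rule n2_ge_1)
        have "\<theta> j \<le> n2 j / 1"
          unfolding \<theta>_def using p[of j] mu j by (intro frac_le) auto
        then have "\<theta> j / n2 j \<le> 1" using j by (simp add: divide_le_eq)
        then show ?thesis using mult_right_mono[of "\<theta> j / n2 j" 1 "(cmod (\<omega> a j))\<^sup>2"] by simp
      qed (simp add: zero)
    qed auto
    finally show ?thesis by (simp add: mult_left_mono)
  qed
  have "\<nu> * \<delta> * I \<le> exp (c * a) * enstrophy (\<omega> a)"
  proof (rule field_le_epsilon)
    fix r :: real assume r: "0 < r"
    define \<eta> where "\<eta> = min (\<nu> / (K + 1)) (r / (\<bar>2 * K * \<mu> * J\<bar> + 1))"
    have eta: "0 < \<eta>" using nu K0 r by (simp add: \<eta>_def)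
    have "K * \<eta> \<le> (K + 1) * (\<nu> / (K + 1))" using K0 nu eta by (intro mult_mono) (auto simp: \<eta>_def)
    then have "K * \<eta> \<le> \<nu>" using K0 by simp
    from main[OF eta this] have "\<nu> * \<delta> * I \<le> exp (c * a) * enstrophy (\<omega> a) + \<eta> * (2 * K * \<mu> * J)" .
    moreover have "\<eta> * (2 * K * \<mu> * J) \<le> \<eta> * (\<bar>2 * K * \<mu> * J\<bar> + 1)" using eta by (intro mult_left_mono) linarith+
    moreover have "\<dots> \<le> (r / (\<bar>2 * K * \<mu> * J\<bar> + 1)) * (\<bar>2 * K * \<mu> * J\<bar> + 1)" by (intro mult_right_mono) (auto simp: \<eta>_def)
    moreover have "\<dots> = r" using abs_ge_zero[of "2 * K * \<mu> * J"] by (simp add: add_nonneg_eq_0_iff)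
    ultimately show "\<nu> * \<delta> * I \<le> exp (c * a) * enstrophy (\<omega> a) + r" by linarith
  qed
  then show ?thesis by (simp add: \<delta>_def c_def I_def)
qed

lemma off_shell_vanishes:
  assumes start: "\<And>k. \<omega> 0 k = 0" and t: "t \<le> 0" and k: "n2 k \<noteq> \<mu>"
  shows "\<omega> t k = 0"
proof (cases "k = 0")
  case False
  define a where "a = t - 1"
  define c where "c = 2 * \<nu> * \<mu>"
  have c0: "0 < c" using nu mu by (simp add: c_def)
  let ?f = "\<lambda>s. exp (c * s) * (cmod (\<omega> s k))\<^sup>2"
  define d where "d = \<nu> * ((n2 k - \<mu>)\<^sup>2 / n2 k / 2)"
  have d0: "0 < d" using nu k n2_ge_1[OF False] by (auto simp: d_def)
  obtain C where C: "\<And>a. \<exists>t\<in>{a..a + 1}. (\<lambda>k. (cmod (\<omega> t k))\<^sup>2) summable_on UNIV \<and> enstrophy (\<omega> t) \<le> C"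
    by (rule energy_dissipation) (rule that)
  have ai: "?f absolutely_integrable_on {u..v}" for u v
    by (intro absolutely_integrable_continuous_real continuous_intros mode_cont)
  have int: "?f integrable_on {u..v}" for u v
    using ai[of u v] by (simp add: absolutely_integrable_on_def)
  have L: "integral\<^sup>L (lebesgue_on {u..v}) ?f = integral {u..v} ?f" for u v
    by (rule lebesgue_integral_eq_integral[OF absolutely_integrable_imp_integrable[OF ai]]) auto
  have C0: "0 \<le> C"
  proof -
    obtain s where "enstrophy (\<omega> s) \<le> C" using C by blast
    moreover have "0 \<le> enstrophy (\<omega> s)" by (simp add: enstrophy_def infsum_nonneg)
    ultimately show ?thesis by linarith
  qed
  have le: "d * integral {a..0} ?f \<le> exp (c * (a - real n)) * C" for n
  proof -
    obtain s where s: "s \<in> {a - real n - 1..a - real n - 1 + 1}" "(\<lambda>k. (cmod (\<omega> s k))\<^sup>2) summable_on UNIV" "enstrophy (\<omega> s) \<le> C"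
      using C by blast
    have sa: "s \<le> a - real n" using s(1) by simp
    have s0: "s \<le> a" "s \<le> 0" using sa t by (auto simp: a_def)
    have "integral {a..0} ?f \<le> integral {s..0} ?f"
      using s0 by (intro integral_subset_le int) auto
    then have "d * integral {a..0} ?f \<le> d * integral {s..0} ?f" using d0 by (intro mult_left_mono) auto
    also have "d * integral {s..0} ?f \<le> exp (c * s) * enstrophy (\<omega> s)"
    proof -
      have "d * integral\<^sup>L (lebesgue_on {s..0}) ?f \<le> exp (c * s) * enstrophy (\<omega> s)"
        using off_shell_bound[OF start s0(2) s(2) False] unfolding d_def c_def .
      then show ?thesis unfolding L .
    qed
    also have "\<dots> \<le> exp (c * (a - real n)) * C"
      using sa s(3) C0 c0 by (intro mult_mono) (auto simp: enstrophy_def infsum_nonneg)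
    finally show ?thesis .
  qed
  have "(\<lambda>n. exp (c * a) * exp (- c) ^ n * C) \<longlonglongrightarrow> exp (c * a) * 0 * C"
    using c0 by (intro tendsto_mult tendsto_const LIMSEQ_realpow_zero) auto
  moreover have "exp (c * a) * exp (- c) ^ n = exp (c * (a - real n))" for n
    by (simp add: exp_of_nat_mult[symmetric] exp_add[symmetric] algebra_simps)
  ultimately have "(\<lambda>n. exp (c * (a - real n)) * C) \<longlonglongrightarrow> 0 * C" by simp
  then have "d * integral {a..0} ?f \<le> 0 * C" by (rule LIMSEQ_le_const) (use le in auto)
  then have "integral {a..0} ?f \<le> 0" using d0 by (simp add: mult_le_0_iff)
  moreover have "0 \<le> integral {a..0} ?f" by (intro integral_nonneg int) auto
  ultimately have "integral (cbox a 0) ?f = 0" by simp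
  then have "\<forall>s\<in>cbox a 0. ?f s = 0"
    by (subst (asm) integral_cbox_eq_0_iff) (use t in \<open>auto intro!: continuous_intros mode_cont simp: a_def box_real\<close>)
  then show ?thesis using t by (auto simp: a_def)
qed (simp add: zero)

lemma conv_on_shell:
  assumes x: "\<And>j. n2 j \<noteq> \<mu> \<Longrightarrow> x j = 0"
  shows "conv x k = 0"
proof -
  let ?f = "\<lambda>j. complex_of_real (crs j (k - j) / n2 j) * (x j * x (k - j))"
  have eq: "?f (k - j) = - ?f j" for j
  proof (cases "n2 j = \<mu> \<and> n2 (k - j) = \<mu>")
    case True
    have "crs (k - j) (k - (k - j)) = - crs j (k - j)" by (simp add: crs_def)
    then show ?thesis using True by (simp add: mult.commute)
  next
    case False
    then have "x j = 0 \<or> x (k - j) = 0" using x by blast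
    then show ?thesis by auto
  qed
  have b: "bij (\<lambda>j. k - j)" by (rule bij_betw_byWitness[where f' = "\<lambda>j. k - j"]) auto
  have "conv x k = (\<Sum>\<^sub>\<infinity>j. ?f (k - j))"
    unfolding conv_def by (rule infsum_reindex_bij_betw[OF b, symmetric])
  also have "\<dots> = - conv x k" unfolding eq infsum_uminus conv_def ..
  finally show ?thesis by simp
qed

text \<open>On the shell the nonlinearity vanishes, and a nonzero solution of the remaining linear equation that is zero
  at time zero grows exponentially backwards in time.\<close>
lemma forcing_vanishes:
  assumes start: "\<And>k. \<omega> 0 k = 0"
  shows "g k = 0"
proof (rule ccontr)
  assume gk: "g k \<noteq> 0"
  then have nk: "n2 k = \<mu>" by (rule forcing)
  define c where "c = \<nu> * \<mu>"
  have c0: "0 < c" using nu mu by (simp add: c_def)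
  have rhs: "vort_rhs \<nu> \<kappa> g (\<omega> t) k = g k - of_real c * \<omega> t k" if "t \<le> 0" for t
    using conv_on_shell[of "\<omega> t" k] off_shell_vanishes[OF start that] by (simp add: vort_rhs_def nk c_def)
  define y where "y t = of_real c * \<omega> t k - g k" for t
  have ode': "y v - y u = integral {u..v} (\<lambda>t. - of_real c * y t)" if "u \<le> v" "v \<le> 0" for u v
  proof -
    have "\<omega> v k - \<omega> u k = integral {u..v} (\<lambda>t. - y t)"
      unfolding ode[OF that(1)] by (rule integral_cong) (use that rhs in \<open>auto simp: y_def\<close>)
    then have "y v - y u = of_real c * integral {u..v} (\<lambda>t. - y t)"
      by (simp add: y_def right_diff_distrib[symmetric])
    also have "\<dots> = integral {u..v} (\<lambda>t. of_real c * - y t)" by (rule integral_mult_right[symmetric])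
    finally show ?thesis by simp
  qed
  have yc: "continuous_on S y" for S unfolding y_def by (intro continuous_intros mode_cont)
  have bal: "exp (2 * c * a) * (cmod (y a))\<^sup>2 = (cmod (g k))\<^sup>2" if a: "a \<le> 0" for a
  proof -
    have "exp (2 * c * 0) * (cmod (y 0))\<^sup>2 - exp (2 * c * a) * (cmod (y a))\<^sup>2
      = integral {a..0} (\<lambda>t. exp (2 * c * t) * (2 * c * (cmod (y t))\<^sup>2 + 2 * Re (- of_real c * y t * cnj (y t))))"
    proof (rule integral_mode_balance(2)[OF a _ yc])
      show "(\<lambda>t. - of_real c * y t) absolutely_integrable_on {a..0}"
        by (intro absolutely_integrable_continuous_real continuous_on_mult continuous_on_const yc)
    qed (use ode' in blast)
    also have "\<dots> = integral {a..0} (\<lambda>t. 0)"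
    proof (rule integral_cong)
      fix t show "exp (2 * c * t) * (2 * c * (cmod (y t))\<^sup>2 + 2 * Re (- of_real c * y t * cnj (y t))) = 0"
        unfolding cmod_power2 by (simp add: power2_eq_square algebra_simps)
    qed
    finally show ?thesis by (simp add: y_def start)
  qed
  define B where "B = (c * (\<mu> * M + 1) + cmod (g k))\<^sup>2"
  have yb: "(cmod (y a))\<^sup>2 \<le> B" for a
  proof -
    have "cmod (\<omega> a k) \<le> (cmod (\<omega> a k))\<^sup>2 + 1"
      using sum_squares_bound[of "cmod (\<omega> a k)" 1] norm_ge_zero[of "\<omega> a k"] unfolding power_one mult_1_right by linarith
    then have "cmod (\<omega> a k) \<le> \<mu> * M + 1" using mode_le[of a k] nk by simp
    then have "c * cmod (\<omega> a k) \<le> c * (\<mu> * M + 1)" using c0 by (intro mult_left_mono) auto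
    moreover have "cmod (y a) \<le> c * cmod (\<omega> a k) + cmod (g k)"
      unfolding y_def using norm_triangle_ineq4[of "of_real c * \<omega> a k" "g k"] c0 by (simp add: norm_mult)
    ultimately show ?thesis unfolding B_def by (intro power_mono) auto
  qed
  define a where "a = - (B / (cmod (g k))\<^sup>2) / (2 * c)"
  have B0: "0 \<le> B" by (simp add: B_def)
  have a: "a \<le> 0" using B0 c0 by (simp add: a_def divide_nonneg_nonneg)
  have "2 * c * a = - (B / (cmod (g k))\<^sup>2)" using c0 by (simp add: a_def)
  then have "exp (2 * c * a) * (1 + B / (cmod (g k))\<^sup>2) \<le> exp (- (B / (cmod (g k))\<^sup>2)) * exp (B / (cmod (g k))\<^sup>2)"
    by (simp only:) (intro mult_left_mono exp_ge_add_one_self exp_ge_zero)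
  then have "exp (2 * c * a) * (1 + B / (cmod (g k))\<^sup>2) \<le> 1"
    by (simp only: exp_add[symmetric] add.left_inverse exp_zero)
  moreover have "(cmod (g k))\<^sup>2 \<le> exp (2 * c * a) * B"
    using bal[OF a] mult_left_mono[OF yb[of a], of "exp (2 * c * a)"] by simp
  then have "1 \<le> exp (2 * c * a) * (B / (cmod (g k))\<^sup>2)" using gk by (simp add: le_divide_eq)
  ultimately have "exp (2 * c * a) \<le> 0" unfolding distrib_left mult_1_right by linarith
  then show False by (simp add: not_le)
qed

end

section \<open>Fourier coefficients on the cell\<close>


definition ph :: "real \<Rightarrow> idx \<Rightarrow> real^2 \<Rightarrow> real" where
  "ph L k x = 2 * pi / L * (of_int (fst k) * x $ 1 + of_int (snd k) * x $ 2)"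

definition wave :: "real \<Rightarrow> idx \<Rightarrow> real^2 \<Rightarrow> complex" where
  "wave L k x = cis (ph L k x)"

lemma ph_add: "ph L (j + k) x = ph L j x + ph L k x"
  by (simp add: ph_def algebra_simps)

lemma ph_uminus: "ph L (- k) x = - ph L k x"
  by (simp add: ph_def algebra_simps)

lemma ph_0 [simp]: "ph L 0 x = 0"
  by (simp add: ph_def)

lemma wave_0 [simp]: "wave L 0 x = 1"
  by (simp add: wave_def)

lemma wave_add: "wave L (j + k) x = wave L j x * wave L k x"
  by (simp add: wave_def ph_add cis_mult)

lemma wave_uminus: "wave L (- k) x = cnj (wave L k x)"
  by (simp add: wave_def ph_uminus cis_cnj)

lemma norm_wave [simp]: "cmod (wave L k x) = 1"
  by (simp add: wave_def)

lemma continuous_on_ph [continuous_intros]: "continuous_on S (ph L k)"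
  unfolding ph_def[abs_def] by (intro continuous_intros)

lemma continuous_on_wave [continuous_intros]: "continuous_on S (wave L k)"
  unfolding wave_def[abs_def] by (intro continuous_intros)

lemma finite_measure_cell: "finite_measure (cell L)"
  by (rule finite_measure_lebesgue_on) simp

lemma continuous_cell_measurable:
  fixes f :: "real^2 \<Rightarrow> 'b::euclidean_space"
  assumes "continuous_on UNIV f" shows "f \<in> borel_measurable (cell L)"
  by (rule continuous_imp_measurable_on_sets_lebesgue) (use assms in \<open>auto intro: continuous_on_subset\<close>)

lemma cell_integral_prod:
  fixes f :: "2 \<Rightarrow> real \<Rightarrow> complex"
  assumes f: "\<And>i. continuous_on UNIV (f i)"
  shows "(\<integral>x. (\<Prod>i\<in>UNIV. f i (x $ i)) \<partial>cell L) = (\<Prod>i\<in>UNIV. \<integral>t. indicator {0..L} t *\<^sub>R f i t \<partial>lborel)"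
proof -
  define ix :: "real^2 \<Rightarrow> 2" where "ix b = (THE i. b = axis i 1)" for b
  have ix: "ix (axis i 1) = i" for i unfolding ix_def by (auto simp: axis_eq_axis)
  define h where "h b t = indicator {0..L} t *\<^sub>R f (ix b) t" for b t
  have fb [measurable]: "f i \<in> borel_measurable borel" for i using f by (rule borel_measurable_continuous_onI)
  have hb [measurable]: "h b \<in> borel_measurable borel" for b unfolding h_def[abs_def] by measurable
  have Basis: "(Basis :: (real^2) set) = (\<lambda>i. axis i 1) ` UNIV" by (auto simp: Basis_vec_def)
  have inj: "inj_on (\<lambda>i::2. axis i (1::real)) UNIV" by (auto simp: inj_on_def axis_eq_axis)
  have prodB: "(\<Prod>b\<in>Basis. G b) = (\<Prod>i\<in>UNIV. G (axis i 1))" for G :: "real^2 \<Rightarrow> complex"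
    unfolding Basis by (subst prod.reindex[OF inj]) simp
  have hint: "integrable lborel (h b)" for b
  proof -
    have "continuous_on {0..L} (f (ix b))" using f by (rule continuous_on_subset) simp
    then show ?thesis unfolding h_def[abs_def] using borel_integrable_atLeastAtMost'[of 0 L "f (ix b)"] by (simp add: set_integrable_def)
  qed
  have eq: "indicator (cbox 0 (vec L)) x *\<^sub>R (\<Prod>i\<in>UNIV. f i (x $ i)) = (\<Prod>b\<in>Basis. h b (x \<bullet> b))" for x :: "real^2"
    unfolding prodB h_def ix by (auto simp: indicator_def mem_box_cart inner_axis UNIV_2 cart_eq_inner_axis[symmetric] forall_2)
  have "(\<integral>x. (\<Prod>i\<in>UNIV. f i (x $ i)) \<partial>cell L) = (\<integral>x. indicator (cbox 0 (vec L)) x *\<^sub>R (\<Prod>i\<in>UNIV. f i (x $ i)) \<partial>lebesgue)"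
    by (subst integral_restrict_space) auto
  also have "\<dots> = (\<integral>x. (\<Prod>b\<in>Basis. h b (x \<bullet> b)) \<partial>lborel)"
    unfolding eq by (rule integral_completion) measurable
  also have "\<dots> = (\<integral>p. (\<Prod>b\<in>Basis. h b ((\<Sum>b\<in>Basis. p b *\<^sub>R b) \<bullet> b)) \<partial>(\<Pi>\<^sub>M b\<in>(Basis :: (real^2) set). lborel))"
    by (subst lborel_eq) (subst integral_distr; measurable)
  also have "\<dots> = (\<integral>p. (\<Prod>b\<in>Basis. h b (p b)) \<partial>(\<Pi>\<^sub>M b\<in>(Basis :: (real^2) set). lborel))"
    by (intro Bochner_Integration.integral_cong prod.cong refl) (simp add: inner_sum_left_Basis)
  also have "\<dots> = (\<Prod>b\<in>Basis. integral\<^sup>L lborel (h b))"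
  proof -
    interpret product_sigma_finite "\<lambda>_::real^2. lborel :: real measure" ..
    show ?thesis by (rule product_integral_prod) (auto intro: hint)
  qed
  also have "\<dots> = (\<Prod>i\<in>UNIV. \<integral>t. indicator {0..L} t *\<^sub>R f i t \<partial>lborel)"
    unfolding prodB h_def[abs_def] ix ..
  finally show ?thesis .
qed

lemma integral_cis_period:
  assumes L: "L > 0"
  shows "(\<integral>t. indicator {0..L} t *\<^sub>R cis (2 * pi / L * of_int n * t) \<partial>lborel) = (if n = 0 then of_real L else 0)"
proof (cases "n = 0")
  case True
  then show ?thesis using L by (simp add: scaleR_conv_of_real)
next
  case False
  define a where "a = 2 * pi / L * of_int n"
  have a0: "a \<noteq> 0" using False L by (simp add: a_def)
  have "(\<integral>t. indicator {0..L} t *\<^sub>R cis (a * t) \<partial>lborel) = cis (a * L) / (\<i> * a) - cis (a * 0) / (\<i> * a)"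
  proof (rule integral_FTC_Icc)
    fix t assume "0 \<le> t" "t \<le> L"
    have "((\<lambda>z. exp (\<i> * (of_real a * z)) / (\<i> * a)) has_field_derivative exp (\<i> * (of_real a * of_real t))) (at (of_real t))"
      using a0 by (auto intro!: derivative_eq_intros simp: complex_eq_iff)
    from has_vector_derivative_real_field[OF this, of UNIV]
    have "((\<lambda>t. exp (\<i> * of_real (a * t)) / (\<i> * a)) has_vector_derivative exp (\<i> * of_real (a * t))) (at t)"
      by simp
    then show "((\<lambda>t. cis (a * t) / (\<i> * a)) has_vector_derivative cis (a * t)) (at t within {0..L})"
      unfolding cis_conv_exp by (rule has_vector_derivative_at_within)
  qed (use L in \<open>auto intro!: continuous_intros\<close>)
  also have "a * L = 2 * pi * of_int n" using L by (simp add: a_def)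
  also have "cis (2 * pi * of_int n) = 1" by (simp add: cis_multiple_2pi)
  finally show ?thesis using False by (simp add: a_def)
qed

lemma integral_wave:
  assumes L: "L > 0"
  shows "(\<integral>x. wave L k x \<partial>cell L) = (if k = 0 then of_real (L\<^sup>2) else 0)"
proof -
  define n where "n = (\<lambda>i::2. if i = 1 then fst k else snd k)"
  have ne: "(2::2) \<noteq> 1" by simp
  have "wave L k x = (\<Prod>i\<in>UNIV. cis (2 * pi / L * of_int (n i) * (x $ i)))" for x
    by (simp add: wave_def ph_def UNIV_2 n_def cis_mult algebra_simps)
  then have "(\<integral>x. wave L k x \<partial>cell L) = (\<integral>x. (\<Prod>i\<in>UNIV. cis (2 * pi / L * of_int (n i) * (x $ i))) \<partial>cell L)"
    by simp
  also have "\<dots> = (\<Prod>i\<in>UNIV. \<integral>t. indicator {0..L} t *\<^sub>R cis (2 * pi / L * of_int (n i) * t) \<partial>lborel)"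
    by (rule cell_integral_prod) (intro continuous_intros)
  also have "\<dots> = (if k = 0 then of_real (L\<^sup>2) else 0)"
    unfolding integral_cis_period[OF L] by (cases k) (auto simp: UNIV_2 n_def zero_prod_def power2_eq_square)
  finally show ?thesis .
qed

definition sq_integrable :: "real \<Rightarrow> (real^2 \<Rightarrow> complex) \<Rightarrow> bool" where
  "sq_integrable L f \<longleftrightarrow> f \<in> borel_measurable (cell L) \<and> integrable (cell L) (\<lambda>x. (cmod (f x))\<^sup>2)"

definition mass :: "real \<Rightarrow> (real^2 \<Rightarrow> complex) \<Rightarrow> real" where
  "mass L f = (\<integral>x. (cmod (f x))\<^sup>2 \<partial>cell L)"

definition fc :: "real \<Rightarrow> (real^2 \<Rightarrow> complex) \<Rightarrow> idx \<Rightarrow> complex" where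
  "fc L f k = (\<integral>x. f x * cnj (wave L k x) \<partial>cell L) / of_real (L\<^sup>2)"

lemma sq_integrable_measurable: "sq_integrable L f \<Longrightarrow> f \<in> borel_measurable (cell L)"
  by (simp add: sq_integrable_def)

lemma mass_nonneg: "0 \<le> mass L f"
  by (simp add: mass_def)

lemma sq_integrable_mult:
  assumes "sq_integrable L f" "sq_integrable L h"
  shows "integrable (cell L) (\<lambda>x. f x * h x)"
    and "0 < t \<Longrightarrow> cmod (\<integral>x. f x * h x \<partial>cell L) \<le> t * mass L f + mass L h / t"
proof -
  have [measurable]: "f \<in> borel_measurable (cell L)" "h \<in> borel_measurable (cell L)"
    using assms by (auto simp: sq_integrable_def)
  have i: "integrable (cell L) (\<lambda>x. (cmod (f x))\<^sup>2)" "integrable (cell L) (\<lambda>x. (cmod (h x))\<^sup>2)"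
    using assms by (auto simp: sq_integrable_def)
  have bound: "cmod (f x * h x) \<le> t * (cmod (f x))\<^sup>2 + (cmod (h x))\<^sup>2 / t" if "0 < t" for t x
  proof -
    have "2 * (sqrt t * cmod (f x)) * (cmod (h x) / sqrt t) \<le> (sqrt t * cmod (f x))\<^sup>2 + (cmod (h x) / sqrt t)\<^sup>2"
      by (rule sum_squares_bound)
    then have "2 * cmod (f x) * cmod (h x) \<le> t * (cmod (f x))\<^sup>2 + (cmod (h x))\<^sup>2 / t"
      using that by (simp add: power_mult_distrib power_divide)
    moreover have "0 \<le> cmod (f x) * cmod (h x)" by simp
    ultimately show ?thesis unfolding norm_mult by linarith
  qed
  have ib: "integrable (cell L) (\<lambda>x. t * (cmod (f x))\<^sup>2 + (cmod (h x))\<^sup>2 / t)" for t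
    using i by (intro Bochner_Integration.integrable_add integrable_mult_right integrable_divide) auto
  show *: "integrable (cell L) (\<lambda>x. f x * h x)"
  proof (rule Bochner_Integration.integrable_bound[OF ib[of 1]])
    show "AE x in cell L. norm (f x * h x) \<le> norm (1 * (cmod (f x))\<^sup>2 + (cmod (h x))\<^sup>2 / 1)"
      using bound[of 1] by (intro AE_I2) (simp add: norm_mult)
  qed measurable
  show "cmod (\<integral>x. f x * h x \<partial>cell L) \<le> t * mass L f + mass L h / t" if "0 < t"
  proof -
    have "cmod (\<integral>x. f x * h x \<partial>cell L) \<le> (\<integral>x. cmod (f x * h x) \<partial>cell L)" by (rule integral_norm_bound)
    also have "\<dots> \<le> (\<integral>x. t * (cmod (f x))\<^sup>2 + (cmod (h x))\<^sup>2 / t \<partial>cell L)"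
      by (intro integral_mono ib integrable_norm * bound that)
    also have "\<dots> = t * mass L f + mass L h / t"
      unfolding mass_def using i by (subst Bochner_Integration.integral_add) auto
    finally show ?thesis .
  qed
qed

lemma sq_integrable_continuous:
  assumes "continuous_on UNIV f" shows "sq_integrable L f"
  unfolding sq_integrable_def
proof
  show "f \<in> borel_measurable (cell L)" by (rule continuous_cell_measurable[OF assms])
  have "continuous_on (cbox 0 (vec L)) (\<lambda>x. (cmod (f x))\<^sup>2)"
    by (intro continuous_intros continuous_on_subset[OF assms]) simp
  then show "integrable (cell L) (\<lambda>x. (cmod (f x))\<^sup>2)"
    by (intro absolutely_integrable_imp_integrable absolutely_integrable_continuous) auto
qed

lemma sq_integrable_wave: "sq_integrable L (wave L k)"
  by (intro sq_integrable_continuous continuous_intros)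

lemma sq_integrable_cmult: "sq_integrable L f \<Longrightarrow> sq_integrable L (\<lambda>x. c * f x)"
  by (auto simp: sq_integrable_def norm_mult power_mult_distrib)

lemma sq_integrable_wave_mult: "sq_integrable L f \<Longrightarrow> sq_integrable L (\<lambda>x. f x * wave L k x)"
  using continuous_cell_measurable[OF continuous_on_wave[of UNIV L k], of L]
  by (auto simp: sq_integrable_def norm_mult)

lemma sq_integrable_cnj: "sq_integrable L f \<Longrightarrow> sq_integrable L (\<lambda>x. cnj (f x))"
  using measurable_compose[of f "cell L" borel cnj borel] borel_measurable_continuous_onI[of cnj]
  by (auto simp: sq_integrable_def intro: continuous_intros)

lemma sq_integrable_add:
  assumes "sq_integrable L f" "sq_integrable L h" shows "sq_integrable L (\<lambda>x. f x + h x)"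
proof -
  have [measurable]: "f \<in> borel_measurable (cell L)" "h \<in> borel_measurable (cell L)"
    using assms by (auto simp: sq_integrable_def)
  have "integrable (cell L) (\<lambda>x. (cmod (f x + h x))\<^sup>2)"
  proof (rule Bochner_Integration.integrable_bound)
    show "integrable (cell L) (\<lambda>x. 2 * (cmod (f x))\<^sup>2 + 2 * (cmod (h x))\<^sup>2)"
      using assms by (auto simp: sq_integrable_def)
    show "AE x in cell L. norm ((cmod (f x + h x))\<^sup>2) \<le> norm (2 * (cmod (f x))\<^sup>2 + 2 * (cmod (h x))\<^sup>2)"
    proof (intro AE_I2)
      fix x
      have "(cmod (f x + h x))\<^sup>2 \<le> (cmod (f x) + cmod (h x))\<^sup>2"
        by (intro power_mono norm_triangle_ineq) auto
      also have "\<dots> \<le> 2 * (cmod (f x))\<^sup>2 + 2 * (cmod (h x))\<^sup>2"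
        using sum_squares_bound[of "cmod (f x)" "cmod (h x)"] by (simp add: power2_sum)
      finally show "norm ((cmod (f x + h x))\<^sup>2) \<le> norm (2 * (cmod (f x))\<^sup>2 + 2 * (cmod (h x))\<^sup>2)" by simp
    qed
  qed measurable
  then show ?thesis by (simp add: sq_integrable_def)
qed

lemma sq_integrable_diff:
  assumes "sq_integrable L f" "sq_integrable L h" shows "sq_integrable L (\<lambda>x. f x - h x)"
  using sq_integrable_add[OF assms(1) sq_integrable_cmult[OF assms(2), of "-1"]] by simp

lemma sq_integrable_sum:
  assumes "\<And>k. k \<in> F \<Longrightarrow> sq_integrable L (f k)" shows "sq_integrable L (\<lambda>x. \<Sum>k\<in>F. f k x)"
  using assms
proof (induction F rule: infinite_finite_induct)
  case (insert k F)
  then show ?case by (simp add: sq_integrable_add)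
qed (auto simp: sq_integrable_def)

lemma fc_integrable: "sq_integrable L f \<Longrightarrow> integrable (cell L) (\<lambda>x. f x * cnj (wave L k x))"
  by (intro sq_integrable_mult sq_integrable_cnj sq_integrable_wave)

lemma sq_integrable_imp_integrable: "sq_integrable L f \<Longrightarrow> integrable (cell L) f"
  using fc_integrable[of L f 0] by simp

lemma fc_add: "sq_integrable L f \<Longrightarrow> sq_integrable L h \<Longrightarrow> fc L (\<lambda>x. f x + h x) k = fc L f k + fc L h k"
  by (simp add: fc_def distrib_right fc_integrable add_divide_distrib)

lemma fc_diff: "sq_integrable L f \<Longrightarrow> sq_integrable L h \<Longrightarrow> fc L (\<lambda>x. f x - h x) k = fc L f k - fc L h k"
  by (simp add: fc_def left_diff_distrib fc_integrable diff_divide_distrib)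

lemma fc_cmult: "fc L (\<lambda>x. c * f x) k = c * fc L f k"
  by (simp add: fc_def mult.assoc)

lemma fc_sum:
  assumes "\<And>k. k \<in> F \<Longrightarrow> sq_integrable L (f k)"
  shows "fc L (\<lambda>x. \<Sum>k\<in>F. f k x) m = (\<Sum>k\<in>F. fc L (f k) m)"
  using assms
proof (induction F rule: infinite_finite_induct)
  case (insert k F)
  then show ?case by (simp add: fc_add sq_integrable_sum)
qed (auto simp: fc_def)

lemma fc_wave:
  assumes "L > 0" shows "fc L (wave L m) k = (if m = k then 1 else 0)"
proof -
  have "wave L m x * cnj (wave L k x) = wave L (m - k) x" for x
    using wave_add[of L m "- k" x] by (simp add: wave_uminus)
  then show ?thesis using assms by (simp add: fc_def integral_wave)
qed

lemma mass_diff_wave: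
  assumes L: "L > 0" and f: "sq_integrable L f"
  shows "mass L (\<lambda>x. f x - d * wave L k x) = mass L f - L\<^sup>2 * (cmod (fc L f k))\<^sup>2 + L\<^sup>2 * (cmod (fc L f k - d))\<^sup>2"
proof -
  have i2: "integrable (cell L) (\<lambda>x. (cmod (f x))\<^sup>2)" using f by (simp add: sq_integrable_def)
  have eq: "(cmod (f x - d * wave L k x))\<^sup>2 = (cmod (f x))\<^sup>2 - 2 * Re (cnj d * (f x * cnj (wave L k x))) + (cmod d)\<^sup>2" for x
  proof -
    have "(cmod (f x - d * wave L k x))\<^sup>2 = (cmod (f x))\<^sup>2 - 2 * Re (f x * cnj (d * wave L k x)) + (cmod (d * wave L k x))\<^sup>2"
      unfolding cmod_power2 by (simp add: power2_eq_square algebra_simps)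
    then show ?thesis by (simp add: norm_mult mult_ac)
  qed
  have im: "integrable (cell L) (\<lambda>x. cnj d * (f x * cnj (wave L k x)))"
    by (intro integrable_mult_right fc_integrable f)
  have "mass L (\<lambda>x. f x - d * wave L k x) = (\<integral>x. (cmod (f x))\<^sup>2 - 2 * Re (cnj d * (f x * cnj (wave L k x))) + (cmod d)\<^sup>2 \<partial>cell L)"
    unfolding mass_def eq ..
  also have "\<dots> = mass L f - 2 * Re (cnj d * (of_real (L\<^sup>2) * fc L f k)) + measure (cell L) (space (cell L)) * (cmod d)\<^sup>2"
  proof -
    interpret finite_measure "cell L" by (rule finite_measure_cell)
    have "integrable (cell L) (\<lambda>x. 2 * Re (cnj d * (f x * cnj (wave L k x))))"
      using integrable_Re[OF im] by (rule integrable_mult_right)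
    moreover have "(\<integral>x. 2 * Re (cnj d * (f x * cnj (wave L k x))) \<partial>cell L) = 2 * Re (cnj d * (of_real (L\<^sup>2) * fc L f k))"
      using L im by (simp only: integral_mult_right_zero integral_Re[OF im] fc_def) simp
    ultimately show ?thesis
      unfolding mass_def using i2 by (simp only: Bochner_Integration.integral_add Bochner_Integration.integral_diff
        Bochner_Integration.integrable_diff integrable_const lebesgue_integral_const) simp
  qed
  also have "measure (cell L) (space (cell L)) = L\<^sup>2"
  proof -
    have "of_real (measure (cell L) (space (cell L))) = (of_real (L\<^sup>2) :: complex)"
      using integral_wave[OF L, of 0] by (simp add: scaleR_conv_of_real)
    then show ?thesis by (simp only: of_real_eq_iff)
  qed
  also have "mass L f - 2 * Re (cnj d * (of_real (L\<^sup>2) * fc L f k)) + L\<^sup>2 * (cmod d)\<^sup>2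
      = mass L f - L\<^sup>2 * (cmod (fc L f k))\<^sup>2 + L\<^sup>2 * (cmod (fc L f k - d))\<^sup>2"
    unfolding cmod_power2 by (simp add: power2_eq_square algebra_simps)
  finally show ?thesis .
qed

lemma mass_diff_poly:
  assumes L: "L > 0" and f: "sq_integrable L f" and "finite F"
  shows "mass L (\<lambda>x. f x - (\<Sum>k\<in>F. d k * wave L k x))
    = mass L f - L\<^sup>2 * (\<Sum>k\<in>F. (cmod (fc L f k))\<^sup>2) + L\<^sup>2 * (\<Sum>k\<in>F. (cmod (fc L f k - d k))\<^sup>2)"
  using \<open>finite F\<close>
proof (induction F rule: finite_induct)
  case (insert k F)
  have s: "sq_integrable L (\<lambda>x. \<Sum>k\<in>F. d k * wave L k x)"
    by (intro sq_integrable_sum sq_integrable_cmult sq_integrable_wave)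
  let ?g = "\<lambda>x. f x - (\<Sum>k\<in>F. d k * wave L k x)"
  have g: "sq_integrable L ?g" by (rule sq_integrable_diff[OF f s])
  have "fc L ?g k = fc L f k - (\<Sum>m\<in>F. d m * fc L (wave L m) k)"
    by (subst fc_diff[OF f s], subst fc_sum) (auto simp: fc_cmult intro: sq_integrable_cmult sq_integrable_wave)
  also have "(\<Sum>m\<in>F. d m * fc L (wave L m) k) = 0"
    using insert.hyps L by (intro sum.neutral) (auto simp: fc_wave)
  finally have gk: "fc L ?g k = fc L f k" by simp
  have "(\<lambda>x. f x - (\<Sum>k\<in>insert k F. d k * wave L k x)) = (\<lambda>x. ?g x - d k * wave L k x)"
    using insert.hyps by (simp add: algebra_simps)
  then show ?case using mass_diff_wave[OF L g, of "d k" k] insert by (simp add: gk algebra_simps)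
qed simp

lemma Bessel:
  assumes L: "L > 0" and f: "sq_integrable L f" and F: "finite F"
  shows "(\<Sum>k\<in>F. (cmod (fc L f k))\<^sup>2) \<le> mass L f / L\<^sup>2"
proof -
  have "0 \<le> mass L f - L\<^sup>2 * (\<Sum>k\<in>F. (cmod (fc L f k))\<^sup>2)"
    using mass_diff_poly[OF assms, of "fc L f"] mass_nonneg[of L "\<lambda>x. f x - (\<Sum>k\<in>F. fc L f k * wave L k x)"] by simp
  then show ?thesis using L by (simp add: le_divide_eq mult.commute)
qed

lemma Bessel_summable:
  assumes L: "L > 0" and f: "sq_integrable L f"
  shows "(\<lambda>k. (cmod (fc L f k))\<^sup>2) summable_on UNIV" "(\<Sum>\<^sub>\<infinity>k. (cmod (fc L f k))\<^sup>2) \<le> mass L f / L\<^sup>2"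
proof -
  show *: "(\<lambda>k. (cmod (fc L f k))\<^sup>2) summable_on UNIV"
    using Bessel[OF assms] by (intro nonneg_bdd_above_summable_on) (auto intro!: bdd_aboveI)
  show "(\<Sum>\<^sub>\<infinity>k. (cmod (fc L f k))\<^sup>2) \<le> mass L f / L\<^sup>2"
    using Bessel[OF assms] by (intro infsum_le_finite_sums *) auto
qed

definition poly_limit :: "real \<Rightarrow> (real^2 \<Rightarrow> complex) \<Rightarrow> bool" where
  "poly_limit L f \<longleftrightarrow> sq_integrable L f \<and>
     (\<forall>e>0. \<exists>F d. finite F \<and> mass L (\<lambda>x. f x - (\<Sum>k\<in>F. d k * wave L k x)) < e)"

lemma poly_limit_partial_sums:
  assumes L: "L > 0" and f: "poly_limit L f" and e: "e > 0"
  obtains F where "finite F" "\<And>G. finite G \<Longrightarrow> F \<subseteq> G \<Longrightarrow> mass L (\<lambda>x. f x - (\<Sum>k\<in>G. fc L f k * wave L k x)) < e"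
proof -
  have sf: "sq_integrable L f" using f by (simp add: poly_limit_def)
  obtain F d where F: "finite F" "mass L (\<lambda>x. f x - (\<Sum>k\<in>F. d k * wave L k x)) < e"
    using f e unfolding poly_limit_def by blast
  show ?thesis
  proof (rule that[OF F(1)])
    fix G :: "idx set" assume G: "finite G" "F \<subseteq> G"
    have "mass L (\<lambda>x. f x - (\<Sum>k\<in>G. fc L f k * wave L k x)) = mass L f - L\<^sup>2 * (\<Sum>k\<in>G. (cmod (fc L f k))\<^sup>2)"
      using mass_diff_poly[OF L sf G(1), of "fc L f"] by simp
    also have "\<dots> \<le> mass L f - L\<^sup>2 * (\<Sum>k\<in>F. (cmod (fc L f k))\<^sup>2)"
      using G by (intro diff_left_mono mult_left_mono sum_mono2) auto
    also have "\<dots> \<le> mass L (\<lambda>x. f x - (\<Sum>k\<in>F. d k * wave L k x))"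
      using mass_diff_poly[OF L sf F(1), of d] by (simp add: sum_nonneg)
    finally show "mass L (\<lambda>x. f x - (\<Sum>k\<in>G. fc L f k * wave L k x)) < e" using F(2) by linarith
  qed
qed

lemma fc_product:
  assumes L: "L > 0" and f: "poly_limit L f" and h: "sq_integrable L h"
  shows "((\<lambda>j. fc L f j * fc L h (k - j)) has_sum fc L (\<lambda>x. f x * h x) k) UNIV"
  unfolding has_sum_def
proof (rule tendstoI)
  fix r :: real assume r: "0 < r"
  have sf: "sq_integrable L f" using f by (simp add: poly_limit_def)
  define H where "H x = h x * cnj (wave L k x)" for x
  have Hs: "sq_integrable L H"
    using sq_integrable_wave_mult[OF h, of "- k"] by (simp add: H_def[abs_def] wave_uminus)
  define B where "B = mass L H"
  have B0: "0 \<le> B" by (simp add: B_def mass_nonneg)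
  define t where "t = 2 * (B + 1) / (r * L\<^sup>2)"
  have t: "0 < t" using B0 r L by (simp add: t_def)
  define e where "e = r * L\<^sup>2 / (2 * t)"
  have e: "0 < e" using r L t by (simp add: e_def)
  obtain F where F: "finite F" "\<And>G. finite G \<Longrightarrow> F \<subseteq> G \<Longrightarrow> mass L (\<lambda>x. f x - (\<Sum>k\<in>G. fc L f k * wave L k x)) < e"
    by (rule poly_limit_partial_sums[OF L f e]) (rule that)
  show "eventually (\<lambda>G. dist (\<Sum>j\<in>G. fc L f j * fc L h (k - j)) (fc L (\<lambda>x. f x * h x) k) < r) (finite_subsets_at_top UNIV)"
    unfolding eventually_finite_subsets_at_top
  proof (intro exI[of _ F] conjI allI impI F(1))
    fix G :: "idx set" assume G: "finite G \<and> F \<subseteq> G \<and> G \<subseteq> UNIV"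
    define p where "p x = (\<Sum>j\<in>G. fc L f j * wave L j x)" for x
    have sp: "sq_integrable L p" unfolding p_def[abs_def]
      by (intro sq_integrable_sum sq_integrable_cmult sq_integrable_wave)
    have "(\<integral>x. (f x - p x) * H x \<partial>cell L) = (\<integral>x. f x * H x \<partial>cell L) - (\<integral>x. p x * H x \<partial>cell L)"
      unfolding left_diff_distrib
      by (intro Bochner_Integration.integral_diff sq_integrable_mult(1) sf sp Hs)
    also have "(\<integral>x. p x * H x \<partial>cell L) = (\<Sum>j\<in>G. fc L f j * (\<integral>x. wave L j x * H x \<partial>cell L))"
      unfolding p_def sum_distrib_right mult.assoc
      by (subst Bochner_Integration.integral_sum) (auto intro!: integrable_mult_right sq_integrable_mult(1) sq_integrable_wave Hs)
    also have "\<dots> = (\<Sum>j\<in>G. fc L f j * (of_real (L\<^sup>2) * fc L h (k - j)))"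
    proof (intro sum.cong refl)
      fix j
      have "wave L j x * H x = h x * cnj (wave L (k - j) x)" for x
        using wave_add[of L "- k" j x] wave_uminus[of L "k - j" x] by (simp add: H_def wave_uminus mult_ac)
      then show "fc L f j * (\<integral>x. wave L j x * H x \<partial>cell L) = fc L f j * (of_real (L\<^sup>2) * fc L h (k - j))"
        using L by (simp add: fc_def)
    qed
    also have "(\<integral>x. f x * H x \<partial>cell L) = of_real (L\<^sup>2) * fc L (\<lambda>x. f x * h x) k"
      using L by (simp add: fc_def H_def mult.assoc)
    finally have eq: "(\<integral>x. (f x - p x) * H x \<partial>cell L) =
        of_real (L\<^sup>2) * (fc L (\<lambda>x. f x * h x) k - (\<Sum>j\<in>G. fc L f j * fc L h (k - j)))"
      by (simp add: right_diff_distrib sum_distrib_left mult_ac)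
    have "L\<^sup>2 * cmod (fc L (\<lambda>x. f x * h x) k - (\<Sum>j\<in>G. fc L f j * fc L h (k - j))) = cmod (\<integral>x. (f x - p x) * H x \<partial>cell L)"
      unfolding eq by (simp add: norm_mult norm_power)
    also have "\<dots> \<le> t * mass L (\<lambda>x. f x - p x) + B / t"
      unfolding B_def by (rule sq_integrable_mult(2)[OF sq_integrable_diff[OF sf sp] Hs t])
    also have "\<dots> < t * e + (B + 1) / t"
      using F(2)[of G] G t by (intro add_strict_mono divide_strict_right_mono) (auto simp: p_def)
    also have "\<dots> = L\<^sup>2 * r"
    proof -
      have "t * e = r * L\<^sup>2 / 2" using t by (simp add: e_def)
      moreover have "(B + 1) / t = r * L\<^sup>2 / 2"
      proof -
        have "(B + 1) / (2 * (B + 1) / q) = q / 2" for q using B0 by (simp add: divide_simps)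
        then show ?thesis by (simp only: t_def)
      qed
      ultimately show ?thesis by (simp only: mult.commute)
    qed
    finally have "cmod (fc L (\<lambda>x. f x * h x) k - (\<Sum>j\<in>G. fc L f j * fc L h (k - j))) < r"
      using L by simp
    then show "dist (\<Sum>j\<in>G. fc L f j * fc L h (k - j)) (fc L (\<lambda>x. f x * h x) k) < r"
      by (simp add: dist_norm norm_minus_commute)
  qed auto
qed

section \<open>Completeness of the trigonometric system\<close>


lemma box_integrals_zero_imp_AE_zero:
  fixes w :: "'a::euclidean_space \<Rightarrow> real"
  assumes w: "integrable lborel w"
    and zero: "\<And>a b. (\<integral>x. indicator (box a b) x * w x \<partial>lborel) = 0"
  shows "AE x in lborel. w x = 0"
proof -
  have [measurable]: "w \<in> borel_measurable borel" using w by simp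
  define f where "f x = ennreal (max 0 (w x))" for x
  define h where "h x = ennreal (max 0 (- w x))" for x
  have [measurable]: "f \<in> borel_measurable borel" "h \<in> borel_measurable borel" unfolding f_def[abs_def] h_def[abs_def] by measurable
  have ip: "integrable lborel (\<lambda>x. max 0 (w x))" "integrable lborel (\<lambda>x. max 0 (- w x))"
    using w by (auto intro!: Bochner_Integration.integrable_max)
  have fe: "(\<integral>\<^sup>+x. f x * indicator A x \<partial>lborel) = ennreal (\<integral>x. indicator A x * max 0 (w x) \<partial>lborel)"
    and he: "(\<integral>\<^sup>+x. h x * indicator A x \<partial>lborel) = ennreal (\<integral>x. indicator A x * max 0 (- w x) \<partial>lborel)"
    if [measurable]: "A \<in> sets borel" for A
  proof -
    have i: "integrable lborel (\<lambda>x. indicator A x * max 0 (w x))" "integrable lborel (\<lambda>x. indicator A x * max 0 (- w x))"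
      using integrable_mult_indicator[OF _ ip(1), of A] integrable_mult_indicator[OF _ ip(2), of A] by (simp_all add: that)
    have "(\<integral>\<^sup>+x. f x * indicator A x \<partial>lborel) = (\<integral>\<^sup>+x. ennreal (indicator A x * max 0 (w x)) \<partial>lborel)"
      unfolding f_def by (intro nn_integral_cong) (auto simp: indicator_def)
    also have "\<dots> = ennreal (\<integral>x. indicator A x * max 0 (w x) \<partial>lborel)"
      by (rule nn_integral_eq_integral[OF i(1)]) (auto simp: indicator_def)
    finally show "(\<integral>\<^sup>+x. f x * indicator A x \<partial>lborel) = ennreal (\<integral>x. indicator A x * max 0 (w x) \<partial>lborel)" .
    have "(\<integral>\<^sup>+x. h x * indicator A x \<partial>lborel) = (\<integral>\<^sup>+x. ennreal (indicator A x * max 0 (- w x)) \<partial>lborel)"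
      unfolding h_def by (intro nn_integral_cong) (auto simp: indicator_def)
    also have "\<dots> = ennreal (\<integral>x. indicator A x * max 0 (- w x) \<partial>lborel)"
      by (rule nn_integral_eq_integral[OF i(2)]) (auto simp: indicator_def)
    finally show "(\<integral>\<^sup>+x. h x * indicator A x \<partial>lborel) = ennreal (\<integral>x. indicator A x * max 0 (- w x) \<partial>lborel)" .
  qed
  have sub: "(\<integral>x. indicator (box a b) x * max 0 (w x) \<partial>lborel) = (\<integral>x. indicator (box a b) x * max 0 (- w x) \<partial>lborel)" for a b :: 'a
  proof -
    have i: "integrable lborel (\<lambda>x. indicator (box a b) x * max 0 (w x))" "integrable lborel (\<lambda>x. indicator (box a b) x * max 0 (- w x))"
      using integrable_mult_indicator[OF _ ip(1), of "box a b"] integrable_mult_indicator[OF _ ip(2), of "box a b"] by simp_all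
    have "(\<integral>x. indicator (box a b) x * max 0 (w x) \<partial>lborel) - (\<integral>x. indicator (box a b) x * max 0 (- w x) \<partial>lborel)
      = (\<integral>x. indicator (box a b) x * max 0 (w x) - indicator (box a b) x * max 0 (- w x) \<partial>lborel)"
      using i by simp
    also have "\<dots> = (\<integral>x. indicator (box a b) x * w x \<partial>lborel)"
      by (intro Bochner_Integration.integral_cong refl) (auto simp: indicator_def max_def)
    finally show ?thesis using zero[of a b] by simp
  qed
  have "density lborel f = density lborel h"
  proof (rule measure_eqI_generator_eq[where E = "range (\<lambda>(a,b). box a b)" and \<Omega> = UNIV and A = "\<lambda>n. box (- (real n *\<^sub>R One)) (real n *\<^sub>R One)"])
    show "Int_stable (range (\<lambda>(a, b). box a b :: 'a set))"
      by (auto simp: Int_stable_def box_Int_box)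
    show "emeasure (density lborel f) X = emeasure (density lborel h) X" if "X \<in> range (\<lambda>(a, b). box a b)" for X
      using that sub by (auto simp: emeasure_density fe he)
    show "sets (density lborel f) = sigma_sets UNIV (range (\<lambda>(a, b). box a b))" "sets (density lborel h) = sigma_sets UNIV (range (\<lambda>(a, b). box a b))"
      by (simp_all add: borel_eq_box)
    show "(\<Union>i. box (- (real i *\<^sub>R One)) (real i *\<^sub>R One)) = (UNIV :: 'a set)" by (rule UN_box_eq_UNIV)
    show "emeasure (density lborel f) (box (- (real i *\<^sub>R One)) (real i *\<^sub>R One)) \<noteq> \<infinity>" for i
      by (simp add: emeasure_density fe)
  qed auto
  then have "AE x in lborel. f x = h x"
    by (subst (asm) sigma_finite_measure.density_unique_iff[OF sigma_finite_lborel]) auto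
  then show ?thesis by eventually_elim (auto simp: f_def h_def max_def split: if_splits)
qed

text \<open>The sets \<open>{x. cos (ph L k x - \<gamma>) > r}\<close> for \<open>k = (1,0)\<close> and \<open>k = (0,1)\<close> cut out all boxes in the cell, and their
  indicators are bounded limits of polynomials in a cosine.  This proves completeness of the trigonometric system
  from the one-dimensional Weierstrass theorem.\<close>
definition arc_bump :: "real \<Rightarrow> nat \<Rightarrow> real \<Rightarrow> real" where
  "arc_bump r n t = min 1 (max 0 (real n * (t - r)))"

lemma arc_bump: "0 \<le> arc_bump r n t" "arc_bump r n t \<le> 1" "continuous_on S (arc_bump r n)"
  unfolding arc_bump_def[abs_def] by (auto intro!: continuous_intros)

lemma arc_bump_lim: "(\<lambda>n. arc_bump r n t) \<longlonglongrightarrow> (if r < t then 1 else 0)"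
proof (cases "r < t")
  case True
  obtain N where N: "1 < real N * (t - r)" using True by (metis diff_gt_0_iff_gt ex_less_of_nat_mult)
  have "arc_bump r n t = 1" if "N \<le> n" for n
  proof -
    have "real N * (t - r) \<le> real n * (t - r)" using that True by (intro mult_right_mono) auto
    then show ?thesis using N by (simp add: arc_bump_def)
  qed
  then have "eventually (\<lambda>n. arc_bump r n t = 1) sequentially" by (auto simp: eventually_sequentially)
  then show ?thesis using True by (simp add: tendsto_eventually)
next
  case False
  have "arc_bump r n t = 0" for n
  proof -
    have "real n * (t - r) \<le> 0" using False by (simp add: mult_nonneg_nonpos)
    then show ?thesis by (simp add: arc_bump_def)
  qed
  then show ?thesis using False by simp
qed

inductive_set trig_span :: "real \<Rightarrow> (real^2 \<Rightarrow> complex) set" for L where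
  wave: "(\<lambda>x. c * wave L k x) \<in> trig_span L"
| add: "f \<in> trig_span L \<Longrightarrow> h \<in> trig_span L \<Longrightarrow> (\<lambda>x. f x + h x) \<in> trig_span L"

lemma trig_span_mult_wave: "f \<in> trig_span L \<Longrightarrow> (\<lambda>x. f x * (c * wave L k x)) \<in> trig_span L"
proof (induction rule: trig_span.induct)
  case (wave d m)
  have "(\<lambda>x. d * wave L m x * (c * wave L k x)) = (\<lambda>x. (d * c) * wave L (m + k) x)"
    by (simp add: wave_add mult_ac)
  then show ?case by (simp add: trig_span.wave)
next
  case (add f h)
  then show ?case by (simp add: distrib_right trig_span.add)
qed

lemma trig_span_mult: "h \<in> trig_span L \<Longrightarrow> f \<in> trig_span L \<Longrightarrow> (\<lambda>x. f x * h x) \<in> trig_span L"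
proof (induction rule: trig_span.induct)
  case (wave d m)
  then show ?case by (rule trig_span_mult_wave)
next
  case (add f h)
  then show ?case by (simp add: distrib_left trig_span.add)
qed

lemma trig_span_const: "(\<lambda>x. c) \<in> trig_span L"
  using trig_span.wave[of c L 0] by simp

lemma trig_span_cos: "(\<lambda>x. of_real (cos (ph L k x - \<gamma>))) \<in> trig_span L"
proof -
  have "complex_of_real (cos (ph L k x - \<gamma>)) = cis (- \<gamma>) / 2 * wave L k x + cis \<gamma> / 2 * wave L (- k) x" for x
    by (simp add: complex_eq_iff wave_def ph_uminus cos_diff) (simp add: field_simps)
  then show ?thesis by (simp only:) (intro trig_span.add trig_span.wave)
qed

lemma trig_span_poly:
  assumes "real_polynomial_function p" "(\<lambda>x. of_real (q x)) \<in> trig_span L"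
  shows "(\<lambda>x. of_real (p (q x :: real))) \<in> trig_span L"
  using assms(1)
proof (induction p rule: real_polynomial_function.induct)
  case (linear f)
  have "f t = f 1 * t" for t using linear_cmul[OF bounded_linear.linear[OF linear], of t 1] by simp
  then have "(\<lambda>x. complex_of_real (f (q x))) = (\<lambda>x. of_real (q x) * of_real (f 1))" by (metis mult.commute of_real_mult)
  then show ?case using trig_span_mult[OF trig_span_const assms(2)] by simp
next
  case (const c)
  then show ?case by (rule trig_span_const)
next
  case (add f g)
  then show ?case by (simp add: trig_span.add)
next
  case (mult f g)
  then show ?case by (simp add: trig_span_mult)
qed

lemma trig_span_orthogonal:
  assumes w: "sq_integrable L w" and orth: "\<And>k. fc L w k = 0" and L: "L > 0"
  shows "f \<in> trig_span L \<Longrightarrow> integrable (cell L) (\<lambda>x. w x * f x) \<and> (\<integral>x. w x * f x \<partial>cell L) = 0"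
proof (induction rule: trig_span.induct)
  case (wave c k)
  have i: "integrable (cell L) (\<lambda>x. w x * cnj (wave L (- k) x))" by (rule fc_integrable[OF w])
  have z: "(\<integral>x. w x * cnj (wave L (- k) x) \<partial>cell L) = 0" using orth[of "- k"] L by (simp add: fc_def)
  have eq: "(\<lambda>x. w x * (c * wave L k x)) = (\<lambda>x. c * (w x * cnj (wave L (- k) x)))"
    by (simp add: fun_eq_iff wave_uminus)
  show ?case unfolding eq integral_mult_right_zero z by (simp only: integrable_mult_right[OF i] mult_zero_right)
next
  case (add f h)
  then show ?case by (simp add: distrib_left)
qed

lemma cos_gt_iff_in_interval:
  assumes L: "L > 0" and pq: "0 \<le> p" "p \<le> q" "q \<le> L" and t: "0 \<le> t" "t \<le> L"
  shows "cos (2 * pi / L * t - 2 * pi / L * ((p + q) / 2)) > cos (2 * pi / L * ((q - p) / 2)) \<longleftrightarrow> p < t \<and> t < q"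
proof -
  define u where "u = \<bar>t - (p + q) / 2\<bar>"
  define d where "d = (q - p) / 2"
  define a where "a = 2 * pi / L"
  have a: "0 < a" "a * L = 2 * pi" using L by (simp_all add: a_def)
  have d: "0 \<le> d" "2 * d \<le> L" using pq by (auto simp: d_def)
  have u: "0 \<le> u" "u \<le> L - d" using pq t by (auto simp: u_def d_def abs_if field_simps)
  have cu: "cos (a * t - a * ((p + q) / 2)) = cos (a * u)"
  proof -
    have "cos (a * u) = cos \<bar>a * (t - (p + q) / 2)\<bar>" using a by (simp add: u_def abs_mult)
    then show ?thesis by (simp add: right_diff_distrib)
  qed
  have ad: "0 \<le> a * d" "a * d \<le> pi" using a d mult_left_mono[OF d(2), of a] by auto
  have "cos (a * u) > cos (a * d) \<longleftrightarrow> u < d"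
  proof (cases "u \<le> L / 2")
    case True
    then have "0 \<le> a * u" "a * u \<le> pi" using a u(1) mult_left_mono[of "2 * u" L a] by auto
    then have "cos (a * d) < cos (a * u) \<longleftrightarrow> a * u < a * d" using ad by (intro cos_mono_less_eq) auto
    then show ?thesis using a by simp
  next
    case False
    have "cos (a * u) = cos (a * (L - u))"
      using a(2) by (simp add: right_diff_distrib cos_diff)
    moreover have "0 \<le> a * (L - u)" "a * (L - u) \<le> pi"
    proof -
      have "u \<le> L" using u d by linarith
      then show "0 \<le> a * (L - u)" using a by simp
      have "a * (2 * (L - u)) \<le> a * L" using a False by (intro mult_left_mono) auto
      moreover have "a * (2 * (L - u)) = 2 * (a * (L - u))" by simp
      ultimately show "a * (L - u) \<le> pi" using a(2) by linarith
    qed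
    then have "cos (a * d) < cos (a * (L - u)) \<longleftrightarrow> a * (L - u) < a * d" using ad by (intro cos_mono_less_eq) auto
    moreover have "\<not> (a * (L - u) < a * d)" using a u(2) by simp
    moreover have "\<not> u < d" using False d by simp
    ultimately show ?thesis by simp
  qed
  also have "u < d \<longleftrightarrow> p < t \<and> t < q" by (auto simp: u_def d_def abs_less_iff field_simps)
  finally show ?thesis using cu by (simp add: a_def d_def)
qed

lemma coefficients_zero_imp_AE_zero:
  fixes w :: "real^2 \<Rightarrow> real"
  assumes L: "L > 0" and w: "sq_integrable L (\<lambda>x. of_real (w x))" and orth: "\<And>k. fc L (\<lambda>x. of_real (w x)) k = 0"
  shows "AE x in cell L. w x = 0"
proof -
  have wm [measurable]: "w \<in> borel_measurable (cell L)"
    using measurable_compose[OF sq_integrable_measurable[OF w] borel_measurable_Re] by simp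
  have wi: "integrable (cell L) w" using integrable_Re[OF sq_integrable_imp_integrable[OF w]] by simp
  define I where "I = (\<integral>x. \<bar>w x\<bar> \<partial>cell L)"
  have I0: "0 \<le> I" by (simp add: I_def)
  have wb: "integrable (cell L) (\<lambda>x. w x * G x)" if "continuous_on UNIV G" "\<And>x. \<bar>G x\<bar> \<le> 1" for G :: "real^2 \<Rightarrow> real"
  proof (rule Bochner_Integration.integrable_bound[OF wi])
    have [measurable]: "G \<in> borel_measurable (cell L)" by (rule continuous_cell_measurable[OF that(1)])
    show "(\<lambda>x. w x * G x) \<in> borel_measurable (cell L)" by measurable
    show "AE x in cell L. norm (w x * G x) \<le> norm (w x)"
      using that(2) by (intro AE_I2) (simp add: abs_mult mult_left_le)
  qed
  have bump: "(\<integral>x. w x * (arc_bump r1 n (cos (ph L (1,0) x - \<gamma>1)) * arc_bump r2 n (cos (ph L (0,1) x - \<gamma>2))) \<partial>cell L) = 0"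
    for r1 r2 n \<gamma>1 \<gamma>2
  proof -
    let ?c1 = "\<lambda>x. cos (ph L (1,0) x - \<gamma>1)" and ?c2 = "\<lambda>x. cos (ph L (0,1) x - \<gamma>2)"
    let ?b1 = "\<lambda>x. arc_bump r1 n (?c1 x)" and ?b2 = "\<lambda>x. arc_bump r2 n (?c2 x)"
    have bc: "continuous_on UNIV (\<lambda>x. ?b1 x * ?b2 x)"
      by (intro continuous_intros continuous_on_compose2[OF arc_bump(3)[of UNIV]]) auto
    have bi: "integrable (cell L) (\<lambda>x. w x * (?b1 x * ?b2 x))"
      by (rule wb[OF bc]) (use arc_bump(1,2) in \<open>auto simp: abs_mult intro!: mult_le_one\<close>)
    have "\<bar>\<integral>x. w x * (?b1 x * ?b2 x) \<partial>cell L\<bar> \<le> 0 + r" if r: "0 < r" for r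
    proof -
      define e where "e = min 1 (r / (3 * (I + 1)))"
      have e: "0 < e" "e \<le> 1" using r I0 by (auto simp: e_def)
      have e3: "3 * e * I \<le> r"
      proof -
        have "3 * e * I \<le> 3 * (r / (3 * (I + 1))) * I" using I0 by (intro mult_right_mono mult_left_mono) (auto simp: e_def)
        also have "\<dots> \<le> r" using I0 r by (simp add: field_simps)
        finally show ?thesis .
      qed
      obtain p1 where p1: "real_polynomial_function p1" "\<And>t. t \<in> {-1..1} \<Longrightarrow> \<bar>arc_bump r1 n t - p1 t\<bar> < e"
        by (rule Stone_Weierstrass_real_polynomial_function[OF compact_Icc arc_bump(3) e(1)]) (rule that)
      obtain p2 where p2: "real_polynomial_function p2" "\<And>t. t \<in> {-1..1} \<Longrightarrow> \<bar>arc_bump r2 n t - p2 t\<bar> < e"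
        by (rule Stone_Weierstrass_real_polynomial_function[OF compact_Icc arc_bump(3) e(1)]) (rule that)
      let ?P = "\<lambda>x. p1 (?c1 x) * p2 (?c2 x)"
      have "(\<lambda>x. complex_of_real (p1 (?c1 x)) * complex_of_real (p2 (?c2 x))) \<in> trig_span L"
        by (rule trig_span_mult[OF trig_span_poly[OF p2(1) trig_span_cos] trig_span_poly[OF p1(1) trig_span_cos]])
      from trig_span_orthogonal[OF w orth L this]
      have Pi: "integrable (cell L) (\<lambda>x. complex_of_real (w x * ?P x))" "(\<integral>x. complex_of_real (w x * ?P x) \<partial>cell L) = 0"
        by simp_all
      have Pr: "integrable (cell L) (\<lambda>x. w x * ?P x)" "(\<integral>x. w x * ?P x \<partial>cell L) = 0"
        using Pi by (simp_all only: complex_of_real_integrable_eq integral_complex_of_real of_real_eq_0_iff)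
      have close: "\<bar>?b1 x * ?b2 x - ?P x\<bar> \<le> 3 * e" for x
      proof -
        have c: "?c1 x \<in> {-1..1}" "?c2 x \<in> {-1..1}" by auto
        have d1: "\<bar>?b1 x - p1 (?c1 x)\<bar> \<le> e" and d2: "\<bar>?b2 x - p2 (?c2 x)\<bar> \<le> e"
          using p1(2)[OF c(1)] p2(2)[OF c(2)] by simp_all
        have P1: "\<bar>p1 (?c1 x)\<bar> \<le> 2" using d1 arc_bump(1,2)[of r1 n "?c1 x"] e(2) by linarith
        have "?b1 x * ?b2 x - ?P x = (?b1 x - p1 (?c1 x)) * ?b2 x + p1 (?c1 x) * (?b2 x - p2 (?c2 x))"
          by (simp add: algebra_simps)
        then have "\<bar>?b1 x * ?b2 x - ?P x\<bar> \<le> \<bar>?b1 x - p1 (?c1 x)\<bar> * \<bar>?b2 x\<bar> + \<bar>p1 (?c1 x)\<bar> * \<bar>?b2 x - p2 (?c2 x)\<bar>"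
          unfolding abs_mult[symmetric] by (simp only: abs_triangle_ineq)
        also have "\<dots> \<le> e * 1 + 2 * e"
          using d1 d2 P1 arc_bump(1,2)[of r2 n "?c2 x"] e(1) by (intro add_mono mult_mono) auto
        finally show ?thesis by simp
      qed
      have diff: "(\<integral>x. w x * (?b1 x * ?b2 x) - w x * ?P x \<partial>cell L) = (\<integral>x. w x * (?b1 x * ?b2 x) \<partial>cell L)"
        using bi Pr by simp
      have le: "\<bar>\<integral>x. w x * (?b1 x * ?b2 x) - w x * ?P x \<partial>cell L\<bar> \<le> (\<integral>x. 3 * e * \<bar>w x\<bar> \<partial>cell L)"
      proof (rule integral_abs_bound_integral)
        show "integrable (cell L) (\<lambda>x. w x * (?b1 x * ?b2 x) - w x * ?P x)" using bi Pr by simp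
        show "integrable (cell L) (\<lambda>x. 3 * e * \<bar>w x\<bar>)" using wi by simp
        fix x
        have "\<bar>w x * (?b1 x * ?b2 x) - w x * ?P x\<bar> = \<bar>w x * (?b1 x * ?b2 x - ?P x)\<bar>"
          by (rule arg_cong[where f = abs], rule right_diff_distrib[symmetric])
        also have "\<dots> = \<bar>w x\<bar> * \<bar>?b1 x * ?b2 x - ?P x\<bar>" by (rule abs_mult)
        also have "\<dots> \<le> \<bar>w x\<bar> * (3 * e)" by (rule mult_left_mono[OF close abs_ge_zero])
        also have "\<dots> = 3 * e * \<bar>w x\<bar>" by (rule mult.commute)
        finally show "\<bar>w x * (?b1 x * ?b2 x) - w x * ?P x\<bar> \<le> 3 * e * \<bar>w x\<bar>" .
      qed
      have "(\<integral>x. 3 * e * \<bar>w x\<bar> \<partial>cell L) = 3 * e * I" by (simp add: I_def)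
      then show ?thesis using le[unfolded diff] e3 by linarith
    qed
    then have "\<bar>\<integral>x. w x * (?b1 x * ?b2 x) \<partial>cell L\<bar> \<le> 0" by (rule field_le_epsilon)
    then show ?thesis by simp
  qed
  have small_box: "(\<integral>x. w x * indicator (box p q) x \<partial>cell L) = 0"
    if pq: "\<And>i. 0 \<le> p $ i" "\<And>i. p $ i \<le> q $ i" "\<And>i. q $ i \<le> L" for p q
  proof -
    define \<gamma> where "\<gamma> i = 2 * pi / L * ((p $ i + q $ i) / 2)" for i
    define r where "r i = cos (2 * pi / L * ((q $ i - p $ i) / 2))" for i
    let ?s = "\<lambda>n x. w x * (arc_bump (r 1) n (cos (ph L (1,0) x - \<gamma> 1)) * arc_bump (r 2) n (cos (ph L (0,1) x - \<gamma> 2)))"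
    have "(\<lambda>n. \<integral>x. ?s n x \<partial>cell L) \<longlonglongrightarrow> (\<integral>x. w x * indicator (box p q) x \<partial>cell L)"
    proof (rule integral_dominated_convergence[where w = "\<lambda>x. \<bar>w x\<bar>"])
      show "(\<lambda>x. w x * indicator (box p q) x) \<in> borel_measurable (cell L)"
      proof -
        have "box p q \<inter> cbox 0 (vec L) \<in> sets (cell L)" by (auto simp: sets_restrict_space)
        then have "indicat_real (box p q) \<in> borel_measurable (cell L)"
          by (simp add: borel_measurable_indicator_iff)
        then show ?thesis by measurable
      qed
      show "?s n \<in> borel_measurable (cell L)" for n
      proof -
        have "continuous_on UNIV (\<lambda>x. arc_bump (r 1) n (cos (ph L (1,0) x - \<gamma> 1)) * arc_bump (r 2) n (cos (ph L (0,1) x - \<gamma> 2)))"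
          by (intro continuous_intros continuous_on_compose2[OF arc_bump(3)[of UNIV]]) auto
        from continuous_cell_measurable[OF this] show ?thesis by measurable
      qed
      show "integrable (cell L) (\<lambda>x. \<bar>w x\<bar>)" using wi by simp
      show "AE x in cell L. (\<lambda>n. ?s n x) \<longlonglongrightarrow> w x * indicator (box p q) x"
      proof (rule AE_I2)
        fix x assume "x \<in> space (cell L)"
        then have x: "0 \<le> x $ i" "x $ i \<le> L" for i by (auto simp: mem_box_cart)
        have c1: "r 1 < cos (ph L (1,0) x - \<gamma> 1) \<longleftrightarrow> p $ 1 < x $ 1 \<and> x $ 1 < q $ 1"
          using cos_gt_iff_in_interval[OF L pq(1,2,3) x, of 1] by (simp add: ph_def \<gamma>_def r_def)
        have c2: "r 2 < cos (ph L (0,1) x - \<gamma> 2) \<longleftrightarrow> p $ 2 < x $ 2 \<and> x $ 2 < q $ 2"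
          using cos_gt_iff_in_interval[OF L pq(1,2,3) x, of 2] by (simp add: ph_def \<gamma>_def r_def)
        have "(\<lambda>n. ?s n x) \<longlonglongrightarrow> w x * ((if r 1 < cos (ph L (1,0) x - \<gamma> 1) then 1 else 0) * (if r 2 < cos (ph L (0,1) x - \<gamma> 2) then 1 else 0))"
          by (intro tendsto_intros arc_bump_lim)
        moreover have "((if r 1 < cos (ph L (1,0) x - \<gamma> 1) then 1 else 0) * (if r 2 < cos (ph L (0,1) x - \<gamma> 2) then 1 else 0)) = indicat_real (box p q) x"
          unfolding c1 c2 by (auto simp: indicator_def mem_box_cart forall_2)
        ultimately show "(\<lambda>n. ?s n x) \<longlonglongrightarrow> w x * indicator (box p q) x" by simp
      qed
      show "AE x in cell L. norm (?s n x) \<le> \<bar>w x\<bar>" for n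
        using arc_bump(1,2) by (intro AE_I2) (auto simp: abs_mult intro!: mult_left_le mult_le_one)
    qed
    then show ?thesis unfolding bump by (simp add: LIMSEQ_const_iff)
  qed
  define W where "W x = indicator (cbox 0 (vec L)) x * w x" for x
  have Wi: "integrable lebesgue W"
    using wi unfolding W_def[abs_def] by (simp add: integrable_restrict_space)
  obtain W' where W'[measurable]: "W' \<in> borel_measurable lborel" and ae: "AE x in lborel. W x = W' x"
    using completion_ex_borel_measurable_real[OF borel_measurable_integrable[OF Wi]] by blast
  have aeL: "AE x in lebesgue. W x = W' x" using ae by (rule AE_completion)
  have W'i: "integrable lborel W'"
  proof -
    have "W' \<in> borel_measurable lebesgue" using W' by (rule measurable_completion)
    then have "integrable lebesgue W'" using integrable_cong_AE_imp[OF Wi] aeL by (metis (mono_tags, lifting) eventually_mono)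
    then show ?thesis using integrable_completion[OF W'] by simp
  qed
  have "AE x in lborel. W' x = 0"
  proof (rule box_integrals_zero_imp_AE_zero[OF W'i])
    fix a b :: "real^2"
    define p q :: "real^2" where "p = (\<chi> i. max 0 (a $ i))" and "q = (\<chi> i. min L (b $ i))"
    have "(\<integral>x. indicator (box a b) x * W' x \<partial>lborel) = (\<integral>x. indicator (box a b) x * W' x \<partial>lebesgue)"
      by (rule integral_completion[symmetric]) measurable
    also have "\<dots> = (\<integral>x. indicator (box a b) x * W x \<partial>lebesgue)"
    proof (rule integral_cong_AE)
      show "(\<lambda>x. indicator (box a b) x * W' x) \<in> borel_measurable lebesgue"
        by (rule measurable_completion) measurable
      show "(\<lambda>x. indicator (box a b) x * W x) \<in> borel_measurable lebesgue"
      proof -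
        have "indicat_real (box a b) \<in> borel_measurable lebesgue" by (intro measurable_completion) measurable
        then show ?thesis using borel_measurable_integrable[OF Wi] by measurable
      qed
      show "AE x in lebesgue. indicator (box a b) x * W' x = indicator (box a b) x * W x"
        using aeL by eventually_elim simp
    qed
    also have "\<dots> = (\<integral>x. indicator (cbox 0 (vec L)) x *\<^sub>R (w x * indicator (box a b) x) \<partial>lebesgue)"
      by (simp add: W_def mult_ac)
    also have "\<dots> = (\<integral>x. w x * indicator (box a b) x \<partial>cell L)"
      by (subst integral_restrict_space) auto
    also have "\<dots> = 0"
    proof (cases "\<forall>i. p $ i \<le> q $ i")
      case True
      have "(\<integral>x. w x * indicator (box a b) x \<partial>cell L) = (\<integral>x. w x * indicator (box p q) x \<partial>cell L)"
      proof (rule integral_cong_AE)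
        have m: "indicat_real (box a b) \<in> borel_measurable (cell L)" for a b
        proof -
          have "box a b \<inter> cbox 0 (vec L) \<in> sets (cell L)" by (auto simp: sets_restrict_space)
          then show ?thesis by (simp add: borel_measurable_indicator_iff)
        qed
        show "(\<lambda>x. w x * indicator (box a b) x) \<in> borel_measurable (cell L)" "(\<lambda>x. w x * indicator (box p q) x) \<in> borel_measurable (cell L)"
          using m[of a b] m[of p q] by measurable
        have "negligible (cbox 0 (vec L) - box 0 (vec L :: real^2))" by (rule negligible_frontier_interval)
        then have "AE x in lebesgue. x \<notin> cbox 0 (vec L) - box 0 (vec L :: real^2)"
          by (simp add: AE_iff_null_sets negligible_iff_null_sets AE_not_in)
        then have "AE x in cell L. x \<notin> cbox 0 (vec L) - box 0 (vec L :: real^2)"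
          by (subst AE_restrict_space_iff) (auto elim: eventually_mono)
        then show "AE x in cell L. w x * indicator (box a b) x = w x * indicator (box p q) x"
          using AE_space
        proof eventually_elim
          case (elim x)
          then have "x \<in> box 0 (vec L)" by simp
          then have "x \<in> box a b \<longleftrightarrow> x \<in> box p q" by (auto simp: mem_box_cart p_def q_def)
          then show ?case by (simp add: indicator_def)
        qed
      qed
      also have "\<dots> = 0" using True L by (intro small_box) (auto simp: p_def q_def)
      finally show ?thesis .
    next
      case False
      then obtain i where "q $ i < p $ i" by (auto simp: not_le)
      then have "x \<notin> box a b" if "x \<in> cbox 0 (vec L)" for x
        using that by (auto simp: mem_box_cart p_def q_def max_def min_def not_less split: if_splits intro!: exI[of _ i] dest!: spec[of _ i])
      then have "(\<integral>x. w x * indicator (box a b) x \<partial>cell L) = (\<integral>x. 0 \<partial>cell L)"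
        by (intro Bochner_Integration.integral_cong refl) (auto simp: indicator_def)
      then show ?thesis by simp
    qed
    finally show "(\<integral>x. indicator (box a b) x * W' x \<partial>lborel) = 0" .
  qed
  then have "AE x in lebesgue. W' x = 0" by (rule AE_completion)
  with aeL have "AE x in lebesgue. x \<in> cbox 0 (vec L) \<longrightarrow> w x = 0"
    by eventually_elim (auto simp: W_def)
  then show ?thesis by (subst AE_restrict_space_iff) auto
qed

section \<open>Fourier coefficients of vector fields\<close>


definition cf :: "field2 \<Rightarrow> 2 \<Rightarrow> real^2 \<Rightarrow> complex" where
  "cf u c x = of_real (u x $ c)"

text \<open>\<open>vort L u k\<close> is \<open>- \<i> k\<^sup>\<perp> \<cdot> u\<^sub>k\<close> with \<open>k\<^sup>\<perp> = perp k\<close>, i.e. the Fourier coefficient of the vorticity up to a power of \<open>2\<pi>/L\<close>;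
  a divergence-free mean-zero field is recovered from it by \<open>u\<^sub>k = \<i> k\<^sup>\<perp> \<omega>\<^sub>k / \<bar>k\<bar>\<^sup>2\<close>, where the mode \<open>k = 0\<close> is covered by \<open>x / 0 = 0\<close>.\<close>
definition vort :: "real \<Rightarrow> field2 \<Rightarrow> idx \<Rightarrow> complex" where
  "vort L u k = - \<i> * (of_int (fst k) * fc L (cf u 2) k - of_int (snd k) * fc L (cf u 1) k)"

definition kc :: "idx \<Rightarrow> 2 \<Rightarrow> real" where
  "kc k j = (if j = 1 then of_int (fst k) else of_int (snd k))"

definition perp :: "idx \<Rightarrow> real^2" where
  "perp k = (\<chi> j. if j = 1 then - of_int (snd k) else of_int (fst k))"

definition cos_field :: "real \<Rightarrow> idx \<Rightarrow> field2" where
  "cos_field L k x = cos (ph L k x) *\<^sub>R perp k"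

definition sin_field :: "real \<Rightarrow> idx \<Rightarrow> field2" where
  "sin_field L k x = sin (ph L k x) *\<^sub>R perp k"

lemma two_neq_one [simp]: "(2::2) \<noteq> 1" "(1::2) \<noteq> 2"
  by simp_all

lemma kc_simps [simp]: "kc k 1 = of_int (fst k)" "kc k 2 = of_int (snd k)"
  by (simp_all add: kc_def)

lemma perp_simps [simp]: "perp k $ 1 = - of_int (snd k)" "perp k $ 2 = of_int (fst k)"
  by (simp_all add: perp_def)

lemma norm_sq_2: "(norm (v::real^2))\<^sup>2 = (v $ 1)\<^sup>2 + (v $ 2)\<^sup>2"
  unfolding power2_norm_eq_inner inner_vec_def by (simp add: UNIV_2 power2_eq_square)

lemma inner_2: "(u::real^2) \<bullet> v = u $ 1 * v $ 1 + u $ 2 * v $ 2"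
  unfolding inner_vec_def by (simp add: UNIV_2)

lemma vec_nth_measurable: "u \<in> borel_measurable M \<Longrightarrow> (\<lambda>x. (u x :: real^2) $ c) \<in> borel_measurable M"
  unfolding cart_eq_inner_axis by (intro borel_measurable_inner) auto

lemma L2_imp_sq_integrable:
  assumes "u \<in> L2 L" shows "sq_integrable L (cf u c)"
proof -
  have m: "u \<in> borel_measurable (cell L)" and i: "integrable (cell L) (\<lambda>x. (norm (u x))\<^sup>2)"
    using assms by (auto simp: L2_def)
  have [measurable]: "(\<lambda>x. u x $ c) \<in> borel_measurable (cell L)" by (rule vec_nth_measurable[OF m])
  have "integrable (cell L) (\<lambda>x. (u x $ c)\<^sup>2)"
  proof (rule Bochner_Integration.integrable_bound[OF i])
    show "AE x in cell L. norm ((u x $ c)\<^sup>2) \<le> norm ((norm (u x))\<^sup>2)"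
      by (intro AE_I2) (simp add: component_le_norm_cart abs_le_square_iff[symmetric])
  qed measurable
  then show ?thesis unfolding sq_integrable_def cf_def[abs_def] by simp
qed

lemma sq_integrable_imp_L2:
  assumes "u \<in> borel_measurable (cell L)" "\<And>c. sq_integrable L (cf u c)" shows "u \<in> L2 L"
proof -
  have "integrable (cell L) (\<lambda>x. (cmod (cf u 1 x))\<^sup>2 + (cmod (cf u 2 x))\<^sup>2)"
    using assms(2) by (auto simp: sq_integrable_def)
  then show ?thesis using assms(1) by (simp add: L2_def norm_sq_2 cf_def)
qed

lemma L2_diff:
  assumes "u \<in> L2 L" "v \<in> L2 L" shows "(\<lambda>x. u x - v x) \<in> L2 L"
proof (rule sq_integrable_imp_L2)
  show "(\<lambda>x. u x - v x) \<in> borel_measurable (cell L)" using assms by (auto simp: L2_def)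
  fix c
  have "cf (\<lambda>x. u x - v x) c = (\<lambda>x. cf u c x - cf v c x)" by (simp add: cf_def fun_eq_iff)
  then show "sq_integrable L (cf (\<lambda>x. u x - v x) c)"
    using sq_integrable_diff[OF assms[THEN L2_imp_sq_integrable]] by simp
qed

lemma cf_diff: "cf (\<lambda>x. u x - v x) c = (\<lambda>x. cf u c x - cf v c x)"
  by (simp add: cf_def fun_eq_iff)

lemma L2_continuous:
  assumes "continuous_on UNIV u" shows "u \<in> L2 L"
  by (rule sq_integrable_imp_L2[OF continuous_cell_measurable[OF assms]])
    (auto intro!: sq_integrable_continuous continuous_intros assms simp: cf_def[abs_def])

lemma l2_norm_sq:
  assumes "u \<in> L2 L" shows "(l2_norm L u)\<^sup>2 = mass L (cf u 1) + mass L (cf u 2)"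
proof -
  have i: "integrable (cell L) (\<lambda>x. (u x $ c)\<^sup>2)" for c
    using L2_imp_sq_integrable[OF assms, of c] by (simp add: sq_integrable_def cf_def)
  have "l2_inner L u u = mass L (cf u 1) + mass L (cf u 2)"
    unfolding l2_inner_def mass_def inner_2 cf_def using i by (simp add: power2_eq_square)
  then show ?thesis unfolding l2_norm_def using mass_nonneg by (simp add: add_nonneg_nonneg)
qed

lemma mass_le_l2_norm: "u \<in> L2 L \<Longrightarrow> mass L (cf u c) \<le> (l2_norm L u)\<^sup>2"
  using exhaust_2[of c] mass_nonneg[of L "cf u 1"] mass_nonneg[of L "cf u 2"] by (auto simp: l2_norm_sq)

lemma l2_norm_nonneg: "0 \<le> l2_norm L u"
  by (simp add: l2_norm_def l2_inner_def integral_nonneg)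

lemma fc_integrable': "integrable (cell L) f \<Longrightarrow> integrable (cell L) (\<lambda>x. f x * cnj (wave L k x))"
proof (rule Bochner_Integration.integrable_bound)
  assume f: "integrable (cell L) f"
  have "(\<lambda>x. cnj (wave L k x)) \<in> borel_measurable (cell L)"
    by (intro continuous_cell_measurable continuous_intros)
  then show "(\<lambda>x. f x * cnj (wave L k x)) \<in> borel_measurable (cell L)" using f by measurable
qed (auto simp: norm_mult)

text \<open>With \<open>W = k\<^sup>\<perp> \<cdot> u\<^sub>k = \<i> \<omega>\<^sub>k\<close>, pairing with \<open>cos_field\<close> and \<open>sin_field\<close> reads off the real and imaginary
  part of \<open>W\<close>.\<close>
lemma l2_inner_test_fields:
  assumes L: "L > 0" and u: "\<And>c. integrable (cell L) (cf u c)"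
  shows "l2_inner L u (cos_field L k) = - L\<^sup>2 * Im (vort L u k)"
    and "l2_inner L u (sin_field L k) = - L\<^sup>2 * Re (vort L u k)"
proof -
  define W where "W x = (of_int (fst k) * cf u 2 x - of_int (snd k) * cf u 1 x) * cnj (wave L k x)" for x
  have i: "integrable (cell L) (\<lambda>x. cf u c x * cnj (wave L k x))" for c by (rule fc_integrable'[OF u])
  have Wi: "integrable (cell L) W"
    unfolding W_def left_diff_distrib mult.assoc by (intro Bochner_Integration.integrable_diff integrable_mult_right i)
  have "(\<integral>x. W x \<partial>cell L) = of_real (L\<^sup>2) * (of_int (fst k) * fc L (cf u 2) k - of_int (snd k) * fc L (cf u 1) k)"
    unfolding W_def left_diff_distrib mult.assoc using i L
    by (subst Bochner_Integration.integral_diff) (auto simp: fc_def right_diff_distrib)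
  then have WI: "(\<integral>x. W x \<partial>cell L) = of_real (L\<^sup>2) * (\<i> * vort L u k)" by (simp add: vort_def algebra_simps)
  have "l2_inner L u (cos_field L k) = (\<integral>x. Re (W x) \<partial>cell L)"
    unfolding l2_inner_def cos_field_def inner_2 W_def cf_def wave_def
    by (intro Bochner_Integration.integral_cong refl) (simp add: algebra_simps)
  then show "l2_inner L u (cos_field L k) = - L\<^sup>2 * Im (vort L u k)"
    unfolding integral_Re[OF Wi] WI by (simp add: power2_eq_square)
  have "l2_inner L u (sin_field L k) = (\<integral>x. - Im (W x) \<partial>cell L)"
    unfolding l2_inner_def sin_field_def inner_2 W_def cf_def wave_def
    by (intro Bochner_Integration.integral_cong refl) (simp add: algebra_simps)
  also have "\<dots> = - Im (\<integral>x. W x \<partial>cell L)" using integral_Im[OF Wi] by simp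
  finally show "l2_inner L u (sin_field L k) = - L\<^sup>2 * Re (vort L u k)"
    unfolding WI by (simp add: power2_eq_square)
qed

abbreviation (input) trig_poly :: "real \<Rightarrow> (int^2) set \<Rightarrow> (int^2 \<Rightarrow> real^2) \<Rightarrow> (int^2 \<Rightarrow> real^2) \<Rightarrow> field2" where
  "trig_poly L K a b \<equiv> (\<lambda>x. \<Sum>k\<in>K. cos (phase L k x) *\<^sub>R a k + sin (phase L k x) *\<^sub>R b k)"

definition pr :: "int^2 \<Rightarrow> idx" where "pr k = (k $ 1, k $ 2)"

lemma phase_ph: "phase L k = ph L (pr k)"
  by (simp add: fun_eq_iff phase_def ph_def UNIV_2 pr_def)

lemma pr_vector: "pr (vector [fst k, snd k]) = k"
  by (simp add: pr_def)

lemma ph_shift: "ph L k (x + s *\<^sub>R axis j 1) = ph L k x + s * (2 * pi / L * kc k j)"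
  using exhaust_2[of j] by (auto simp: ph_def axis_def algebra_simps)

lemma partial_trig_poly:
  assumes K: "finite K"
  shows "partial j (trig_poly L K a b) = trig_poly L K (\<lambda>k. (2 * pi / L * kc (pr k) j) *\<^sub>R b k) (\<lambda>k. - (2 * pi / L * kc (pr k) j) *\<^sub>R a k)"
proof
  fix x
  have "((\<lambda>s. \<Sum>k\<in>K. cos (ph L (pr k) x + s * (2 * pi / L * kc (pr k) j)) *\<^sub>R a k + sin (ph L (pr k) x + s * (2 * pi / L * kc (pr k) j)) *\<^sub>R b k)
     has_vector_derivative (\<Sum>k\<in>K. cos (ph L (pr k) x) *\<^sub>R (2 * pi / L * kc (pr k) j) *\<^sub>R b k + sin (ph L (pr k) x) *\<^sub>R - (2 * pi / L * kc (pr k) j) *\<^sub>R a k)) (at 0)"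
  proof (rule has_vector_derivative_sum)
    fix k assume "k \<in> K"
    define p q where "p = ph L (pr k) x" and "q = 2 * pi / L * kc (pr k) j"
    have "((\<lambda>s. cos (p + s * q)) has_vector_derivative - sin p * q) (at 0)" "((\<lambda>s. sin (p + s * q)) has_vector_derivative cos p * q) (at 0)"
      unfolding has_real_derivative_iff_has_vector_derivative[symmetric] by (auto intro!: derivative_eq_intros)
    then have "((\<lambda>s. cos (p + s * q) *\<^sub>R a k + sin (p + s * q) *\<^sub>R b k) has_vector_derivative (- sin p * q) *\<^sub>R a k + (cos p * q) *\<^sub>R b k) (at 0)"
      by (intro has_vector_derivative_add bounded_linear.has_vector_derivative[OF bounded_linear_scaleR_left])
    then show "((\<lambda>s. cos (p + s * q) *\<^sub>R a k + sin (p + s * q) *\<^sub>R b k) has_vector_derivative cos p *\<^sub>R q *\<^sub>R b k + sin p *\<^sub>R - q *\<^sub>R a k) (at 0)"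
      by (simp add: algebra_simps)
  qed
  then show "partial j (trig_poly L K a b) x = trig_poly L K (\<lambda>k. (2 * pi / L * kc (pr k) j) *\<^sub>R b k) (\<lambda>k. - (2 * pi / L * kc (pr k) j) *\<^sub>R a k) x"
    unfolding partial_def phase_ph ph_shift by (rule vector_derivative_at)
qed

lemma fc_cos: 
  assumes "L > 0"
  shows "fc L (\<lambda>x. of_real (cos (ph L m x))) k = ((if m = k then 1 else 0) + (if - m = k then 1 else 0)) / 2"
proof -
  have eq: "complex_of_real (cos (ph L m x)) = (1/2) * wave L m x + (1/2) * wave L (- m) x" for x
    by (simp add: complex_eq_iff wave_def ph_uminus)
  have "fc L (\<lambda>x. of_real (cos (ph L m x))) k = (1/2) * fc L (wave L m) k + (1/2) * fc L (wave L (- m)) k"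
    unfolding eq by (subst fc_add) (auto intro: sq_integrable_cmult sq_integrable_wave simp del: times_divide_eq_left mult_1 simp: fc_cmult)
  then show ?thesis by (simp add: fc_wave[OF assms])
qed

lemma fc_sin:
  assumes "L > 0"
  shows "fc L (\<lambda>x. of_real (sin (ph L m x))) k = ((if m = k then 1 else 0) - (if - m = k then 1 else 0)) / (2 * \<i>)"
proof -
  have eq: "complex_of_real (sin (ph L m x)) = (1 / (2 * \<i>)) * wave L m x + (- 1 / (2 * \<i>)) * wave L (- m) x" for x
    by (simp add: complex_eq_iff wave_def ph_uminus)
  have "fc L (\<lambda>x. of_real (sin (ph L m x))) k = (1 / (2 * \<i>)) * fc L (wave L m) k + (- 1 / (2 * \<i>)) * fc L (wave L (- m)) k"
    unfolding eq by (subst fc_add) (auto intro: sq_integrable_cmult sq_integrable_wave simp only: fc_cmult)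
  then show ?thesis by (simp add: fc_wave[OF assms] diff_divide_distrib)
qed

lemma fc_trig_poly:
  assumes L: "L > 0"
  shows "fc L (cf (trig_poly L K a b) c) k = (\<Sum>m\<in>K. of_real (a m $ c) * fc L (\<lambda>x. of_real (cos (ph L (pr m) x))) k
     + of_real (b m $ c) * fc L (\<lambda>x. of_real (sin (ph L (pr m) x))) k)"
proof -
  have eq: "cf (trig_poly L K a b) c = (\<lambda>x. \<Sum>m\<in>K. of_real (a m $ c) * of_real (cos (ph L (pr m) x)) + of_real (b m $ c) * of_real (sin (ph L (pr m) x)))"
    by (simp add: cf_def fun_eq_iff phase_ph mult.commute)
  have s: "sq_integrable L (\<lambda>x. d * of_real (cos (ph L m x)))" "sq_integrable L (\<lambda>x. d * of_real (sin (ph L m x)))" for d m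
    by (auto intro!: sq_integrable_continuous continuous_intros)
  show ?thesis unfolding eq
    by (subst fc_sum) (auto intro!: sq_integrable_add s sum.cong simp: fc_add[OF s] fc_cmult)
qed

lemma fc_partial_trig_poly:
  assumes L: "L > 0" and K: "finite K"
  shows "fc L (cf (partial j (trig_poly L K a b)) c) k = \<i> * of_real (2 * pi / L * kc k j) * fc L (cf (trig_poly L K a b) c) k"
  unfolding partial_trig_poly[OF K] fc_trig_poly[OF L] sum_distrib_left
proof (intro sum.cong refl)
  fix m
  define X Y where "X = complex_of_real (2 * pi / L * kc (pr m) j)" and "Y = complex_of_real (2 * pi / L * kc k j)"
  define A B where "A = complex_of_real (a m $ c)" and "B = complex_of_real (b m $ c)"
  have kcm: "kc (- k) j = - kc k j" using exhaust_2[of j] by auto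
  have XY: "pr m = k \<Longrightarrow> X = Y" "- pr m = k \<Longrightarrow> X = - Y" using kcm by (auto simp: X_def Y_def)
  have i: "z / (2 * \<i>) = - (\<i> / 2) * z" for z by simp
  have "(X * B) * (((if pr m = k then 1 else 0) + (if - pr m = k then 1 else 0)) / 2) + (- X * A) * (((if pr m = k then 1 else 0) - (if - pr m = k then 1 else 0)) / (2 * \<i>))
     = \<i> * Y * (A * (((if pr m = k then 1 else 0) + (if - pr m = k then 1 else 0)) / 2) + B * (((if pr m = k then 1 else 0) - (if - pr m = k then 1 else 0)) / (2 * \<i>)))"
    unfolding i using XY by (auto simp: algebra_simps)
  then show "of_real (((2 * pi / L * kc (pr m) j) *\<^sub>R b m) $ c) * fc L (\<lambda>x. of_real (cos (ph L (pr m) x))) k +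
      of_real ((- (2 * pi / L * kc (pr m) j) *\<^sub>R a m) $ c) * fc L (\<lambda>x. of_real (sin (ph L (pr m) x))) k =
      \<i> * of_real (2 * pi / L * kc k j) * (of_real (a m $ c) * fc L (\<lambda>x. of_real (cos (ph L (pr m) x))) k +
      of_real (b m $ c) * fc L (\<lambda>x. of_real (sin (ph L (pr m) x))) k)"
    unfolding fc_cos[OF L] fc_sin[OF L] vector_scaleR_component real_scaleR_def of_real_mult of_real_minus X_def Y_def A_def B_def .
qed

lemma continuous_on_trig_poly: "continuous_on S (trig_poly L K a b)"
  unfolding phase_ph by (intro continuous_intros)

lemma trig_polys_L2: "v \<in> trig_polys L \<Longrightarrow> v \<in> L2 L"
  unfolding trig_polys_def by (auto intro!: L2_continuous continuous_on_trig_poly)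

lemma trig_polysI: "finite K \<Longrightarrow> trig_poly L K a b \<in> trig_polys L"
  unfolding trig_polys_def by (rule CollectI, rule exI[of _ K], rule exI[of _ a], rule exI[of _ b]) simp

lemma partial_trig_polys: "v \<in> trig_polys L \<Longrightarrow> partial j v \<in> trig_polys L"
proof -
  assume "v \<in> trig_polys L"
  then obtain K a b where K: "finite K" and v: "v = trig_poly L K a b" by (auto simp: trig_polys_def)
  show "partial j v \<in> trig_polys L"
    unfolding v partial_trig_poly[OF K] by (rule trig_polysI[OF K])
qed

lemma fc_partial: "L > 0 \<Longrightarrow> v \<in> trig_polys L \<Longrightarrow> fc L (cf (partial j v) c) k = \<i> * of_real (2 * pi / L * kc k j) * fc L (cf v c) k"
  unfolding trig_polys_def by (auto simp: fc_partial_trig_poly)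

lemma trig_span_finite_sum:
  "f \<in> trig_span L \<Longrightarrow> \<exists>F d. finite F \<and> (\<forall>x. f x = (\<Sum>k\<in>F. d k * wave L k x))"
proof (induction rule: trig_span.induct)
  case (wave c k)
  show ?case by (intro exI[of _ "{k}"] exI[of _ "\<lambda>_. c"]) simp
next
  case (add f h)
  then obtain F d G e where *: "finite F" "\<And>x. f x = (\<Sum>k\<in>F. d k * wave L k x)"
    "finite G" "\<And>x. h x = (\<Sum>k\<in>G. e k * wave L k x)" by blast
  have "f x + h x = (\<Sum>k\<in>F \<union> G. ((if k \<in> F then d k else 0) + (if k \<in> G then e k else 0)) * wave L k x)" for x
  proof -
    have "(\<Sum>k\<in>F \<union> G. (if k \<in> F then d k else 0) * wave L k x) = f x"
      unfolding *(2) using *(1,3) by (intro sum.mono_neutral_cong_right) auto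
    moreover have "(\<Sum>k\<in>F \<union> G. (if k \<in> G then e k else 0) * wave L k x) = h x"
      unfolding *(4) using *(1,3) by (intro sum.mono_neutral_cong_right) auto
    ultimately show ?thesis by (simp add: distrib_right sum.distrib)
  qed
  then show ?case using *(1,3) by (intro exI[of _ "F \<union> G"] exI conjI) auto
qed

lemma trig_span_sum:
  "finite K \<Longrightarrow> (\<And>k. k \<in> K \<Longrightarrow> f k \<in> trig_span L) \<Longrightarrow> (\<lambda>x. \<Sum>k\<in>K. f k x) \<in> trig_span L"
proof (induction K rule: finite_induct)
  case empty
  then show ?case using trig_span_const[of 0] by simp
next
  case (insert k K)
  then show ?case by (simp add: trig_span.add)
qed

lemma trig_polys_span:
  assumes "v \<in> trig_polys L" shows "cf v c \<in> trig_span L"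
proof -
  obtain K a b where K: "finite K" and v: "v = trig_poly L K a b" using assms by (auto simp: trig_polys_def)
  have s: "(\<lambda>x. of_real (sin (ph L k x))) \<in> trig_span L" for k
    using trig_span_cos[of L k "pi / 2"] by (simp add: cos_diff)
  have "cf v c = (\<lambda>x. \<Sum>k\<in>K. of_real (cos (ph L (pr k) x - 0)) * of_real (a k $ c) + of_real (sin (ph L (pr k) x)) * of_real (b k $ c))"
    by (simp add: v cf_def fun_eq_iff phase_ph)
  also have "\<dots> \<in> trig_span L"
    by (intro trig_span_sum[OF K] trig_span.add trig_span_mult[OF trig_span_const] trig_span_cos s)
  finally show ?thesis .
qed

lemma test_fields_trig_polys: "cos_field L k \<in> trig_polys L" "sin_field L k \<in> trig_polys L"
proof -
  let ?K = "{vector [fst k, snd k] :: int^2}"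
  have "cos_field L k = trig_poly L ?K (\<lambda>_. perp k) (\<lambda>_. 0)" "sin_field L k = trig_poly L ?K (\<lambda>_. 0) (\<lambda>_. perp k)"
    by (simp_all add: cos_field_def sin_field_def fun_eq_iff phase_ph pr_vector)
  then show "cos_field L k \<in> trig_polys L" "sin_field L k \<in> trig_polys L"
    using trig_polysI[of ?K L "\<lambda>_. perp k" "\<lambda>_. 0"] trig_polysI[of ?K L "\<lambda>_. 0" "\<lambda>_. perp k"] by simp_all
qed

lemma partial_test_fields:
  "partial j (cos_field L k) = (\<lambda>x. - (2 * pi / L * kc k j) *\<^sub>R sin_field L k x)"
  "partial j (sin_field L k) = (\<lambda>x. (2 * pi / L * kc k j) *\<^sub>R cos_field L k x)"
proof -
  let ?K = "{vector [fst k, snd k] :: int^2}"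
  have eq: "cos_field L k = trig_poly L ?K (\<lambda>_. perp k) (\<lambda>_. 0)" "sin_field L k = trig_poly L ?K (\<lambda>_. 0) (\<lambda>_. perp k)"
    by (simp_all add: cos_field_def sin_field_def fun_eq_iff phase_ph pr_vector)
  show "partial j (cos_field L k) = (\<lambda>x. - (2 * pi / L * kc k j) *\<^sub>R sin_field L k x)"
    unfolding eq(1) by (subst partial_trig_poly) (auto simp: fun_eq_iff phase_ph pr_vector sin_field_def)
  show "partial j (sin_field L k) = (\<lambda>x. (2 * pi / L * kc k j) *\<^sub>R cos_field L k x)"
    unfolding eq(2) by (subst partial_trig_poly) (auto simp: fun_eq_iff phase_ph pr_vector cos_field_def)
qed

lemma partial_scaleR_trig:
  assumes "v \<in> trig_polys L" shows "partial j (\<lambda>x. r *\<^sub>R v x) = (\<lambda>x. r *\<^sub>R partial j v x)"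
proof -
  obtain K a b where K: "finite K" and v: "v = trig_poly L K a b" using assms by (auto simp: trig_polys_def)
  have eq: "(\<lambda>x. r *\<^sub>R v x) = trig_poly L K (\<lambda>k. r *\<^sub>R a k) (\<lambda>k. r *\<^sub>R b k)"
    by (simp add: v fun_eq_iff scaleR_sum_right scaleR_add_right mult.commute)
  have "partial j v = trig_poly L K (\<lambda>k. (2 * pi / L * kc (pr k) j) *\<^sub>R b k) (\<lambda>k. - (2 * pi / L * kc (pr k) j) *\<^sub>R a k)"
    unfolding v by (rule partial_trig_poly[OF K])
  then show ?thesis unfolding eq partial_trig_poly[OF K]
    by (simp add: fun_eq_iff scaleR_sum_right scaleR_diff_right mult_ac)
qed

lemma laplacian_test_fields:
  "laplacian (cos_field L k) = (\<lambda>x. - ((2 * pi / L)\<^sup>2 * n2 k) *\<^sub>R cos_field L k x)"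
  "laplacian (sin_field L k) = (\<lambda>x. - ((2 * pi / L)\<^sup>2 * n2 k) *\<^sub>R sin_field L k x)"
  unfolding laplacian_def[abs_def] partial_test_fields
    partial_scaleR_trig[OF test_fields_trig_polys(1)] partial_scaleR_trig[OF test_fields_trig_polys(2)]
  by (auto simp: fun_eq_iff UNIV_2 n2_def power2_eq_square algebra_simps scaleR_left_distrib[symmetric])

lemma test_fields_solenoidal:
  assumes L: "L > 0"
  shows "cos_field L k \<in> solenoidal_polys L" "sin_field L k \<in> solenoidal_polys L"
proof -
  have div: "divergence (cos_field L k) x = 0" "divergence (sin_field L k) x = 0" for x
    unfolding divergence_def partial_test_fields by (simp_all add: UNIV_2 cos_field_def sin_field_def)
  have w: "(\<integral>x. wave L k x \<partial>cell L) = (if k = 0 then of_real (L\<^sup>2) else 0)" by (rule integral_wave[OF L])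
  have wi: "integrable (cell L) (wave L k)" by (rule sq_integrable_imp_integrable[OF sq_integrable_wave])
  have "(\<integral>x. cos_field L k x \<partial>cell L) = (\<integral>x. Re (wave L k x) \<partial>cell L) *\<^sub>R perp k"
    unfolding cos_field_def using integrable_Re[OF wi] by (subst integral_scaleR_left) (auto simp: wave_def)
  then have c: "(\<integral>x. cos_field L k x \<partial>cell L) = 0"
    unfolding integral_Re[OF wi] w by (auto simp: perp_def vec_eq_iff)
  have "(\<integral>x. sin_field L k x \<partial>cell L) = (\<integral>x. Im (wave L k x) \<partial>cell L) *\<^sub>R perp k"
    unfolding sin_field_def using integrable_Im[OF wi] by (subst integral_scaleR_left) (auto simp: wave_def)
  then have s: "(\<integral>x. sin_field L k x \<partial>cell L) = 0"
    unfolding integral_Im[OF wi] w by (auto simp: perp_def vec_eq_iff)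
  show "cos_field L k \<in> solenoidal_polys L" "sin_field L k \<in> solenoidal_polys L"
    unfolding solenoidal_polys_def using test_fields_trig_polys div c s by auto
qed

lemma solenoidal_coefficients:
  assumes L: "L > 0" and v: "v \<in> solenoidal_polys L"
  shows "fc L (cf v c) 0 = 0" and "of_int (fst k) * fc L (cf v 1) k + of_int (snd k) * fc L (cf v 2) k = 0"
proof -
  have t: "v \<in> trig_polys L" and d: "\<And>x. divergence v x = 0" and z: "(\<integral>x. v x \<partial>cell L) = 0"
    using v by (auto simp: solenoidal_polys_def)
  have vi: "integrable (cell L) (\<lambda>x. v x $ c)" for c
    using integrable_Re[OF sq_integrable_imp_integrable[OF L2_imp_sq_integrable[OF trig_polys_L2[OF t]]]] by (simp add: cf_def)
  have "integrable (cell L) v"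
  proof -
    have "v \<in> borel_measurable (cell L)" using trig_polys_L2[OF t] by (simp add: L2_def)
    then show ?thesis
    proof (rule Bochner_Integration.integrable_bound[rotated])
      show "integrable (cell L) (\<lambda>x. \<bar>v x $ 1\<bar> + \<bar>v x $ 2\<bar>)" using vi by auto
      show "AE x in cell L. norm (v x) \<le> norm (\<bar>v x $ 1\<bar> + \<bar>v x $ 2\<bar>)"
      proof (rule AE_I2)
        fix x show "norm (v x) \<le> norm (\<bar>v x $ 1\<bar> + \<bar>v x $ 2\<bar>)"
          using norm_le_l1_cart[of "v x"] by (simp add: UNIV_2)
      qed
    qed
  qed
  then have "(\<integral>x. v x $ c \<partial>cell L) = (\<integral>x. v x \<partial>cell L) $ c"
    by (intro integral_bounded_linear[OF bounded_linear_vec_nth])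
  then have "(\<integral>x. v x $ c \<partial>cell L) = 0" using z by simp
  then show "fc L (cf v c) 0 = 0" by (simp add: fc_def cf_def)
  have s: "sq_integrable L (cf (partial j v) c)" for j c
    by (intro L2_imp_sq_integrable trig_polys_L2 partial_trig_polys t)
  have "0 = fc L (\<lambda>x. of_real (divergence v x)) k" unfolding d by (simp add: fc_def)
  also have "(\<lambda>x. complex_of_real (divergence v x)) = (\<lambda>x. cf (partial 1 v) 1 x + cf (partial 2 v) 2 x)"
    by (simp add: divergence_def cf_def UNIV_2)
  also have "fc L \<dots> k = \<i> * of_real (2 * pi / L) * (of_int (fst k) * fc L (cf v 1) k + of_int (snd k) * fc L (cf v 2) k)"
    by (simp add: fc_add[OF s s] fc_partial[OF L t] algebra_simps)
  finally show "of_int (fst k) * fc L (cf v 1) k + of_int (snd k) * fc L (cf v 2) k = 0" using L by simp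
qed

lemma solenoidal_in_H: "v \<in> solenoidal_polys L \<Longrightarrow> v \<in> H_space L"
proof -
  assume v: "v \<in> solenoidal_polys L"
  then have "v \<in> L2 L" by (auto simp: solenoidal_polys_def intro: trig_polys_L2)
  moreover have "l2_norm L (\<lambda>x. v x - v x) = 0" by (simp add: l2_norm_def l2_inner_def)
  ultimately show ?thesis using v unfolding H_space_def
    by (intro CollectI conjI allI impI bexI[of _ v]) simp_all
qed

lemma H_imp_L2: "u \<in> H_space L \<Longrightarrow> u \<in> L2 L"
  by (simp add: H_space_def)

lemma H_approx:
  assumes u: "u \<in> H_space L" and e: "0 < e"
  obtains v where "v \<in> solenoidal_polys L" "\<And>c. mass L (\<lambda>x. cf u c x - cf v c x) < e"
proof -
  have "0 < sqrt e" using e by simp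
  then have "\<exists>v\<in>solenoidal_polys L. l2_norm L (\<lambda>x. u x - v x) < sqrt e" using u by (simp add: H_space_def)
  then obtain v where v: "v \<in> solenoidal_polys L" "l2_norm L (\<lambda>x. u x - v x) < sqrt e" by (rule bexE)
  have vL: "v \<in> L2 L" using H_imp_L2[OF solenoidal_in_H[OF v(1)]] .
  have "(l2_norm L (\<lambda>x. u x - v x))\<^sup>2 < (sqrt e)\<^sup>2"
    using v(2) l2_norm_nonneg by (intro power_strict_mono) auto
  then have "(l2_norm L (\<lambda>x. u x - v x))\<^sup>2 < e" using e by simp
  then have "mass L (\<lambda>x. cf u c x - cf v c x) < e" for c
    using mass_le_l2_norm[OF L2_diff[OF H_imp_L2[OF u] vL], of c] unfolding cf_diff by linarith
  then show ?thesis using v(1) by (intro that)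
qed

lemma H_poly_limit:
  assumes u: "u \<in> H_space L" shows "poly_limit L (cf u c)"
  unfolding poly_limit_def
proof (intro conjI allI impI)
  show "sq_integrable L (cf u c)" by (rule L2_imp_sq_integrable[OF H_imp_L2[OF u]])
  fix e :: real assume "0 < e"
  then obtain v where v: "v \<in> solenoidal_polys L" "\<And>c. mass L (\<lambda>x. cf u c x - cf v c x) < e"
    using H_approx[OF u] by blast
  have "cf v c \<in> trig_span L" using v(1) by (intro trig_polys_span) (simp add: solenoidal_polys_def)
  then obtain F d where F: "finite F" "\<And>x. cf v c x = (\<Sum>k\<in>F. d k * wave L k x)"
    using trig_span_finite_sum by blast
  show "\<exists>F d. finite F \<and> mass L (\<lambda>x. cf u c x - (\<Sum>k\<in>F. d k * wave L k x)) < e"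
    using v(2)[of c] F(1) unfolding F(2) by blast
qed

lemma fc_le_mass:
  assumes "L > 0" "sq_integrable L f" shows "(cmod (fc L f k))\<^sup>2 \<le> mass L f / L\<^sup>2"
  using Bessel[OF assms, of "{k}"] by simp

lemma H_coefficients:
  assumes L: "L > 0" and u: "u \<in> H_space L"
  shows "fc L (cf u c) 0 = 0" and "of_int (fst k) * fc L (cf u 1) k + of_int (snd k) * fc L (cf u 2) k = 0"
proof -
  have su: "sq_integrable L (cf u c)" for c by (rule L2_imp_sq_integrable[OF H_imp_L2[OF u]])
  have approx: "\<exists>v\<in>solenoidal_polys L. \<forall>c k. cmod (fc L (cf u c) k - fc L (cf v c) k) \<le> s" if s: "0 < s" for s
  proof -
    have "0 < s\<^sup>2 * L\<^sup>2" using s L by simp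
    then obtain v where v: "v \<in> solenoidal_polys L" "\<And>c. mass L (\<lambda>x. cf u c x - cf v c x) < s\<^sup>2 * L\<^sup>2"
      using H_approx[OF u] by blast
    have sv: "sq_integrable L (cf v c)" for c by (rule L2_imp_sq_integrable[OF H_imp_L2[OF solenoidal_in_H[OF v(1)]]])
    have "cmod (fc L (cf u c) k - fc L (cf v c) k) \<le> s" for c k
    proof -
      have "(cmod (fc L (cf u c) k - fc L (cf v c) k))\<^sup>2 \<le> mass L (\<lambda>x. cf u c x - cf v c x) / L\<^sup>2"
        unfolding fc_diff[OF su sv, symmetric] by (rule fc_le_mass[OF L sq_integrable_diff[OF su sv]])
      also have "\<dots> \<le> (s\<^sup>2 * L\<^sup>2) / L\<^sup>2" using v(2)[of c] by (intro divide_right_mono) auto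
      also have "\<dots> = s\<^sup>2" using L by simp
      finally show ?thesis using s by (simp add: power2_le_iff_abs_le)
    qed
    then show ?thesis using v(1) by blast
  qed
  have "cmod (fc L (cf u c) 0) \<le> 0"
  proof (rule field_le_epsilon)
    fix s :: real assume "0 < s"
    then obtain v where "v \<in> solenoidal_polys L" "cmod (fc L (cf u c) 0 - fc L (cf v c) 0) \<le> s" using approx by blast
    then show "cmod (fc L (cf u c) 0) \<le> 0 + s" using solenoidal_coefficients(1)[OF L] by simp
  qed
  then show "fc L (cf u c) 0 = 0" by simp
  let ?a = "of_int (fst k) :: complex" and ?b = "of_int (snd k) :: complex"
  have "cmod (?a * fc L (cf u 1) k + ?b * fc L (cf u 2) k) \<le> 0"
  proof (rule field_le_epsilon)
    fix r :: real assume r: "0 < r"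
    define C where "C = cmod ?a + cmod ?b + 1"
    have C: "0 < C" by (simp add: C_def add_nonneg_pos)
    have "0 < r / C" using r C by simp
    then obtain v where v: "v \<in> solenoidal_polys L" "\<And>c. cmod (fc L (cf u c) k - fc L (cf v c) k) \<le> r / C"
      using approx by blast
    have "?a * fc L (cf u 1) k + ?b * fc L (cf u 2) k =
        ?a * (fc L (cf u 1) k - fc L (cf v 1) k) + ?b * (fc L (cf u 2) k - fc L (cf v 2) k)"
      using solenoidal_coefficients(2)[OF L v(1), of k] by (simp add: algebra_simps)
    also have "cmod \<dots> \<le> cmod ?a * (r / C) + cmod ?b * (r / C)"
      by (intro order_trans[OF norm_triangle_ineq] add_mono) (auto simp only: norm_mult intro!: mult_left_mono v(2) norm_ge_zero)
    also have "\<dots> \<le> C * (r / C)"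
      using r C unfolding distrib_right[symmetric] by (intro mult_right_mono) (auto simp: C_def)
    also have "\<dots> = r" using C by simp
    finally show "cmod (?a * fc L (cf u 1) k + ?b * fc L (cf u 2) k) \<le> 0 + r" by simp
  qed
  then show "?a * fc L (cf u 1) k + ?b * fc L (cf u 2) k = 0" by simp
qed

lemma H_vort:
  assumes L: "L > 0" and u: "u \<in> H_space L"
  shows "fc L (cf u 1) k = - \<i> * of_int (snd k) * vort L u k / of_real (n2 k)"
    and "fc L (cf u 2) k = \<i> * of_int (fst k) * vort L u k / of_real (n2 k)"
    and "(cmod (vort L u k))\<^sup>2 = n2 k * ((cmod (fc L (cf u 1) k))\<^sup>2 + (cmod (fc L (cf u 2) k))\<^sup>2)"
proof -
  define a b :: real where "a = of_int (fst k)" and "b = of_int (snd k)"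
  define p q where "p = fc L (cf u 1) k" and "q = fc L (cf u 2) k"
  have z: "of_real a * p + of_real b * q = 0" using H_coefficients(2)[OF L u, of k] by (simp add: a_def b_def p_def q_def)
  have v: "vort L u k = - \<i> * (of_real a * q - of_real b * p)" by (simp add: vort_def a_def b_def p_def q_def)
  have n: "n2 k = a\<^sup>2 + b\<^sup>2" by (simp add: n2_def a_def b_def)
  show "(cmod (vort L u k))\<^sup>2 = n2 k * ((cmod (fc L (cf u 1) k))\<^sup>2 + (cmod (fc L (cf u 2) k))\<^sup>2)"
  proof -
    have "(cmod (of_real a * q - of_real b * p))\<^sup>2 + (cmod (of_real a * p + of_real b * q))\<^sup>2 = n2 k * ((cmod p)\<^sup>2 + (cmod q)\<^sup>2)"
      unfolding cmod_power2 n by (simp add: power2_eq_square algebra_simps)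
    then show ?thesis unfolding z v p_def[symmetric] q_def[symmetric] by (simp add: norm_mult norm_minus_commute)
  qed
  have "fc L (cf u 1) k = - \<i> * of_real b * vort L u k / of_real (n2 k) \<and> fc L (cf u 2) k = \<i> * of_real a * vort L u k / of_real (n2 k)"
  proof (cases "k = 0")
    case True
    then show ?thesis using H_coefficients(1)[OF L u] by simp
  next
    case False
    then have nz: "complex_of_real (n2 k) \<noteq> 0" by simp
    have "of_real (n2 k) * p = of_real a * (of_real a * p + of_real b * q) - of_real b * (of_real a * q - of_real b * p)"
      unfolding n by (simp add: power2_eq_square algebra_simps)
    also have "\<dots> = - \<i> * of_real b * vort L u k" unfolding z v by (simp add: algebra_simps)
    finally have P: "of_real (n2 k) * p = - \<i> * of_real b * vort L u k" .
    have "of_real (n2 k) * q = of_real b * (of_real a * p + of_real b * q) + of_real a * (of_real a * q - of_real b * p)"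
      unfolding n by (simp add: power2_eq_square algebra_simps)
    also have "\<dots> = \<i> * of_real a * vort L u k" unfolding z v by (simp add: algebra_simps)
    finally have Q: "of_real (n2 k) * q = \<i> * of_real a * vort L u k" .
    show ?thesis unfolding p_def[symmetric] q_def[symmetric] P[symmetric] Q[symmetric] using nz by simp
  qed
  then show "fc L (cf u 1) k = - \<i> * of_int (snd k) * vort L u k / of_real (n2 k)"
    "fc L (cf u 2) k = \<i> * of_int (fst k) * vort L u k / of_real (n2 k)" by (simp_all add: a_def b_def)
qed

lemma vort_0 [simp]: "vort L u 0 = 0"
  by (simp add: vort_def)

lemma fc_cf_uminus: "fc L (cf u c) (- k) = cnj (fc L (cf u c) k)"
proof -
  have "(\<integral>x. cf u c x * cnj (wave L (- k) x) \<partial>cell L) = (\<integral>x. cnj (cf u c x * cnj (wave L k x)) \<partial>cell L)"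
    by (simp add: wave_uminus cf_def)
  also have "\<dots> = cnj (\<integral>x. cf u c x * cnj (wave L k x) \<partial>cell L)" by (rule Bochner_Integration.integral_cnj)
  finally show ?thesis by (simp add: fc_def)
qed

lemma vort_uminus: "vort L u (- k) = cnj (vort L u k)"
  by (simp add: vort_def fc_cf_uminus algebra_simps)

lemma vort_diff:
  assumes "u \<in> L2 L" "v \<in> L2 L" shows "vort L (\<lambda>x. u x - v x) k = vort L u k - vort L v k"
  unfolding vort_def cf_diff fc_diff[OF assms[THEN L2_imp_sq_integrable]] by (simp add: algebra_simps)

lemma vort_sq_le: "(cmod (vort L u k))\<^sup>2 \<le> n2 k * ((cmod (fc L (cf u 1) k))\<^sup>2 + (cmod (fc L (cf u 2) k))\<^sup>2)"
proof -
  define a b :: real where "a = of_int (fst k)" and "b = of_int (snd k)"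
  define p q where "p = fc L (cf u 1) k" and "q = fc L (cf u 2) k"
  have "(cmod (of_real a * q - of_real b * p))\<^sup>2 + (cmod (of_real a * p + of_real b * q))\<^sup>2 = (a\<^sup>2 + b\<^sup>2) * ((cmod p)\<^sup>2 + (cmod q)\<^sup>2)"
    unfolding cmod_power2 by (simp add: power2_eq_square algebra_simps)
  then have "(cmod (of_real a * q - of_real b * p))\<^sup>2 \<le> (a\<^sup>2 + b\<^sup>2) * ((cmod p)\<^sup>2 + (cmod q)\<^sup>2)"
    using zero_le_power2[of "cmod (of_real a * p + of_real b * q)"] by linarith
  then show ?thesis by (simp add: vort_def n2_def a_def b_def p_def q_def norm_mult norm_minus_commute)
qed

lemma vort_energy:
  assumes L: "L > 0" and u: "u \<in> L2 L"
  shows "(\<lambda>k. (cmod (vort L u k))\<^sup>2 / n2 k) summable_on UNIV" "energy (vort L u) \<le> (l2_norm L u)\<^sup>2 / L\<^sup>2"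
proof -
  have le: "(cmod (vort L u k))\<^sup>2 / n2 k \<le> (cmod (fc L (cf u 1) k))\<^sup>2 + (cmod (fc L (cf u 2) k))\<^sup>2" for k
  proof (cases "k = 0")
    case False
    then have "0 < n2 k" by (simp add: less_le)
    then show ?thesis using vort_sq_le[of L u k] by (simp add: divide_le_eq mult.commute)
  qed simp
  note B = Bessel_summable[OF L L2_imp_sq_integrable[OF u]]
  show s: "(\<lambda>k. (cmod (vort L u k))\<^sup>2 / n2 k) summable_on UNIV"
    by (rule summable_on_comparison_test[OF summable_on_add[OF B(1) B(1)] le]) simp
  have "energy (vort L u) \<le> (\<Sum>\<^sub>\<infinity>k. (cmod (fc L (cf u 1) k))\<^sup>2 + (cmod (fc L (cf u 2) k))\<^sup>2)"
    unfolding energy_def by (intro infsum_mono s summable_on_add B le)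
  also have "\<dots> \<le> (l2_norm L u)\<^sup>2 / L\<^sup>2"
    unfolding infsum_add[OF B(1) B(1)] l2_norm_sq[OF u] add_divide_distrib by (intro add_mono B)
  finally show "energy (vort L u) \<le> (l2_norm L u)\<^sup>2 / L\<^sup>2" .
qed

lemma vort_le_l2_norm:
  assumes L: "L > 0" and u: "u \<in> L2 L"
  shows "(cmod (vort L u k))\<^sup>2 \<le> n2 k * ((l2_norm L u)\<^sup>2 / L\<^sup>2)"
proof -
  have "(cmod (fc L (cf u 1) k))\<^sup>2 + (cmod (fc L (cf u 2) k))\<^sup>2 \<le> (l2_norm L u)\<^sup>2 / L\<^sup>2"
    unfolding l2_norm_sq[OF u] add_divide_distrib by (intro add_mono fc_le_mass L L2_imp_sq_integrable u)
  then show ?thesis using vort_sq_le[of L u k] mult_left_mono[OF _ n2_nonneg] order_trans by blast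
qed

lemma vort_scaleR: "vort L (\<lambda>x. r *\<^sub>R u x) k = of_real r * vort L u k"
proof -
  have "cf (\<lambda>x. r *\<^sub>R u x) c = (\<lambda>x. of_real r * cf u c x)" for c by (simp add: cf_def fun_eq_iff)
  then show ?thesis by (simp add: vort_def fc_cmult algebra_simps)
qed

lemma H_vort_zero_imp:
  assumes L: "L > 0" and u: "u \<in> H_space L" and z: "\<And>k. vort L u k = 0"
  shows "AE x in cell L. u x = 0"
proof -
  have "AE x in cell L. u x $ c = 0" for c
  proof (rule coefficients_zero_imp_AE_zero[OF L])
    show "sq_integrable L (\<lambda>x. complex_of_real (u x $ c))"
      using L2_imp_sq_integrable[OF H_imp_L2[OF u], of c] by (simp add: cf_def[abs_def])
    show "fc L (\<lambda>x. complex_of_real (u x $ c)) k = 0" for k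
      using H_vort(1,2)[OF L u, of k] z[of k] exhaust_2[of c] by (auto simp: cf_def[abs_def])
  qed
  from this[of 1] this[of 2] show ?thesis by eventually_elim (simp add: vec_eq_iff forall_2)
qed

lemma l2_inner_component_fields:
  assumes L: "L > 0" and u: "u \<in> L2 L"
  shows "l2_inner L u (\<lambda>x. cos (ph L k x) *\<^sub>R axis c 1) = L\<^sup>2 * Re (fc L (cf u c) k)"
    and "l2_inner L u (\<lambda>x. sin (ph L k x) *\<^sub>R axis c 1) = - L\<^sup>2 * Im (fc L (cf u c) k)"
proof -
  have i: "integrable (cell L) (\<lambda>x. cf u c x * cnj (wave L k x))" by (rule fc_integrable[OF L2_imp_sq_integrable[OF u]])
  have e: "(\<integral>x. cf u c x * cnj (wave L k x) \<partial>cell L) = of_real (L\<^sup>2) * fc L (cf u c) k" using L by (simp add: fc_def)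
  have "l2_inner L u (\<lambda>x. cos (ph L k x) *\<^sub>R axis c 1) = (\<integral>x. Re (cf u c x * cnj (wave L k x)) \<partial>cell L)"
    unfolding l2_inner_def cf_def wave_def by (intro Bochner_Integration.integral_cong refl) (simp add: inner_axis mult.commute)
  then show "l2_inner L u (\<lambda>x. cos (ph L k x) *\<^sub>R axis c 1) = L\<^sup>2 * Re (fc L (cf u c) k)"
    unfolding integral_Re[OF i] e by (simp add: power2_eq_square)
  have "l2_inner L u (\<lambda>x. sin (ph L k x) *\<^sub>R axis c 1) = (\<integral>x. - Im (cf u c x * cnj (wave L k x)) \<partial>cell L)"
    unfolding l2_inner_def cf_def wave_def by (intro Bochner_Integration.integral_cong refl) (simp add: inner_axis mult.commute)
  also have "\<dots> = - Im (\<integral>x. cf u c x * cnj (wave L k x) \<partial>cell L)" unfolding integral_Im[OF i, symmetric] by (rule Bochner_Integration.integral_minus)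
  finally show "l2_inner L u (\<lambda>x. sin (ph L k x) *\<^sub>R axis c 1) = - L\<^sup>2 * Im (fc L (cf u c) k)"
    unfolding e by (simp add: power2_eq_square)
qed

lemma l2_inner_scaleR_right: "l2_inner L u (\<lambda>x. r *\<^sub>R v x) = r * l2_inner L u v"
  by (simp add: l2_inner_def)

lemma l2_inner_commute: "l2_inner L u v = l2_inner L v u"
  by (simp add: l2_inner_def inner_commute)

lemma fc_weak_partial:
  assumes L: "L > 0" and w: "weak_partial L j u w"
  shows "fc L (cf w c) k = \<i> * of_real (2 * pi / L * kc k j) * fc L (cf u c) k"
proof -
  let ?K = "{vector [fst k, snd k] :: int^2}" and ?r = "2 * pi / L * kc k j"
  let ?C = "\<lambda>x. cos (ph L k x) *\<^sub>R (axis c 1 :: real^2)" and ?S = "\<lambda>x. sin (ph L k x) *\<^sub>R (axis c 1 :: real^2)"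
  have eq: "?C = trig_poly L ?K (\<lambda>_. axis c 1) (\<lambda>_. 0)" "?S = trig_poly L ?K (\<lambda>_. 0) (\<lambda>_. axis c 1)"
    by (simp_all add: fun_eq_iff phase_ph pr_vector)
  have t: "?C \<in> trig_polys L" "?S \<in> trig_polys L" unfolding eq by (simp_all only: trig_polysI finite.intros)
  have p: "partial j ?C = (\<lambda>x. - ?r *\<^sub>R ?S x)" "partial j ?S = (\<lambda>x. ?r *\<^sub>R ?C x)"
    unfolding eq by (subst partial_trig_poly; simp add: fun_eq_iff phase_ph pr_vector mult_ac)+
  have uw: "u \<in> L2 L" "w \<in> L2 L" and test: "\<And>\<phi>. \<phi> \<in> trig_polys L \<Longrightarrow> l2_inner L u (partial j \<phi>) = - l2_inner L w \<phi>"
    using w by (auto simp: weak_partial_def)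
  have 1: "?r * (L\<^sup>2 * Im (fc L (cf u c) k)) = - (L\<^sup>2 * Re (fc L (cf w c) k))"
    using test[OF t(1)] unfolding p l2_inner_scaleR_right l2_inner_component_fields[OF L uw(1)] l2_inner_component_fields[OF L uw(2)]
    by simp
  have 2: "?r * (L\<^sup>2 * Re (fc L (cf u c) k)) = L\<^sup>2 * Im (fc L (cf w c) k)"
    using test[OF t(2)] unfolding p l2_inner_scaleR_right l2_inner_component_fields[OF L uw(1)] l2_inner_component_fields[OF L uw(2)]
    by simp
  have L2: "L\<^sup>2 \<noteq> 0" using L by simp
  have "L\<^sup>2 * Re (fc L (cf w c) k) = L\<^sup>2 * (- ?r * Im (fc L (cf u c) k))" using 1 by (simp add: mult_ac)
  then have R: "Re (fc L (cf w c) k) = - ?r * Im (fc L (cf u c) k)" by (rule mult_left_cancel[OF L2, THEN iffD1])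
  have "L\<^sup>2 * Im (fc L (cf w c) k) = L\<^sup>2 * (?r * Re (fc L (cf u c) k))" using 2 by (simp add: mult_ac)
  then have I: "Im (fc L (cf w c) k) = ?r * Re (fc L (cf u c) k)" by (rule mult_left_cancel[OF L2, THEN iffD1])
  show ?thesis by (rule complex_eqI) (use R I in simp_all)
qed

lemma vort_weak_partial:
  assumes L: "L > 0" and w: "weak_partial L j u w"
  shows "vort L w k = \<i> * of_real (2 * pi / L * kc k j) * vort L u k"
  unfolding vort_def fc_weak_partial[OF assms] by (simp add: algebra_simps)

lemma vort_partial:
  assumes L: "L > 0" and v: "v \<in> trig_polys L"
  shows "vort L (partial j v) k = \<i> * of_real (2 * pi / L * kc k j) * vort L v k"
  unfolding vort_def fc_partial[OF assms] by (simp add: algebra_simps)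

lemma l2_inner_test:
  assumes L: "L > 0" and u: "u \<in> L2 L"
  shows "l2_inner L u (cos_field L k) = - L\<^sup>2 * Im (vort L u k)"
    and "l2_inner L u (sin_field L k) = - L\<^sup>2 * Re (vort L u k)"
  by (rule l2_inner_test_fields[OF L sq_integrable_imp_integrable[OF L2_imp_sq_integrable[OF u]]])+

lemma weak_partial_test_fields:
  assumes L: "L > 0"
  shows "weak_partial L j (cos_field L k) (partial j (cos_field L k))" "weak_partial L j (sin_field L k) (partial j (sin_field L k))"
proof -
  have t: "cos_field L k \<in> L2 L" "sin_field L k \<in> L2 L" "partial j (cos_field L k) \<in> L2 L" "partial j (sin_field L k) \<in> L2 L"
    by (intro trig_polys_L2 partial_trig_polys test_fields_trig_polys)+
  have "l2_inner L (cos_field L k) (partial j \<phi>) = - l2_inner L (partial j (cos_field L k)) \<phi>"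
    "l2_inner L (sin_field L k) (partial j \<phi>) = - l2_inner L (partial j (sin_field L k)) \<phi>" if f: "\<phi> \<in> trig_polys L" for \<phi>
  proof -
    note p = trig_polys_L2[OF f] trig_polys_L2[OF partial_trig_polys[OF f]]
    show "l2_inner L (cos_field L k) (partial j \<phi>) = - l2_inner L (partial j (cos_field L k)) \<phi>"
      unfolding l2_inner_commute[of L _ \<phi>] l2_inner_commute[of L _ "partial j \<phi>"] partial_test_fields l2_inner_scaleR_right
        l2_inner_test[OF L p(1)] l2_inner_test[OF L p(2)] vort_partial[OF L f] by simp
    show "l2_inner L (sin_field L k) (partial j \<phi>) = - l2_inner L (partial j (sin_field L k)) \<phi>"
      unfolding l2_inner_commute[of L _ \<phi>] l2_inner_commute[of L _ "partial j \<phi>"] partial_test_fields l2_inner_scaleR_right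
        l2_inner_test[OF L p(1)] l2_inner_test[OF L p(2)] vort_partial[OF L f] by simp
  qed
  then show "weak_partial L j (cos_field L k) (partial j (cos_field L k))" "weak_partial L j (sin_field L k) (partial j (sin_field L k))"
    unfolding weak_partial_def using t by blast+
qed

lemma weak_partial_unique:
  assumes L: "L > 0" and w: "weak_partial L j u w" "weak_partial L j u w'"
  shows "AE x in cell L. w x = w' x"
proof -
  have i: "w \<in> L2 L" "w' \<in> L2 L" using w by (auto simp: weak_partial_def)
  have "AE x in cell L. (w x - w' x) $ c = 0" for c
  proof (rule coefficients_zero_imp_AE_zero[OF L])
    show "sq_integrable L (\<lambda>x. complex_of_real ((w x - w' x) $ c))"
      using L2_imp_sq_integrable[OF L2_diff[OF i], of c] by (simp only: cf_def[abs_def])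
    have "fc L (cf (\<lambda>x. w x - w' x) c) k = 0" for k
      unfolding cf_diff fc_diff[OF i[THEN L2_imp_sq_integrable]] fc_weak_partial[OF L w(1)] fc_weak_partial[OF L w(2)] by simp
    then show "fc L (\<lambda>x. complex_of_real ((w x - w' x) $ c)) k = 0" for k by (simp only: cf_def[abs_def])
  qed
  from this[of 1] this[of 2] show ?thesis by eventually_elim (simp add: vec_eq_iff forall_2)
qed

lemma wpartial: "\<exists>w. weak_partial L j u w \<Longrightarrow> weak_partial L j u (wpartial L j u)"
  using someI_ex[of "weak_partial L j u"] by (simp add: wpartial_def)

lemma l2_inner_wpartial_test_field:
  assumes L: "L > 0" and w: "w \<in> L2 L"
    and p: "weak_partial L j \<phi> (partial j \<phi>)"
  shows "l2_inner L w (wpartial L j \<phi>) = l2_inner L w (partial j \<phi>)"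
proof -
  have q: "weak_partial L j \<phi> (wpartial L j \<phi>)" using p by (intro wpartial exI)
  have m: "w \<in> borel_measurable (cell L)" "wpartial L j \<phi> \<in> borel_measurable (cell L)" "partial j \<phi> \<in> borel_measurable (cell L)"
    using w p q by (auto simp: weak_partial_def L2_def)
  show ?thesis unfolding l2_inner_def
  proof (rule integral_cong_AE)
    show "AE x in cell L. w x \<bullet> wpartial L j \<phi> x = w x \<bullet> partial j \<phi> x"
      using weak_partial_unique[OF L q p] by eventually_elim simp
  qed (use m in measurable)
qed

context
  fixes L :: real and u :: field2
  assumes L: "L > 0" and u: "u \<in> V_space L"
begin

lemma V_wpartial: "weak_partial L j u (wpartial L j u)"
  using u by (intro wpartial) (simp add: V_space_def)

lemma V_in_H: "u \<in> H_space L"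
  using u by (simp add: V_space_def)

lemma wpartial_L2: "wpartial L j u \<in> L2 L"
  using V_wpartial by (simp add: weak_partial_def)

lemma stokes_dual_test_fields:
  "stokes_dual L u (cos_field L k) = - L\<^sup>2 * ((2 * pi / L)\<^sup>2 * n2 k * Im (vort L u k))"
  "stokes_dual L u (sin_field L k) = - L\<^sup>2 * ((2 * pi / L)\<^sup>2 * n2 k * Re (vort L u k))"
  unfolding stokes_dual_def
    l2_inner_wpartial_test_field[OF L wpartial_L2 weak_partial_test_fields(1)[OF L]]
    l2_inner_wpartial_test_field[OF L wpartial_L2 weak_partial_test_fields(2)[OF L]]
    partial_test_fields l2_inner_scaleR_right l2_inner_test[OF L wpartial_L2] vort_weak_partial[OF L V_wpartial]
  by (simp_all add: UNIV_2 n2_def power2_eq_square algebra_simps)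

lemma vort_enstrophy:
  "(\<lambda>k. (cmod (vort L u k))\<^sup>2) summable_on UNIV" "enstrophy (vort L u) \<le> stokes_dual L u u / (2 * pi)\<^sup>2"
proof -
  let ?\<kappa> = "2 * pi / L"
  have "(\<Sum>k\<in>F. (cmod (vort L u k))\<^sup>2) \<le> stokes_dual L u u / (2 * pi)\<^sup>2" if F: "finite F" for F
  proof -
    have eq: "?\<kappa>\<^sup>2 * (cmod (vort L u k))\<^sup>2 = (\<Sum>j\<in>UNIV. (cmod (fc L (cf (wpartial L j u) 1) k))\<^sup>2 + (cmod (fc L (cf (wpartial L j u) 2) k))\<^sup>2)" for k
      unfolding fc_weak_partial[OF L V_wpartial] H_vort(3)[OF L V_in_H]
      by (simp add: UNIV_2 norm_mult power_mult_distrib n2_def algebra_simps norm_divide power_divide)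
    have "?\<kappa>\<^sup>2 * (\<Sum>k\<in>F. (cmod (vort L u k))\<^sup>2)
       = (\<Sum>j\<in>UNIV. (\<Sum>k\<in>F. (cmod (fc L (cf (wpartial L j u) 1) k))\<^sup>2) + (\<Sum>k\<in>F. (cmod (fc L (cf (wpartial L j u) 2) k))\<^sup>2))"
      unfolding sum_distrib_left eq by (subst sum.swap) (simp add: sum.distrib)
    also have "\<dots> \<le> (\<Sum>j\<in>UNIV. mass L (cf (wpartial L j u) 1) / L\<^sup>2 + mass L (cf (wpartial L j u) 2) / L\<^sup>2)"
      by (intro sum_mono add_mono Bessel L F L2_imp_sq_integrable wpartial_L2)
    also have "\<dots> = stokes_dual L u u / L\<^sup>2"
    proof -
      have "l2_inner L w w = mass L (cf w 1) + mass L (cf w 2)" if "w \<in> L2 L" for w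
      proof -
        have "0 \<le> l2_inner L w w" by (simp add: l2_inner_def integral_nonneg)
        then have "l2_inner L w w = (l2_norm L w)\<^sup>2" by (simp add: l2_norm_def)
        then show ?thesis by (simp add: l2_norm_sq[OF that])
      qed
      then show ?thesis unfolding stokes_dual_def using wpartial_L2 by (simp add: sum_divide_distrib add_divide_distrib)
    qed
    finally show ?thesis using L by (simp add: power_divide field_simps)
  qed
  note le = this
  show s: "(\<lambda>k. (cmod (vort L u k))\<^sup>2) summable_on UNIV"
    using le by (intro nonneg_bdd_above_summable_on) (auto intro!: bdd_aboveI)
  show "enstrophy (vort L u) \<le> stokes_dual L u u / (2 * pi)\<^sup>2"
    unfolding enstrophy_def using le by (intro infsum_le_finite_sums s) auto
qed

end

lemma conv_summable:
  assumes P: "(\<lambda>k. (cmod (x k))\<^sup>2) summable_on UNIV"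
  shows "(\<lambda>j. norm (of_real (crs j (k - j) / n2 j) * (x j * x (k - j)))) summable_on UNIV"
    and "norm (conv x k) \<le> sqrt (n2 k) * enstrophy x"
proof -
  let ?f = "\<lambda>j. of_real (crs j (k - j) / n2 j) * (x j * x (k - j))"
  have b: "bij (\<lambda>j. k - j)" by (rule bij_betw_byWitness[where f' = "\<lambda>j. k - j"]) auto
  have P': "(\<lambda>j. (cmod (x (k - j)))\<^sup>2) summable_on UNIV"
    using summable_on_reindex_bij_betw[OF b, of "\<lambda>j. (cmod (x j))\<^sup>2"] P by simp
  have iP': "(\<Sum>\<^sub>\<infinity>j. (cmod (x (k - j)))\<^sup>2) = enstrophy x"
    unfolding enstrophy_def by (rule infsum_reindex_bij_betw[OF b])
  have le: "norm (?f j) \<le> sqrt (n2 k) * ((1/2) * (cmod (x j))\<^sup>2 + (1/2) * (cmod (x (k - j)))\<^sup>2)" for j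
  proof (cases "j = 0")
    case False
    have c: "crs j (k - j) = crs j k" by (simp add: crs_def algebra_simps)
    have "1 \<le> sqrt (n2 j)" using n2_ge_1[OF False] by simp
    moreover have "\<bar>crs j k\<bar> / n2 j \<le> sqrt (n2 j) * sqrt (n2 k) / n2 j" by (intro divide_right_mono abs_crs_le) simp
    moreover have "sqrt (n2 j) * sqrt (n2 k) / n2 j = sqrt (n2 k) / sqrt (n2 j)"
      using False by (simp add: field_simps)
    moreover have "sqrt (n2 k) / sqrt (n2 j) \<le> sqrt (n2 k) / 1" using \<open>1 \<le> sqrt (n2 j)\<close> by (intro divide_left_mono) auto
    ultimately have cr: "\<bar>crs j k\<bar> / n2 j \<le> sqrt (n2 k)" by simp
    have "norm (?f j) = (\<bar>crs j k\<bar> / n2 j) * (cmod (x j) * cmod (x (k - j)))"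
      by (simp add: norm_mult norm_divide c)
    also have "\<dots> \<le> sqrt (n2 k) * ((1/2) * (cmod (x j))\<^sup>2 + (1/2) * (cmod (x (k - j)))\<^sup>2)"
      using sum_squares_bound[of "cmod (x j)" "cmod (x (k - j))"] by (intro mult_mono cr) auto
    finally show ?thesis .
  qed simp
  have sb: "(\<lambda>j. sqrt (n2 k) * ((1/2) * (cmod (x j))\<^sup>2 + (1/2) * (cmod (x (k - j)))\<^sup>2)) summable_on UNIV"
    by (intro summable_on_cmult_right summable_on_add P P')
  show s: "(\<lambda>j. norm (?f j)) summable_on UNIV"
    by (rule summable_on_comparison_test[OF sb]) (use le in auto)
  have "norm (conv x k) \<le> (\<Sum>\<^sub>\<infinity>j. norm (?f j))" unfolding conv_def by (rule norm_infsum_bound[OF s])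
  also have "\<dots> \<le> (\<Sum>\<^sub>\<infinity>j. sqrt (n2 k) * ((1/2) * (cmod (x j))\<^sup>2 + (1/2) * (cmod (x (k - j)))\<^sup>2))"
    by (intro infsum_mono s sb le)
  also have "\<dots> = sqrt (n2 k) * ((1/2) * enstrophy x + (1/2) * enstrophy x)"
    unfolding infsum_cmult_right' infsum_add[OF summable_on_cmult_right[OF P] summable_on_cmult_right[OF P']] iP'
    by (simp add: enstrophy_def)
  finally show "norm (conv x k) \<le> sqrt (n2 k) * enstrophy x" by simp
qed

lemma vort_convection:
  assumes L: "L > 0" and u: "u \<in> V_space L"
  shows "vort L (convection L u u) k = - of_real (2 * pi / L) * conv (vort L u) k"
    and "integrable (cell L) (cf (convection L u u) c)"
proof -
  let ?w = "\<lambda>j. wpartial L j u" and ?\<omega> = "vort L u" and ?\<kappa> = "complex_of_real (2 * pi / L)"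
  note H = V_in_H[OF L u] and W = V_wpartial[OF L u]
  have su: "sq_integrable L (cf u j)" for j by (rule L2_imp_sq_integrable[OF H_imp_L2[OF H]])
  have sw: "sq_integrable L (cf (?w j) c)" for j c by (rule L2_imp_sq_integrable[OF wpartial_L2[OF L u]])
  have pi: "integrable (cell L) (\<lambda>x. cf u j x * cf (?w j) c x)" for j c by (rule sq_integrable_mult(1)[OF su sw])
  have cc: "cf (convection L u u) c = (\<lambda>x. cf u 1 x * cf (?w 1) c x + cf u 2 x * cf (?w 2) c x)" for c
    by (simp add: fun_eq_iff cf_def convection_def UNIV_2)
  show "integrable (cell L) (cf (convection L u u) c)" unfolding cc by (intro Bochner_Integration.integrable_add pi)
  have fcc: "fc L (cf (convection L u u) c) k = fc L (\<lambda>x. cf u 1 x * cf (?w 1) c x) k + fc L (\<lambda>x. cf u 2 x * cf (?w 2) c x) k" for c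
    unfolding cc fc_def distrib_right
    by (subst Bochner_Integration.integral_add) (auto intro!: fc_integrable' pi simp: add_divide_distrib)
  have hs: "((\<lambda>m. fc L (cf u j) m * (\<i> * of_real (2 * pi / L * kc (k - m) j) * fc L (cf u c) (k - m))) has_sum fc L (\<lambda>x. cf u j x * cf (?w j) c x) k) UNIV" for j c
    using fc_product[OF L H_poly_limit[OF H, of j] sw[of j c], of k] unfolding fc_weak_partial[OF L W] .
  define t where "t m = - \<i> * (of_int (fst k) * (fc L (cf u 1) m * (\<i> * of_real (2 * pi / L * kc (k - m) 1) * fc L (cf u 2) (k - m))
      + fc L (cf u 2) m * (\<i> * of_real (2 * pi / L * kc (k - m) 2) * fc L (cf u 2) (k - m)))
    + - of_int (snd k) * (fc L (cf u 1) m * (\<i> * of_real (2 * pi / L * kc (k - m) 1) * fc L (cf u 1) (k - m))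
      + fc L (cf u 2) m * (\<i> * of_real (2 * pi / L * kc (k - m) 2) * fc L (cf u 1) (k - m))))" for m
  have ht: "(t has_sum vort L (convection L u u) k) UNIV"
  proof -
    have v: "vort L (convection L u u) k = - \<i> * (of_int (fst k) * fc L (cf (convection L u u) 2) k + - of_int (snd k) * fc L (cf (convection L u u) 1) k)"
      by (simp add: vort_def)
    show ?thesis unfolding t_def v fcc by (intro has_sum_cmult_right has_sum_add hs)
  qed
  define s1 where "s1 m = of_real (crs m (k - m) / n2 m) * (?\<omega> m * ?\<omega> (k - m))" for m
  define s2 where "s2 m = of_real (crs m (k - m) * (of_int (fst m) * of_int (fst (k - m)) + of_int (snd m) * of_int (snd (k - m))) / (n2 m * n2 (k - m))) * (?\<omega> m * ?\<omega> (k - m))" for m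
  have teq: "t m = - ?\<kappa> * (s1 m + s2 m)" for m
  proof -
    define l where "l = k - m"
    have k: "k = m + l" by (simp add: l_def)
    define a b c d :: complex where "a = of_int (fst m)" and "b = of_int (snd m)" and "c = of_int (fst l)" and "d = of_int (snd l)"
    define p q where "p = ?\<omega> m / of_real (n2 m)" and "q = ?\<omega> l / of_real (n2 l)"
    have um: "fc L (cf u 1) m = - \<i> * b * p" "fc L (cf u 2) m = \<i> * a * p" "fc L (cf u 1) l = - \<i> * d * q" "fc L (cf u 2) l = \<i> * c * q"
      using H_vort(1,2)[OF L H, of m] H_vort(1,2)[OF L H, of l] by (simp_all add: a_def b_def c_def d_def p_def q_def)
    have id: "- \<i> * ((a + c) * ((- \<i> * b * p) * (\<i> * (K * c) * (\<i> * c * q)) + (\<i> * a * p) * (\<i> * (K * d) * (\<i> * c * q)))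
        + - (b + d) * ((- \<i> * b * p) * (\<i> * (K * c) * (- \<i> * d * q)) + (\<i> * a * p) * (\<i> * (K * d) * (- \<i> * d * q))))
      = - K * ((a * d - b * c) * ((a + c) * c + (b + d) * d) * (p * q))" for K
    proof -
      have "\<i> * \<i> = -1" by simp
      then show ?thesis by algebra
    qed
    have kk: "of_int (fst k) = a + c" "of_int (snd k) = b + d" by (simp_all add: k a_def b_def c_def d_def)
    have kl: "complex_of_real (2 * pi / L * kc l 1) = ?\<kappa> * c" "complex_of_real (2 * pi / L * kc l 2) = ?\<kappa> * d"
      by (simp_all add: c_def d_def)
    have "t m = - ?\<kappa> * ((a * d - b * c) * ((a + c) * c + (b + d) * d) * (p * q))"
      unfolding t_def l_def[symmetric] um kk kl by (rule id)
    also have "(a + c) * c + (b + d) * d = (a * c + b * d) + of_real (n2 l)"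
      by (simp add: c_def d_def n2_def power2_eq_square algebra_simps)
    also have "(a * d - b * c) * ((a * c + b * d) + of_real (n2 l)) * (p * q) = s1 m + s2 m"
    proof (cases "l = 0")
      case True
      then show ?thesis by (simp add: s1_def s2_def l_def[symmetric] c_def d_def crs_def)
    next
      case False
      then have nl: "complex_of_real (n2 l) \<noteq> 0" by simp
      have cr: "complex_of_real (crs m l) = a * d - b * c" by (simp add: crs_def a_def b_def c_def d_def)
      have "s1 m = (a * d - b * c) * of_real (n2 l) * (p * q)"
        unfolding s1_def l_def[symmetric] p_def q_def of_real_divide cr using nl by simp
      moreover have "s2 m = (a * d - b * c) * (a * c + b * d) * (p * q)"
        unfolding s2_def l_def[symmetric] p_def q_def of_real_divide of_real_mult cr
        by (simp add: a_def b_def c_def d_def)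
      ultimately show ?thesis by (simp only: distrib_left distrib_right add.commute)
    qed
    finally show ?thesis .
  qed
  have sum1: "s1 summable_on UNIV"
    unfolding s1_def by (rule abs_summable_summable[OF conv_summable(1)[OF vort_enstrophy(1)[OF L u]]])
  have \<kappa>: "?\<kappa> \<noteq> 0" using L by simp
  have s2e: "s2 m = (- 1 / ?\<kappa>) * t m + (- 1) * s1 m" for m unfolding teq using \<kappa> by simp
  then have sum2: "s2 summable_on UNIV"
    unfolding s2e[abs_def] by (intro summable_on_add summable_on_cmult_right has_sum_imp_summable[OF ht] sum1)
  have z2: "(\<Sum>\<^sub>\<infinity>m. s2 m) = 0"
  proof -
    have b: "bij (\<lambda>j. k - j)" by (rule bij_betw_byWitness[where f' = "\<lambda>j. k - j"]) auto
    have "s2 (k - m) = - s2 m" for m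
    proof -
      have "crs (k - m) (k - (k - m)) = - crs m (k - m)" by (simp add: crs_def)
      then show ?thesis by (simp add: s2_def mult_ac)
    qed
    then have "(\<Sum>\<^sub>\<infinity>m. s2 (k - m)) = - (\<Sum>\<^sub>\<infinity>m. s2 m)" by (simp add: infsum_uminus)
    moreover have "(\<Sum>\<^sub>\<infinity>m. s2 (k - m)) = (\<Sum>\<^sub>\<infinity>m. s2 m)" by (rule infsum_reindex_bij_betw[OF b])
    ultimately show ?thesis by simp
  qed
  have "vort L (convection L u u) k = (\<Sum>\<^sub>\<infinity>m. t m)" using infsumI[OF ht] by simp
  also have "\<dots> = - ?\<kappa> * ((\<Sum>\<^sub>\<infinity>m. s1 m) + (\<Sum>\<^sub>\<infinity>m. s2 m))"
    unfolding teq infsum_cmult_right' infsum_add[OF sum1 sum2] ..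
  also have "(\<Sum>\<^sub>\<infinity>m. s1 m) = conv ?\<omega> k" by (simp add: conv_def s1_def)
  finally show "vort L (convection L u u) k = - of_real (2 * pi / L) * conv (vort L u) k" using z2 by simp
qed

section \<open>From weak solutions to the Fourier equations\<close>


lemma stokes_eigenfield_shell:
  assumes L: "L > 0" and st: "stokes L g (\<lambda>x. lam *\<^sub>R g x)" and k: "vort L g k \<noteq> 0"
  shows "n2 k = lam / (2 * pi / L)\<^sup>2"
proof -
  obtain w where wl: "weak_laplacian L g w" and lp: "leray_proj L (\<lambda>x. - w x) (\<lambda>x. lam *\<^sub>R g x)"
    using st by (auto simp: stokes_def)
  have gL: "g \<in> L2 L" and wL: "w \<in> L2 L"
    and wt: "\<And>\<phi>. \<phi> \<in> trig_polys L \<Longrightarrow> l2_inner L g (laplacian \<phi>) = l2_inner L w \<phi>"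
    using wl by (auto simp: weak_laplacian_def)
  have mL: "(\<lambda>x. - w x) \<in> L2 L" and lgH: "(\<lambda>x. lam *\<^sub>R g x) \<in> H_space L"
    and orth: "\<And>v. v \<in> H_space L \<Longrightarrow> l2_inner L (\<lambda>x. - w x - lam *\<^sub>R g x) v = 0"
    using lp by (auto simp: leray_proj_def)
  have dL: "(\<lambda>x. - w x - lam *\<^sub>R g x) \<in> L2 L" by (rule L2_diff[OF mL H_imp_L2[OF lgH]])
  define q where "q = (2 * pi / L)\<^sup>2 * n2 k"
  have L2: "L\<^sup>2 \<noteq> 0" using L by simp
  have vd: "vort L (\<lambda>x. - w x - lam *\<^sub>R g x) k = - vort L w k - of_real lam * vort L g k"
    unfolding vort_diff[OF mL H_imp_L2[OF lgH]] vort_scaleR using vort_scaleR[of L "-1" w k] by simp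
  have "vort L (\<lambda>x. - w x - lam *\<^sub>R g x) k = 0"
    using orth[OF solenoidal_in_H[OF test_fields_solenoidal(1)[OF L]], of k] orth[OF solenoidal_in_H[OF test_fields_solenoidal(2)[OF L]], of k] L2
    unfolding l2_inner_test[OF L dL] by (simp add: complex_eq_iff)
  then have w1: "of_real lam * vort L g k = - vort L w k" unfolding vd by (simp only: eq_iff_diff_eq_0[symmetric])
  have "L\<^sup>2 * Im (vort L w k) = L\<^sup>2 * (- q * Im (vort L g k))"
    using wt[OF test_fields_trig_polys(1), of k]
    unfolding laplacian_test_fields l2_inner_scaleR_right l2_inner_test[OF L gL] l2_inner_test[OF L wL] q_def[symmetric]
    by (simp add: algebra_simps)
  then have i: "Im (vort L w k) = - q * Im (vort L g k)" by (rule mult_left_cancel[OF L2, THEN iffD1])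
  have "L\<^sup>2 * Re (vort L w k) = L\<^sup>2 * (- q * Re (vort L g k))"
    using wt[OF test_fields_trig_polys(2), of k]
    unfolding laplacian_test_fields l2_inner_scaleR_right l2_inner_test[OF L gL] l2_inner_test[OF L wL] q_def[symmetric]
    by (simp add: algebra_simps)
  then have r: "Re (vort L w k) = - q * Re (vort L g k)" by (rule mult_left_cancel[OF L2, THEN iffD1])
  have "vort L w k = - of_real q * vort L g k" by (rule complex_eqI) (use i r in simp_all)
  with w1 have "of_real lam * vort L g k = of_real q * vort L g k" by simp
  then have "lam = q" using k by simp
  then have "lam = (2 * pi / L)\<^sup>2 * n2 k" by (simp only: q_def)
  then show ?thesis using L by simp
qed

lemma nse_solution_vorticity_flow:
  assumes L: "L > 0" and nu: "\<nu> > 0" and lam: "lam > 0" and gH: "g \<in> H_space L"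
    and st: "stokes L g (\<lambda>x. lam *\<^sub>R g x)"
    and sol: "nse_solution L \<nu> g u" and bd: "\<And>t. l2_norm L (u t) \<le> B"
  shows "vorticity_flow (\<lambda>t. vort L (u t)) (vort L g) (\<nu> * (2 * pi / L)\<^sup>2) (2 * pi / L) (lam / (2 * pi / L)\<^sup>2)
     (B\<^sup>2 / L\<^sup>2) (\<lambda>t. stokes_dual L (u t) (u t) / (2 * pi)\<^sup>2)"
proof -
  define \<kappa> where "\<kappa> = 2 * pi / L"
  define \<omega> where "\<omega> t = vort L (u t)" for t
  define e where "e t = stokes_dual L (u t) (u t) / (2 * pi)\<^sup>2" for t
  define rhs where "rhs k t = vort_rhs (\<nu> * \<kappa>\<^sup>2) \<kappa> (vort L g) (\<omega> t) k" for k t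
  have k0: "0 < \<kappa>" using L by (simp add: \<kappa>_def)
  have uH: "u t \<in> H_space L" for t using sol by (simp add: nse_solution_def)
  have uL: "u t \<in> L2 L" for t by (rule H_imp_L2[OF uH])
  have ucont: "((\<lambda>s. l2_norm L (\<lambda>x. u s x - u t x)) \<longlongrightarrow> 0) (at t)" for t using sol by (simp add: nse_solution_def)
  have uV: "AE t in lebesgue. u t \<in> V_space L" using sol by (simp add: nse_solution_def)
  have dint: "integrable (lebesgue_on {a..b}) (\<lambda>t. stokes_dual L (u t) (u t))" for a b using sol by (simp add: nse_solution_def)
  have eq: "l2_inner L (u b) \<phi> - l2_inner L (u a) \<phi>
        + (\<integral>t. \<nu> * stokes_dual L (u t) \<phi> + B_dual L (u t) (u t) \<phi> \<partial>lebesgue_on {a..b})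
        = (b - a) * l2_inner L g \<phi>" if "\<phi> \<in> solenoidal_polys L" "a \<le> b" for \<phi> a b
    using sol that by (simp add: nse_solution_def)
  have eint: "integrable (lebesgue_on {a..b}) e" for a b
    unfolding e_def[abs_def] using dint[of a b] by (rule integrable_divide)
  have uVon: "AE t in lebesgue_on {a..b}. u t \<in> V_space L" for a b
  proof -
    have S: "{a..b} \<inter> space lebesgue \<in> sets lebesgue" by simp
    show ?thesis unfolding AE_restrict_space_iff[OF S] by (rule eventually_mono[OF uV]) blast
  qed
  have wd: "\<omega> s k - \<omega> t k = vort L (\<lambda>x. u s x - u t x) k" for s t k
    unfolding \<omega>_def by (rule vort_diff[OF uL uL, symmetric])
  have mode_cont: "continuous_on S (\<lambda>t. \<omega> t k)" for S k
  proof -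
    have "isCont (\<lambda>t. \<omega> t k) t" for t
    proof -
      have "((\<lambda>s. sqrt (n2 k * ((l2_norm L (\<lambda>x. u s x - u t x))\<^sup>2 / L\<^sup>2))) \<longlongrightarrow> sqrt (n2 k * (0\<^sup>2 / L\<^sup>2))) (at t)"
        using L by (intro tendsto_intros ucont) auto
      then have "((\<lambda>s. sqrt (n2 k * ((l2_norm L (\<lambda>x. u s x - u t x))\<^sup>2 / L\<^sup>2))) \<longlongrightarrow> 0) (at t)" by simp
      then have "((\<lambda>s. \<omega> s k - \<omega> t k) \<longlongrightarrow> 0) (at t)"
      proof (rule Lim_null_comparison[rotated])
        show "eventually (\<lambda>s. norm (\<omega> s k - \<omega> t k) \<le> sqrt (n2 k * ((l2_norm L (\<lambda>x. u s x - u t x))\<^sup>2 / L\<^sup>2))) (at t)"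
          unfolding wd by (intro always_eventually allI real_le_rsqrt vort_le_l2_norm L L2_diff uL)
      qed
      then show ?thesis unfolding isCont_def using LIM_zero_iff by blast
    qed
    then show ?thesis by (simp add: continuous_at_imp_continuous_on)
  qed
  have mode_int: "integrable (lebesgue_on {a..b}) (\<lambda>t. \<omega> t k)" for a b k
    by (intro absolutely_integrable_imp_integrable absolutely_integrable_continuous_real mode_cont) simp
  have ens: "(\<lambda>k. (cmod (\<omega> t k))\<^sup>2) summable_on UNIV \<and> enstrophy (\<omega> t) \<le> e t" if "u t \<in> V_space L" for t
    unfolding \<omega>_def e_def using vort_enstrophy[OF L that] by simp
  have conv_int: "integrable (lebesgue_on {a..b}) (\<lambda>t. conv (\<omega> t) k)" for a b k
  proof (rule Bochner_Integration.integrable_bound)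
    show "integrable (lebesgue_on {a..b}) (\<lambda>t. sqrt (n2 k) * e t)" using eint by (rule integrable_mult_right)
    show "(\<lambda>t. conv (\<omega> t) k) \<in> borel_measurable (lebesgue_on {a..b})"
    proof (rule borel_measurable_lebesgue_on_lim)
      show "(\<lambda>t. \<Sum>j\<in>ibox n. complex_of_real (crs j (k - j) / n2 j) * (\<omega> t j * \<omega> t (k - j))) \<in> borel_measurable (lebesgue_on {a..b})" for n
        by (intro continuous_imp_measurable_on_sets_lebesgue continuous_on_sum continuous_on_mult continuous_on_const mode_cont) simp
      show "AE t in lebesgue_on {a..b}. (\<lambda>n. \<Sum>j\<in>ibox n. complex_of_real (crs j (k - j) / n2 j) * (\<omega> t j * \<omega> t (k - j))) \<longlonglongrightarrow> conv (\<omega> t) k"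
        using uVon[of a b]
      proof eventually_elim
        case (elim t)
        show ?case unfolding conv_def
          by (rule has_sum_ibox[OF has_sum_infsum[OF abs_summable_summable[OF conv_summable(1)]]]) (use ens[OF elim] in blast)
      qed
    qed simp
    show "AE t in lebesgue_on {a..b}. norm (conv (\<omega> t) k) \<le> norm (sqrt (n2 k) * e t)"
      using uVon[of a b]
    proof eventually_elim
      case (elim t)
      have "norm (conv (\<omega> t) k) \<le> sqrt (n2 k) * enstrophy (\<omega> t)" using ens[OF elim] by (intro conv_summable(2)) blast
      also have "\<dots> \<le> sqrt (n2 k) * e t" using ens[OF elim] by (intro mult_left_mono) auto
      finally show ?case by (metis abs_ge_self order_trans real_norm_def)
    qed
  qed
  have rhs_int: "integrable (lebesgue_on {a..b}) (rhs k)" for a b k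
  proof -
    interpret finite_measure "lebesgue_on {a..b}" by (rule finite_measure_lebesgue_on) simp
    show ?thesis unfolding rhs_def[abs_def] vort_rhs_def
      by (intro Bochner_Integration.integrable_add Bochner_Integration.integrable_diff integrable_mult_right mode_int conv_int integrable_const)
  qed
  have rhs_ai: "rhs k absolutely_integrable_on {a..b}" for a b k
    using rhs_int[of a b k] by (simp add: set_integrable_def integrable_restrict_space)
  have flux: "\<nu> * stokes_dual L (u t) (cos_field L k) + B_dual L (u t) (u t) (cos_field L k) = L\<^sup>2 * Im (rhs k t - vort L g k)"
    "\<nu> * stokes_dual L (u t) (sin_field L k) + B_dual L (u t) (u t) (sin_field L k) = L\<^sup>2 * Re (rhs k t - vort L g k)"
    if V: "u t \<in> V_space L" for t k
    unfolding stokes_dual_test_fields[OF L V] B_dual_def l2_inner_test_fields[OF L vort_convection(2)[OF L V]] vort_convection(1)[OF L V]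
      rhs_def vort_rhs_def \<omega>_def \<kappa>_def by (simp_all add: algebra_simps)
  have ode: "\<omega> b k - \<omega> a k = integral {a..b} (rhs k)" if ab: "a \<le> b" for a b k
  proof -
    interpret finite_measure "lebesgue_on {a..b}" by (rule finite_measure_lebesgue_on) simp
    let ?I = "integral\<^sup>L (lebesgue_on {a..b})"
    have di: "integrable (lebesgue_on {a..b}) (\<lambda>t. rhs k t - vort L g k)"
      by (intro Bochner_Integration.integrable_diff rhs_int integrable_const)
    have dI: "?I (\<lambda>t. rhs k t - vort L g k) = ?I (rhs k) - of_real (b - a) * vort L g k"
      using ab rhs_int by (subst Bochner_Integration.integral_diff) (auto simp: measure_restrict_space scaleR_conv_of_real)
    have m: "(\<lambda>t. L\<^sup>2 * Im (rhs k t - vort L g k)) \<in> borel_measurable (lebesgue_on {a..b})"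
      "(\<lambda>t. L\<^sup>2 * Re (rhs k t - vort L g k)) \<in> borel_measurable (lebesgue_on {a..b})"
      by (rule borel_measurable_integrable[OF integrable_mult_right[OF integrable_Im[OF di]]],
          rule borel_measurable_integrable[OF integrable_mult_right[OF integrable_Re[OF di]]])
    have aeC: "AE t in lebesgue_on {a..b}. L\<^sup>2 * Im (rhs k t - vort L g k) = \<nu> * stokes_dual L (u t) (cos_field L k) + B_dual L (u t) (u t) (cos_field L k)"
      using uVon[of a b] by eventually_elim (simp only: flux)
    have aeS: "AE t in lebesgue_on {a..b}. L\<^sup>2 * Re (rhs k t - vort L g k) = \<nu> * stokes_dual L (u t) (sin_field L k) + B_dual L (u t) (u t) (sin_field L k)"
      using uVon[of a b] by eventually_elim (simp only: flux)
    have C: "?I (\<lambda>t. \<nu> * stokes_dual L (u t) (cos_field L k) + B_dual L (u t) (u t) (cos_field L k)) = L\<^sup>2 * Im (?I (rhs k) - of_real (b - a) * vort L g k)"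
    proof -
      have "?I (\<lambda>t. L\<^sup>2 * Im (rhs k t - vort L g k)) = ?I (\<lambda>t. \<nu> * stokes_dual L (u t) (cos_field L k) + B_dual L (u t) (u t) (cos_field L k))"
        by (rule integral_cong_AE[OF m(1) borel_measurable_lebesgue_on_AE[OF _ m(1) aeC] aeC]) simp
      then show ?thesis unfolding integral_mult_right_zero integral_Im[OF di] dI by simp
    qed
    have S: "?I (\<lambda>t. \<nu> * stokes_dual L (u t) (sin_field L k) + B_dual L (u t) (u t) (sin_field L k)) = L\<^sup>2 * Re (?I (rhs k) - of_real (b - a) * vort L g k)"
    proof -
      have "?I (\<lambda>t. L\<^sup>2 * Re (rhs k t - vort L g k)) = ?I (\<lambda>t. \<nu> * stokes_dual L (u t) (sin_field L k) + B_dual L (u t) (u t) (sin_field L k))"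
        by (rule integral_cong_AE[OF m(2) borel_measurable_lebesgue_on_AE[OF _ m(2) aeS] aeS]) simp
      then show ?thesis unfolding integral_mult_right_zero integral_Re[OF di] dI by simp
    qed
    have L2: "L\<^sup>2 \<noteq> 0" using L by simp
    have "L\<^sup>2 * Im (\<omega> b k - \<omega> a k) = L\<^sup>2 * Im (?I (rhs k))"
      using eq[OF test_fields_solenoidal(1)[OF L] ab, of k] unfolding C l2_inner_test[OF L uL] l2_inner_test[OF L H_imp_L2[OF gH]] \<omega>_def
      by (simp add: algebra_simps)
    then have i: "Im (\<omega> b k - \<omega> a k) = Im (?I (rhs k))" by (rule mult_left_cancel[OF L2, THEN iffD1])
    have "L\<^sup>2 * Re (\<omega> b k - \<omega> a k) = L\<^sup>2 * Re (?I (rhs k))"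
      using eq[OF test_fields_solenoidal(2)[OF L] ab, of k] unfolding S l2_inner_test[OF L uL] l2_inner_test[OF L H_imp_L2[OF gH]] \<omega>_def
      by (simp add: algebra_simps)
    then have r: "Re (\<omega> b k - \<omega> a k) = Re (?I (rhs k))" by (rule mult_left_cancel[OF L2, THEN iffD1])
    have "?I (rhs k) = integral {a..b} (rhs k)" by (rule lebesgue_integral_eq_integral[OF rhs_int]) simp
    then show ?thesis using complex_eqI[OF r i] by simp
  qed
  have "vorticity_flow \<omega> (vort L g) (\<nu> * \<kappa>\<^sup>2) \<kappa> (lam / \<kappa>\<^sup>2) (B\<^sup>2 / L\<^sup>2) e"
  proof
    show "0 < \<nu> * \<kappa>\<^sup>2" "0 < lam / \<kappa>\<^sup>2" using nu lam k0 by simp_all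
    show "\<omega> t 0 = 0" "\<omega> t (- k) = cnj (\<omega> t k)" for t k by (simp_all add: \<omega>_def vort_uminus)
    show "(\<lambda>k. (cmod (\<omega> t k))\<^sup>2 / n2 k) summable_on UNIV" for t unfolding \<omega>_def by (rule vort_energy(1)[OF L uL])
    show "energy (\<omega> t) \<le> B\<^sup>2 / L\<^sup>2" for t
    proof -
      have "energy (\<omega> t) \<le> (l2_norm L (u t))\<^sup>2 / L\<^sup>2" unfolding \<omega>_def by (rule vort_energy(2)[OF L uL])
      also have "\<dots> \<le> B\<^sup>2 / L\<^sup>2" by (intro divide_right_mono power_mono bd l2_norm_nonneg) simp
      finally show ?thesis .
    qed
    show "((\<lambda>s. energy (\<lambda>k. \<omega> s k - \<omega> t k)) \<longlongrightarrow> 0) (at t)" for t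
    proof -
      have "((\<lambda>s. (l2_norm L (\<lambda>x. u s x - u t x))\<^sup>2 / L\<^sup>2) \<longlongrightarrow> 0\<^sup>2 / L\<^sup>2) (at t)"
        using L by (intro tendsto_intros ucont) auto
      then have *: "((\<lambda>s. (l2_norm L (\<lambda>x. u s x - u t x))\<^sup>2 / L\<^sup>2) \<longlongrightarrow> 0) (at t)" by simp
      show ?thesis
      proof (rule tendsto_sandwich[OF _ _ tendsto_const *])
        show "eventually (\<lambda>s. 0 \<le> energy (\<lambda>k. \<omega> s k - \<omega> t k)) (at t)"
          by (simp add: energy_def infsum_nonneg)
        show "eventually (\<lambda>s. energy (\<lambda>k. \<omega> s k - \<omega> t k) \<le> (l2_norm L (\<lambda>x. u s x - u t x))\<^sup>2 / L\<^sup>2) (at t)"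
          unfolding wd by (intro always_eventually allI vort_energy(2) L L2_diff uL)
      qed
    qed
    show "AE t in lebesgue. (\<lambda>k. (cmod (\<omega> t k))\<^sup>2) summable_on UNIV \<and> enstrophy (\<omega> t) \<le> e t"
      by (rule eventually_mono[OF uV]) (rule ens)
    show "integrable (lebesgue_on {a..b}) e" for a b by (rule eint)
    show "(\<lambda>t. vort_rhs (\<nu> * \<kappa>\<^sup>2) \<kappa> (vort L g) (\<omega> t) k) absolutely_integrable_on {a..b}" for k a b
      using rhs_ai[where k = k and a = a and b = b] by (simp add: rhs_def[abs_def])
    show "\<omega> b k - \<omega> a k = integral {a..b} (\<lambda>t. vort_rhs (\<nu> * \<kappa>\<^sup>2) \<kappa> (vort L g) (\<omega> t) k)" if "a \<le> b" for k a b
      using ode[OF that, of k] by (simp add: rhs_def[abs_def])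
    show "n2 k = lam / \<kappa>\<^sup>2" if "vort L g k \<noteq> 0" for k
      unfolding \<kappa>_def by (rule stokes_eigenfield_shell[OF L st that])
  qed
  then show ?thesis unfolding \<omega>_def[abs_def] e_def[abs_def] \<kappa>_def .
qed

theorem mainTheorem5:
  fixes L \<nu> lam :: real and g :: "real^2 \<Rightarrow> real^2"
  assumes "L > 0" and "\<nu> > 0"
    and "g \<in> H_space L" and "\<not> (AE x in cell L. g x = 0)"
    and "lam > 0" and "stokes L g (\<lambda>x. lam *\<^sub>R g x)"
  shows "(\<lambda>x. 0) \<notin> global_attractor L \<nu> g"
proof
  assume "(\<lambda>x. 0) \<in> global_attractor L \<nu> g"
  then obtain u where sol: "nse_solution L \<nu> g u" and u0: "u 0 = (\<lambda>x. 0)"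
    and bd: "bdd_above (range (\<lambda>t. l2_norm L (u t)))"
    by (auto simp: global_attractor_def)
  obtain B where "\<And>t. l2_norm L (u t) \<le> B" using bd by (auto simp: bdd_above_def)
  then interpret vorticity_flow "\<lambda>t. vort L (u t)" "vort L g" "\<nu> * (2 * pi / L)\<^sup>2" "2 * pi / L" "lam / (2 * pi / L)\<^sup>2"
     "B\<^sup>2 / L\<^sup>2" "\<lambda>t. stokes_dual L (u t) (u t) / (2 * pi)\<^sup>2"
    by (intro nse_solution_vorticity_flow assms sol)
  have "vort L (u 0) k = 0" for k by (simp add: u0 vort_def fc_def cf_def)
  then have "vort L g k = 0" for k by (rule forcing_vanishes)
  then have "AE x in cell L. g x = 0" by (rule H_vort_zero_imp[OF assms(1,3)])
  with assms(4) show False ..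
qed

end
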